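(* For every positive integer $t$, there is an algorithm that, given an $n$-vertex graph $G$ that does not contain $K_1+tK_2$ as an induced minor, computes a maximum independent set of $G$ in time $n^{O(t^5)}$.
   Context: An independent set is a set of pairwise non-adjacent vertices. A graph $H$ is an induced minor of $G$ if $H$ can be obtained from $G$ by a sequence of vertex deletions and edge contractions. $tK_2$ denotes the disjoint union of $t$ edges, and $K_1+tK_2$ (the friendship graph) is the join of a single vertex with $tK_2$, i.e., $t$ pairwise disjoint, non-adjacent edges together with a $(2t+1)$-st vertex adjacent to all $2t$ endpoints. The constant hidden in $O(\cdot)$ does not depend on $t$ or $n$. *)

theory Defs
  imports Main "HOL-Library.Ramsey"
begin

section \<open>Graphs and induced minors\<close>

type_synonym 'a ugraph = "'a set \<times> 'a set set"

definition simple_graph :: "'a ugraph \<Rightarrow> bool" where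
  "simple_graph G \<longleftrightarrow> finite (fst G) \<and> snd G \<subseteq> nsets (fst G) 2"

definition graph_iso :: "'a ugraph \<Rightarrow> 'b ugraph \<Rightarrow> bool" where
  "graph_iso G H \<longleftrightarrow>
     (\<exists>f. bij_betw f (fst G) (fst H) \<and>
          (\<forall>u\<in>fst G. \<forall>v\<in>fst G. {u, v} \<in> snd G \<longleftrightarrow> {f u, f v} \<in> snd H))"

definition delete_vertex :: "'a \<Rightarrow> 'a ugraph \<Rightarrow> 'a ugraph" where
  "delete_vertex v G = (fst G - {v}, {e \<in> snd G. v \<notin> e})"

text \<open>Contracting the edge \<open>uv\<close>: the merged vertex keeps the name \<open>u\<close>;
  the loop is discarded and parallel edges coincide, so that the result is again simple.\<close>

definition contract_edge :: "'a \<Rightarrow> 'a \<Rightarrow> 'a ugraph \<Rightarrow> 'a ugraph" where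
  "contract_edge u v G =
     (fst G - {v}, {e \<in> snd G. v \<notin> e} \<union> {{u, w} | w. {v, w} \<in> snd G \<and> w \<noteq> u})"

inductive induced_minor_step :: "'a ugraph \<Rightarrow> 'a ugraph \<Rightarrow> bool" where
  delete: "v \<in> fst G \<Longrightarrow> induced_minor_step G (delete_vertex v G)"
| contract: "{u, v} \<in> snd G \<Longrightarrow> induced_minor_step G (contract_edge u v G)"

definition induced_minor :: "'a ugraph \<Rightarrow> 'b ugraph \<Rightarrow> bool" where
  "induced_minor H G \<longleftrightarrow> (\<exists>G'. induced_minor_step\<^sup>*\<^sup>* G G' \<and> graph_iso H G')"

text \<open>The friendship graph \<open>K\<^sub>1 + t K\<^sub>2\<close>: vertex \<open>0\<close> is the centre, and the
  \<open>i\<close>-th copy of \<open>K\<^sub>2\<close> has the ends \<open>2 i + 1\<close> and \<open>2 i + 2\<close>.\<close>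

definition friendship_graph :: "nat \<Rightarrow> nat ugraph" where
  "friendship_graph t =
     ({0..2 * t}, {{0, i} | i. i \<in> {1..2 * t}} \<union> {{2 * i + 1, 2 * i + 2} | i. i < t})"

definition independent_set :: "'a ugraph \<Rightarrow> 'a set \<Rightarrow> bool" where
  "independent_set G S \<longleftrightarrow> S \<subseteq> fst G \<and> indep S (snd G)"

definition maximum_independent_set :: "'a ugraph \<Rightarrow> 'a set \<Rightarrow> bool" where
  "maximum_independent_set G S \<longleftrightarrow>
     independent_set G S \<and> (\<forall>S'. independent_set G S' \<longrightarrow> card S' \<le> card S)"

lemma simple_graph_delete_vertex:
  "simple_graph G \<Longrightarrow> simple_graph (delete_vertex v G)"
  by (auto simp: simple_graph_def delete_vertex_def nsets_def)

lemma simple_graph_contract_edge: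
  assumes "simple_graph G" and "{u, v} \<in> snd G"
  shows "simple_graph (contract_edge u v G)"
proof -
  have e: "x \<in> fst G \<and> y \<in> fst G \<and> x \<noteq> y" if "{x, y} \<in> snd G" for x y
  proof -
    from that assms(1) have "{x, y} \<subseteq> fst G" and c: "card {x, y} = 2"
      by (auto simp: simple_graph_def nsets_def)
    moreover from c have "x \<noteq> y" by auto
    ultimately show ?thesis by simp
  qed
  have "f \<in> nsets (fst G - {v}) 2" if "f \<in> snd (contract_edge u v G)" for f
    using that assms e[OF assms(2)]
    by (auto simp: simple_graph_def contract_edge_def nsets_def card_insert_if dest: e)
  then show ?thesis
    using assms(1) by (auto simp: simple_graph_def contract_edge_def)
qed

lemma simple_graph_friendship_graph: "simple_graph (friendship_graph t)"
  by (auto simp: simple_graph_def friendship_graph_def nsets_def card_insert_if)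


section \<open>Random access machines\<close>

text \<open>Algorithms are structured programs for a random access machine with registers (named
  by the program, hence finitely many in each program) and a memory that is addressed
  indirectly. Every instruction and every test takes one unit of time. Since addition and
  (truncated) subtraction are the only arithmetic operations, the maximal bit length of
  the numbers (constants of the program aside) grows by at most one per step, so this uniform cost measure is polynomially related to
  the logarithmic cost measure and to the running time of Turing machines.\<close>

type_synonym reg = nat

datatype prog =
    Skip
  | Const reg nat
  | Copy reg reg
  | Add reg reg reg
  | Sub reg reg reg
  | Load reg reg
  | Store reg reg
  | Seq prog prog
  | IfNZ reg prog prog
  | WhileNZ reg prog

text \<open>A state consists of the register contents and the memory contents.\<close>

type_synonym state = "(reg \<Rightarrow> nat) \<times> (nat \<Rightarrow> nat)"

text \<open>\<open>exec P s k s'\<close>: started in \<open>s\<close>, the program \<open>P\<close> halts in \<open>s'\<close> after exactly \<open>k\<close>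
  steps.\<close>

inductive exec :: "prog \<Rightarrow> state \<Rightarrow> nat \<Rightarrow> state \<Rightarrow> bool" where
  Skip: "exec Skip s 1 s"
| Const: "exec (Const x c) (r, m) 1 (r(x := c), m)"
| Copy: "exec (Copy x y) (r, m) 1 (r(x := r y), m)"
| Add: "exec (Add x y z) (r, m) 1 (r(x := r y + r z), m)"
| Sub: "exec (Sub x y z) (r, m) 1 (r(x := r y - r z), m)"
| Load: "exec (Load x y) (r, m) 1 (r(x := m (r y)), m)"
| Store: "exec (Store x y) (r, m) 1 (r, m(r x := r y))"
| Seq: "exec P s k s' \<Longrightarrow> exec Q s' l s'' \<Longrightarrow> exec (Seq P Q) s (k + l) s''"
| IfTrue: "fst s x \<noteq> 0 \<Longrightarrow> exec P s k s' \<Longrightarrow> exec (IfNZ x P Q) s (1 + k) s'"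
| IfFalse: "fst s x = 0 \<Longrightarrow> exec Q s k s' \<Longrightarrow> exec (IfNZ x P Q) s (1 + k) s'"
| WhileTrue: "fst s x \<noteq> 0 \<Longrightarrow> exec P s k s' \<Longrightarrow> exec (WhileNZ x P) s' l s'' \<Longrightarrow>
    exec (WhileNZ x P) s (1 + k + l) s''"
| WhileFalse: "fst s x = 0 \<Longrightarrow> exec (WhileNZ x P) s 1 s"

inductive_cases exec_elims:
  "exec Skip s k s'" "exec (Const x c) s k s'" "exec (Copy x y) s k s'"
  "exec (Add x y z) s k s'" "exec (Sub x y z) s k s'"
  "exec (Load x y) s k s'" "exec (Store x y) s k s'"
  "exec (Seq P Q) s k s'" "exec (IfNZ x P Q) s k s'" "exec (WhileNZ x P) s k s'"

lemma exec_deterministic: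
  "exec P s k s' \<Longrightarrow> exec P s k1 s1 \<Longrightarrow> k = k1 \<and> s' = s1"
proof (induction arbitrary: k1 s1 rule: exec.induct)
  case (Seq P s k s' Q l s'')
  from Seq.prems obtain i u j where "exec P s i u" "exec Q u j s1" "k1 = i + j"
    by (rule exec_elims)
  with Seq.IH show ?case by blast
next
  case (WhileTrue s x P k s' l s'')
  from WhileTrue.prems show ?case
  proof (rule exec_elims)
    fix i u j
    assume k1: "k1 = Suc (i + j)" and P: "exec P s i u" and W: "exec (WhileNZ x P) u j s1"
    from WhileTrue.IH(1)[OF P] have "k = i" "s' = u" by simp_all
    with WhileTrue.IH(2)[of j s1] W k1 show ?thesis by simp
  qed (use WhileTrue.hyps(1) in simp)
next
  case (IfTrue s x P k s' Q)
  from IfTrue.prems show ?case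
    by (rule exec_elims) (use IfTrue.hyps(1) in \<open>auto dest: IfTrue.IH\<close>)
next
  case (IfFalse s x Q k s' P)
  from IfFalse.prems show ?case
    by (rule exec_elims) (use IfFalse.hyps(1) in \<open>auto dest: IfFalse.IH\<close>)
next
  case (WhileFalse s x P)
  from WhileFalse.prems show ?case
    by (rule exec_elims) (use WhileFalse.hyps in auto)
qed (erule exec_elims, simp)+

text \<open>A graph on the vertices \<open>0, \<dots>, n - 1\<close> is given by \<open>n\<close> in register \<open>0\<close> and its adjacency
  matrix, row by row, in the memory cells \<open>0, \<dots>, n\<^sup>2 - 1\<close>; everything else is \<open>0\<close>. A vertex
  set is returned as its characteristic vector in the memory cells \<open>0, \<dots>, n - 1\<close>.\<close>

definition graph_input :: "nat \<Rightarrow> nat set set \<Rightarrow> state" where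
  "graph_input n E =
     ((\<lambda>_. 0)(0 := n), \<lambda>a. if a < n * n \<and> {a div n, a mod n} \<in> E then 1 else 0)"

definition set_output :: "nat \<Rightarrow> state \<Rightarrow> nat set" where
  "set_output n s = {v. v < n \<and> snd s v = 1}"

end

theory Submission
  imports Defs "HOL-Library.Disjoint_Sets"
begin

text \<open>
  If a connected set \<open>S\<close> has \<open>t\<close> pairwise anticomplete edges inside its neighbourhood, then contracting \<open>S\<close>
  exhibits \<open>K\<^sub>1 + t K\<^sub>2\<close> as an induced minor. Only this obstruction (a hub) is used.

  Vertices of degree at most one can be put into a maximum independent set greedily, so let the
  minimum degree be at least two. Then an induced matching all of whose edges meet a closed
  neighbourhood \<open>N[v]\<close> has only \<open>O(t\<^sup>2)\<close> edges, and hence a maximal independent set \<open>I\<close> leaves only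
  \<open>n\<close> to the \<open>O(|X| t\<^sup>2)\<close> possible traces on \<open>N[X]\<close>: the trace is recovered from \<open>O(|X| t\<^sup>2)\<close> pairs of vertices.

  Grow an induced path \<open>P\<close> into a component \<open>D\<close> of the graph without \<open>N[P]\<close>. At most \<open>3 t\<close> vertices of \<open>P\<close> have
  neighbours in \<open>N(D)\<close>, for otherwise \<open>D\<close> together with pieces of \<open>P\<close> is a hub; so \<open>N(D)\<close> is dominated by
  a set \<open>X\<close> of at most \<open>3 t\<close> vertices. Extending \<open>P\<close> towards \<open>D\<close> splits \<open>D\<close> into smaller components of the same
  kind. Dynamic programming over all \<open>(X, D, trace)\<close> finds a maximum independent set in time
  \<open>n\<close> to the \<open>O(t\<^sup>3)\<close>.
\<close>

section \<open>Connected vertex sets\<close>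

locale sgraph =
  fixes G :: "'a ugraph"
  assumes simple: "simple_graph G"
begin

abbreviation V :: "'a set" where
  "V \<equiv> fst G"

definition adj :: "'a \<Rightarrow> 'a \<Rightarrow> bool" where
  "adj x y \<longleftrightarrow> {x, y} \<in> snd G"

definition reachable :: "'a set \<Rightarrow> 'a \<Rightarrow> 'a \<Rightarrow> bool" where
  "reachable S = (\<lambda>x y. adj x y \<and> x \<in> S \<and> y \<in> S)\<^sup>*\<^sup>*"

definition connected :: "'a set \<Rightarrow> bool" where
  "connected S \<longleftrightarrow> S \<noteq> {} \<and> (\<forall>x\<in>S. \<forall>y\<in>S. reachable S x y)"

definition component :: "'a set \<Rightarrow> 'a \<Rightarrow> 'a set" where
  "component S c = {x. c \<in> S \<and> reachable S c x}"

definition touches :: "'a set \<Rightarrow> 'a set \<Rightarrow> bool" where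
  "touches S T \<longleftrightarrow> (\<exists>x\<in>S. \<exists>y\<in>T. adj x y \<or> x = y)"

definition nbhd :: "'a set \<Rightarrow> 'a set" where
  "nbhd S = {x. x \<notin> S \<and> (\<exists>y\<in>S. adj y x)}"

definition closed_nbhd :: "'a set \<Rightarrow> 'a set" where
  "closed_nbhd S = S \<union> {x. \<exists>y\<in>S. adj y x}"

lemma finite_V: "finite V"
  using simple by (simp add: simple_graph_def)

lemma adj_sym: "adj x y \<Longrightarrow> adj y x"
  by (simp add: adj_def insert_commute)

lemma adj_commute: "adj x y \<longleftrightarrow> adj y x"
  using adj_sym by blast

lemma adjD:
  assumes "adj x y"
  shows "x \<in> V" "y \<in> V" "x \<noteq> y"
proof -
  have "{x, y} \<in> nsets V 2"
    using assms simple unfolding adj_def simple_graph_def by blast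
  then have "{x, y} \<subseteq> V" "card {x, y} = 2" by (auto simp: nsets_def)
  then show "x \<in> V" "y \<in> V" "x \<noteq> y" by auto
qed

lemma adj_irrefl [simp]: "\<not> adj x x"
  using adjD(3) by blast

lemma reachable_refl [simp]: "reachable S x x"
  by (simp add: reachable_def)

lemma reachable_trans [trans]: "reachable S x y \<Longrightarrow> reachable S y z \<Longrightarrow> reachable S x z"
  by (simp add: reachable_def)

lemma reachable_sym: "reachable S x y \<Longrightarrow> reachable S y x"
  unfolding reachable_def
  by (rule sympD[OF symp_rtranclp]) (auto intro: sympI adj_sym)

lemma reachable_adj: "adj x y \<Longrightarrow> x \<in> S \<Longrightarrow> y \<in> S \<Longrightarrow> reachable S x y"
  unfolding reachable_def by blast

lemma reachable_mono: "reachable S x y \<Longrightarrow> S \<subseteq> T \<Longrightarrow> reachable T x y"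
  unfolding reachable_def by (erule rtranclp_mono[THEN predicate2D, rotated]) auto

lemma reachable_closed:
  assumes "reachable S x y" "x \<in> Y" "\<And>a b. a \<in> Y \<Longrightarrow> adj a b \<Longrightarrow> b \<in> S \<Longrightarrow> b \<in> Y"
  shows "y \<in> Y"
  using assms(1,2) unfolding reachable_def by (induction rule: rtranclp_induct) (auto intro: assms(3))

lemma connectedI: "a \<in> S \<Longrightarrow> (\<And>x. x \<in> S \<Longrightarrow> reachable S a x) \<Longrightarrow> connected S"
  unfolding connected_def using reachable_sym reachable_trans by blast

lemma connectedD: "connected S \<Longrightarrow> x \<in> S \<Longrightarrow> y \<in> S \<Longrightarrow> reachable S x y"
  by (simp add: connected_def)

lemma connected_nonempty: "connected S \<Longrightarrow> S \<noteq> {}"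
  by (simp add: connected_def)

lemma connected_singleton [simp]: "connected {a}"
  by (rule connectedI[of a]) auto

lemma connected_leaving_edge:
  assumes "connected C" "Y \<subseteq> C" "Y \<noteq> {}" "Y \<noteq> C"
  obtains a b where "a \<in> Y" "b \<in> C - Y" "adj a b"
proof -
  obtain x y where "x \<in> Y" "y \<in> C - Y" using assms by blast
  with assms have "reachable C x y" by (blast intro: connectedD)
  then show ?thesis
    using reachable_closed[of C x y Y] \<open>x \<in> Y\<close> \<open>y \<in> C - Y\<close> that by blast
qed

lemma connected_UN:
  assumes "connected S" "\<And>i. i \<in> I \<Longrightarrow> connected (Q i)" "\<And>i. i \<in> I \<Longrightarrow> touches S (Q i)"
  shows "connected (S \<union> (\<Union>i\<in>I. Q i))"
proof -
  let ?T = "S \<union> (\<Union>i\<in>I. Q i)"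
  obtain a where a: "a \<in> S" using connected_nonempty[OF assms(1)] by blast
  have in_S: "reachable ?T a x" if "x \<in> S" for x
    using connectedD[OF assms(1) a that] reachable_mono[of S a x ?T] by blast
  have "reachable ?T a x" if i: "i \<in> I" and x: "x \<in> Q i" for i x
  proof -
    obtain s q where sq: "s \<in> S" "q \<in> Q i" "adj s q \<or> s = q"
      using assms(3)[OF i] by (auto simp: touches_def)
    have "reachable ?T a s" by (rule in_S) fact
    also have "reachable ?T s q" using sq i by (cases "s = q") (auto intro!: reachable_adj)
    also have "reachable ?T q x"
      using connectedD[OF assms(2)[OF i] sq(2) x] i reachable_mono[of "Q i" q x ?T] by blast
    finally show ?thesis .
  qed
  with in_S a show ?thesis by (intro connectedI[of a]) auto
qed

lemma connected_insert: "connected S \<Longrightarrow> s \<in> S \<Longrightarrow> adj s x \<Longrightarrow> connected (insert x S)"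
  using connected_UN[of S "{()}" "\<lambda>_. {x}"] by (auto simp: touches_def)

lemma component_subset: "component S c \<subseteq> S"
  using reachable_closed[of S c _ S] by (auto simp: component_def)

lemma component_self: "c \<in> S \<Longrightarrow> c \<in> component S c"
  by (simp add: component_def)

lemma component_closed: "x \<in> component S c \<Longrightarrow> adj x y \<Longrightarrow> y \<in> S \<Longrightarrow> y \<in> component S c"
  using component_subset[of S c] unfolding component_def by (auto intro: reachable_trans reachable_adj)

lemma component_mono: "S \<subseteq> T \<Longrightarrow> component S c \<subseteq> component T c"
  using reachable_mono unfolding component_def by blast

lemma component_connected:
  assumes "c \<in> S"
  shows "connected (component S c)"
proof (rule connectedI[of c])
  show "c \<in> component S c" by (rule component_self) fact
  fix x assume "x \<in> component S c"
  then have "reachable S c x" by (simp add: component_def)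
  then show "reachable (component S c) c x"
    unfolding reachable_def
  proof (induction rule: rtranclp_induct)
    case (step y z)
    have "y \<in> component S c" "z \<in> component S c"
      using step assms unfolding component_def reachable_def by (auto intro: rtranclp.rtrancl_into_rtrancl)
    with step show ?case by (intro rtranclp.rtrancl_into_rtrancl[OF step.IH]) auto
  qed simp
qed

lemma component_eq: "y \<in> component S x \<Longrightarrow> component S y = component S x"
  using component_subset[of S x] unfolding component_def
  by (auto intro: reachable_trans reachable_sym)

lemma component_subset_closed:
  "c \<in> R \<Longrightarrow> (\<And>x y. x \<in> R \<Longrightarrow> adj x y \<Longrightarrow> y \<in> S \<Longrightarrow> y \<in> R) \<Longrightarrow> component S c \<subseteq> R"
  by (auto simp: component_def intro: reachable_closed[of S c _ R])

lemma component_eqI: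
  assumes "connected D" "D \<subseteq> S" "c \<in> D" "\<And>x y. x \<in> D \<Longrightarrow> adj x y \<Longrightarrow> y \<in> S \<Longrightarrow> y \<in> D"
  shows "component S c = D"
proof
  show "component S c \<subseteq> D" using assms(3,4) by (rule component_subset_closed)
  show "D \<subseteq> component S c"
    using assms(1-3) unfolding component_def connected_def by (auto intro: reachable_mono)
qed

end

section \<open>Friendship graphs as induced minors\<close>

context sgraph
begin

definition induced_matching :: "'b set \<Rightarrow> ('b \<Rightarrow> 'a) \<Rightarrow> ('b \<Rightarrow> 'a) \<Rightarrow> bool" where
  "induced_matching J u v \<longleftrightarrow> (\<forall>i\<in>J. adj (u i) (v i)) \<and>
     (\<forall>i\<in>J. \<forall>j\<in>J. i \<noteq> j \<longrightarrow> \<not> adj (u i) (u j) \<and> \<not> adj (u i) (v j) \<and> \<not> adj (v i) (v j))"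

definition hub :: "'a set \<Rightarrow> 'b set \<Rightarrow> ('b \<Rightarrow> 'a) \<Rightarrow> ('b \<Rightarrow> 'a) \<Rightarrow> bool" where
  "hub S J u v \<longleftrightarrow> connected S \<and> S \<subseteq> V \<and> finite J \<and> induced_matching J u v \<and>
     u ` J \<subseteq> nbhd S \<and> v ` J \<subseteq> nbhd S"

lemma induced_matching_adj:
  assumes "induced_matching J u v" "i \<in> J" "j \<in> J"
  shows "adj (u i) (v j) \<longleftrightarrow> i = j" "\<not> adj (u i) (u j)" "\<not> adj (v i) (v j)"
  using assms unfolding induced_matching_def by (metis adj_irrefl)+

lemma induced_matching_distinct:
  assumes "induced_matching J u v" "i \<in> J" "j \<in> J"
  shows "u i \<noteq> v j" "u i = u j \<longleftrightarrow> i = j" "v i = v j \<longleftrightarrow> i = j"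
  using induced_matching_adj[OF assms] induced_matching_adj[OF assms(1,2,2)]
    induced_matching_adj[OF assms(1,3,3)] adj_commute by metis+

lemma induced_matching_subset: "induced_matching J u v \<Longrightarrow> J' \<subseteq> J \<Longrightarrow> induced_matching J' u v"
  unfolding induced_matching_def by blast

lemma hub_reindex:
  assumes "hub S J u v" "finite I" "inj_on h I" "h ` I \<subseteq> J"
  shows "hub S I (u \<circ> h) (v \<circ> h)"
  using assms unfolding hub_def induced_matching_def by (auto simp: inj_on_eq_iff image_subset_iff)

end

definition induced_subgraph :: "'a ugraph \<Rightarrow> 'a set \<Rightarrow> 'a ugraph" where
  "induced_subgraph G A = (A, {e \<in> snd G. e \<subseteq> A})"

lemma fst_induced_subgraph [simp]: "fst (induced_subgraph G A) = A"
  by (simp add: induced_subgraph_def)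

lemma simple_graph_induced_subgraph:
  "simple_graph G \<Longrightarrow> A \<subseteq> fst G \<Longrightarrow> simple_graph (induced_subgraph G A)"
  by (auto simp: simple_graph_def induced_subgraph_def nsets_def intro: finite_subset)

lemma delete_vertices_steps:
  assumes "finite W" "W \<subseteq> fst G"
  shows "induced_minor_step\<^sup>*\<^sup>* G (fst G - W, {e \<in> snd G. e \<inter> W = {}})"
  using assms
proof (induction W rule: finite_induct)
  case empty
  then show ?case by simp
next
  case (insert x W)
  let ?G = "(fst G - W, {e \<in> snd G. e \<inter> W = {}})"
  have "induced_minor_step ?G (delete_vertex x ?G)"
    using insert by (intro induced_minor_step.delete) auto
  moreover have "delete_vertex x ?G = (fst G - insert x W, {e \<in> snd G. e \<inter> insert x W = {}})"
    by (auto simp: delete_vertex_def)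
  ultimately show ?case using insert by (auto intro: rtranclp.rtrancl_into_rtrancl)
qed

lemma induced_subgraph_steps:
  assumes "simple_graph G" "A \<subseteq> fst G"
  shows "induced_minor_step\<^sup>*\<^sup>* G (induced_subgraph G A)"
proof -
  have "induced_subgraph G A = (fst G - (fst G - A), {e \<in> snd G. e \<inter> (fst G - A) = {}})"
    using assms by (auto simp: induced_subgraph_def simple_graph_def nsets_def)
  moreover have "finite (fst G - A)" using assms(1) by (simp add: simple_graph_def)
  ultimately show ?thesis using delete_vertices_steps[of "fst G - A" G] by simp
qed

lemma induced_minor_steps: "induced_minor_step\<^sup>*\<^sup>* G G' \<Longrightarrow> induced_minor H G' \<Longrightarrow> induced_minor H G"
  unfolding induced_minor_def by (meson rtranclp_trans)

lemma induced_minor_induced_subgraph: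
  "simple_graph G \<Longrightarrow> A \<subseteq> fst G \<Longrightarrow> induced_minor H (induced_subgraph G A) \<Longrightarrow> induced_minor H G"
  by (blast intro: induced_minor_steps induced_subgraph_steps)

context sgraph
begin

lemma sgraph_induced_subgraph: "A \<subseteq> V \<Longrightarrow> sgraph (induced_subgraph G A)"
  by (simp add: sgraph_def simple simple_graph_induced_subgraph)

lemma adj_induced_subgraph:
  "A \<subseteq> V \<Longrightarrow> sgraph.adj (induced_subgraph G A) x y \<longleftrightarrow> x \<in> A \<and> y \<in> A \<and> adj x y"
  unfolding sgraph.adj_def[OF sgraph_induced_subgraph] adj_def by (auto simp: induced_subgraph_def)

lemma hub_induced_subgraph:
  assumes hub: "hub S J u v" and A: "A \<subseteq> V" "S \<union> u ` J \<union> v ` J \<subseteq> A"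
  shows "sgraph.hub (induced_subgraph G A) S J u v"
proof -
  interpret A: sgraph "induced_subgraph G A" by (rule sgraph_induced_subgraph) fact
  have eq: "A.adj x y \<longleftrightarrow> adj x y" if "x \<in> A" "y \<in> A" for x y
    using that adj_induced_subgraph[OF A(1)] by simp
  have "(\<lambda>x y. A.adj x y \<and> x \<in> S \<and> y \<in> S) = (\<lambda>x y. adj x y \<and> x \<in> S \<and> y \<in> S)"
    using A(2) eq by (auto simp: fun_eq_iff)
  then have "A.connected S"
    using hub by (simp add: hub_def A.connected_def connected_def A.reachable_def reachable_def)
  moreover have "A.induced_matching J u v"
    using hub A(2) eq unfolding hub_def A.induced_matching_def induced_matching_def
    by (simp add: image_subset_iff)
  moreover have "w \<in> A.nbhd S" if "w \<in> nbhd S" "w \<in> A" for w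
    using that A(2) eq unfolding A.nbhd_def nbhd_def by auto
  ultimately show ?thesis
    using hub A(2) unfolding hub_def A.hub_def by (auto simp: image_subset_iff)
qed

lemma adj_contract_edge:
  assumes "adj y x"
  defines "f \<equiv> (\<lambda>z. if z = x then y else z)"
  shows "adj p q \<Longrightarrow> f p \<noteq> f q \<Longrightarrow> sgraph.adj (contract_edge y x G) (f p) (f q)"
    and "sgraph.adj (contract_edge y x G) p q \<Longrightarrow> p \<noteq> y \<Longrightarrow> q \<noteq> y \<Longrightarrow> adj p q"
proof -
  interpret G': sgraph "contract_edge y x G"
    using assms simple by (simp add: sgraph_def adj_def simple_graph_contract_edge)
  have adj': "G'.adj p q \<longleftrightarrow> p \<noteq> x \<and> q \<noteq> x \<and> (adj p q \<or> p = y \<and> adj x q \<and> q \<noteq> y \<or> q = y \<and> adj x p \<and> p \<noteq> y)" for p q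
    using adjD(3)[OF assms(1)] adj_irrefl[of x] unfolding G'.adj_def adj_def
    by (auto simp: contract_edge_def doubleton_eq_iff insert_commute)
  show "adj p q \<Longrightarrow> f p \<noteq> f q \<Longrightarrow> G'.adj (f p) (f q)"
    using adjD(3)[OF assms(1)] adj_commute[of p q] unfolding adj' f_def by (auto split: if_splits)
  show "G'.adj p q \<Longrightarrow> p \<noteq> y \<Longrightarrow> q \<noteq> y \<Longrightarrow> adj p q"
    unfolding adj' by blast
qed

lemma hub_contract_edge:
  assumes hub: "hub S J u v" and xy: "adj y x" "x \<in> S" "y \<in> S"
  shows "sgraph.hub (contract_edge y x G) (S - {x}) J u v"
proof -
  interpret G': sgraph "contract_edge y x G"
    using xy(1) simple by (simp add: sgraph_def adj_def simple_graph_contract_edge)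
  define f where "f z = (if z = x then y else z)" for z
  note contract = adj_contract_edge[OF xy(1), folded f_def]
  have f: "f z \<in> S - {x}" if "z \<in> S" for z
    using that xy(3) adjD(3)[OF xy(1)] by (simp add: f_def)
  have reachable: "G'.reachable (S - {x}) (f a) (f b)" if "reachable S a b" for a b
    using that unfolding reachable_def
  proof (induction rule: rtranclp_induct)
    case (step b c)
    then have "G'.reachable (S - {x}) (f b) (f c)"
      using contract(1)[of b c] f by (cases "f b = f c") (auto intro: G'.reachable_adj)
    with step.IH show ?case by (rule G'.reachable_trans)
  qed simp
  have "G'.reachable (S - {x}) a b" if "a \<in> S - {x}" "b \<in> S - {x}" for a b
    using reachable[of a b] that hub connectedD[of S a b] by (auto simp: hub_def f_def)
  then have "G'.connected (S - {x})"
    using f[OF xy(3)] unfolding G'.connected_def by blast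
  moreover have eq: "G'.adj p q \<longleftrightarrow> adj p q" if "p \<notin> S" "q \<notin> S" for p q
  proof
    have "f p = p" "f q = q" using that xy(2) by (auto simp: f_def)
    then show "G'.adj p q" if "adj p q" using contract(1)[OF that] adjD(3)[OF that] by simp
    show "adj p q" if "G'.adj p q" using contract(2)[OF that] \<open>p \<notin> S\<close> \<open>q \<notin> S\<close> xy(3) by blast
  qed
  moreover have "G'.induced_matching J u v"
    using hub eq unfolding hub_def G'.induced_matching_def induced_matching_def nbhd_def
    by (simp add: image_subset_iff)
  moreover have "w \<in> G'.nbhd (S - {x})" if w: "w \<in> nbhd S" for w
  proof -
    obtain s where s: "s \<in> S" "adj s w" and wS: "w \<notin> S" using w by (auto simp: nbhd_def)
    have "f w = w" "f s \<noteq> w" using f[OF s(1)] wS xy(2) by (auto simp: f_def)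
    then have "G'.adj (f s) w" using contract(1)[OF s(2)] by simp
    with f[OF s(1)] wS show ?thesis unfolding G'.nbhd_def by blast
  qed
  moreover have "S - {x} \<subseteq> fst (contract_edge y x G)"
    using hub by (auto simp: hub_def contract_edge_def)
  ultimately show ?thesis
    using hub unfolding hub_def G'.hub_def by (auto simp: image_subset_iff)
qed

end

lemma hub_contract_to_vertex:
  assumes "simple_graph G" "sgraph.hub G S J u v"
  shows "\<exists>G' a. induced_minor_step\<^sup>*\<^sup>* G G' \<and> simple_graph G' \<and> sgraph.hub G' {a} J u v"
  using assms
proof (induction "card S" arbitrary: G S rule: less_induct)
  case less
  interpret sgraph G by unfold_locales (rule less.prems(1))
  have S: "connected S" "finite S"
    using less.prems(2) finite_V finite_subset by (auto simp: hub_def)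
  then obtain x where x: "x \<in> S" using connected_nonempty by blast
  show ?case
  proof (cases "S = {x}")
    case True
    with less.prems show ?thesis by blast
  next
    case False
    then obtain y where y: "y \<in> S" "adj x y"
      using connected_leaving_edge[OF S(1), of "{x}"] x by blast
    have edge: "{y, x} \<in> snd G" using y(2) by (simp add: adj_def insert_commute)
    have "simple_graph (contract_edge y x G)"
      using less.prems(1) edge by (rule simple_graph_contract_edge)
    moreover have "card (S - {x}) < card S" using x S(2) by (intro psubset_card_mono) auto
    ultimately obtain G' a where "induced_minor_step\<^sup>*\<^sup>* (contract_edge y x G) G'" "simple_graph G'"
        "sgraph.hub G' {a} J u v"
      using less.hyps hub_contract_edge[OF less.prems(2) adj_sym[OF y(2)] x y(1)] by blast
    with induced_minor_step.contract[OF edge] show ?thesis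
      by (meson converse_rtranclp_into_rtranclp)
  qed
qed

lemma friendship_graph_vertex_cases:
  assumes "k \<in> fst (friendship_graph t)"
  obtains "k = 0" | i where "i < t" "k = 2 * i + 1" | i where "i < t" "k = 2 * i + 2"
proof -
  have "k = 0 \<or> (\<exists>i<t. k = 2 * i + 1) \<or> (\<exists>i<t. k = 2 * i + 2)"
    using assms by (simp add: friendship_graph_def) presburger
  then show ?thesis using that by blast
qed

lemma friendship_graph_edge_iff:
  "{k, l} \<in> snd (friendship_graph t) \<longleftrightarrow>
     k = 0 \<and> 1 \<le> l \<and> l \<le> 2 * t \<or> l = 0 \<and> 1 \<le> k \<and> k \<le> 2 * t \<or>
     (\<exists>i<t. k = 2 * i + 1 \<and> l = 2 * i + 2 \<or> k = 2 * i + 2 \<and> l = 2 * i + 1)"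
  by (auto simp: friendship_graph_def doubleton_eq_iff)

context sgraph
begin

definition friendship_label :: "'a \<Rightarrow> (nat \<Rightarrow> 'a) \<Rightarrow> (nat \<Rightarrow> 'a) \<Rightarrow> nat \<Rightarrow> 'a" where
  "friendship_label a u v k =
     (if k = 0 then a else if odd k then u ((k - 1) div 2) else v ((k - 2) div 2))"

lemma friendship_label_simps:
  "friendship_label a u v 0 = a"
  "friendship_label a u v (2 * i + 1) = u i"
  "friendship_label a u v (2 * i + 2) = v i"
  by (auto simp: friendship_label_def)

lemma friendship_label_adj:
  assumes "hub {a} {..<t} u v" "k \<in> fst (friendship_graph t)" "l \<in> fst (friendship_graph t)"
  shows "{k, l} \<in> snd (friendship_graph t) \<longleftrightarrow>
    adj (friendship_label a u v k) (friendship_label a u v l)"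
proof -
  have matching: "induced_matching {..<t} u v" and centre: "adj a (u i)" "adj a (v i)" if "i < t" for i
    using assms(1) that by (auto simp: hub_def nbhd_def)
  have adj_simps: "adj a (u i)" "adj (u i) a" "adj a (v i)" "adj (v i) a"
    "\<not> adj (u i) (u j)" "\<not> adj (v i) (v j)" "adj (u i) (v j) \<longleftrightarrow> i = j" "adj (v j) (u i) \<longleftrightarrow> i = j"
    if "i < t" "j < t" for i j
    using that centre[of i] induced_matching_adj[OF matching, of i i j]
    by (simp_all add: adj_commute[of _ a] adj_commute[of "v j" "u i"])
  have edge_simps: "{0, 2 * i + 1} \<in> snd (friendship_graph t)" "{2 * i + 1, 0} \<in> snd (friendship_graph t)"
    "{0, 2 * i + 2} \<in> snd (friendship_graph t)" "{2 * i + 2, 0} \<in> snd (friendship_graph t)"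
    "{2 * i + 1, 2 * j + 1} \<notin> snd (friendship_graph t)"
    "{2 * i + 2, 2 * j + 2} \<notin> snd (friendship_graph t)"
    "{2 * i + 1, 2 * j + 2} \<in> snd (friendship_graph t) \<longleftrightarrow> i = j"
    "{2 * j + 2, 2 * i + 1} \<in> snd (friendship_graph t) \<longleftrightarrow> i = j"
    if "i < t" "j < t" for i j
    unfolding friendship_graph_edge_iff using that by presburger+
  have no_loop: "{0, 0} \<notin> snd (friendship_graph t)"
    unfolding friendship_graph_edge_iff by presburger
  show ?thesis
    by (rule friendship_graph_vertex_cases[OF assms(2)]; rule friendship_graph_vertex_cases[OF assms(3)])
      (simp_all only: friendship_label_simps edge_simps adj_simps no_loop adj_irrefl)
qed

lemma friendship_label_inj:
  assumes "hub {a} {..<t} u v"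
  shows "inj_on (friendship_label a u v) (fst (friendship_graph t))"
proof (rule inj_onI)
  fix k l
  assume k: "k \<in> fst (friendship_graph t)" and l: "l \<in> fst (friendship_graph t)"
    and eq: "friendship_label a u v k = friendship_label a u v l"
  have matching: "induced_matching {..<t} u v" and centre: "a \<noteq> u i" "a \<noteq> v i" if "i < t" for i
    using assms that by (auto simp: hub_def nbhd_def)
  have distinct: "u i \<noteq> v j" "v j \<noteq> u i" "u i = u j \<longleftrightarrow> i = j" "v i = v j \<longleftrightarrow> i = j"
      "u i \<noteq> a" "v i \<noteq> a"
    if "i < t" "j < t" for i j
    using induced_matching_distinct[OF matching, of i i j] centre[of i] that by auto
  show "k = l"
    by (rule friendship_graph_vertex_cases[OF k]; rule friendship_graph_vertex_cases[OF l];
        use eq in \<open>simp only: friendship_label_simps distinct centre\<close>)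
qed

lemma friendship_label_image:
  "friendship_label a u v ` fst (friendship_graph t) = insert a (u ` {..<t} \<union> v ` {..<t})"
    (is "?f ` _ = _")
proof
  show "?f ` fst (friendship_graph t) \<subseteq> insert a (u ` {..<t} \<union> v ` {..<t})"
  proof (rule image_subsetI)
    fix k assume "k \<in> fst (friendship_graph t)"
    then show "?f k \<in> insert a (u ` {..<t} \<union> v ` {..<t})"
      by (rule friendship_graph_vertex_cases) (auto simp only: friendship_label_simps)
  qed
  have "?f 0 \<in> ?f ` fst (friendship_graph t)"
    by (rule imageI) (simp add: friendship_graph_def)
  moreover have "?f (2 * i + 1) \<in> ?f ` fst (friendship_graph t)"
      and "?f (2 * i + 2) \<in> ?f ` fst (friendship_graph t)" if "i < t" for i
    using that by (intro imageI; simp add: friendship_graph_def)+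
  ultimately show "insert a (u ` {..<t} \<union> v ` {..<t}) \<subseteq> ?f ` fst (friendship_graph t)"
    unfolding friendship_label_simps by blast
qed

lemma friendship_graph_iso:
  assumes "hub {a} {..<t} u v" "V = insert a (u ` {..<t} \<union> v ` {..<t})"
  shows "graph_iso (friendship_graph t) G"
  unfolding graph_iso_def bij_betw_def
  using friendship_label_inj[OF assms(1)] friendship_label_adj[OF assms(1)]
    friendship_label_image[of a u v t] assms(2)
  by (intro exI[of _ "friendship_label a u v"]) (simp add: adj_def)

theorem hub_induced_minor:
  assumes "hub S J u v" "t \<le> card J"
  shows "induced_minor (friendship_graph t) G"
proof -
  obtain J' where J': "J' \<subseteq> J" "card J' = t" by (meson assms(2) obtain_subset_with_card_n)
  moreover have "finite J'" using J'(1) assms(1) finite_subset by (auto simp: hub_def)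
  ultimately obtain h where "bij_betw h {..<t} J'"
    using ex_bij_betw_nat_finite[of J'] by (auto simp: atLeast0LessThan)
  then have "hub S {..<t} (u \<circ> h) (v \<circ> h)"
    using J'(1) by (intro hub_reindex[OF assms(1)]) (auto simp: bij_betw_def)
  then obtain G' a where steps: "induced_minor_step\<^sup>*\<^sup>* G G'" and G': "simple_graph G'"
      and hub: "sgraph.hub G' {a} {..<t} (u \<circ> h) (v \<circ> h)"
    using hub_contract_to_vertex[OF simple] by blast
  interpret G': sgraph G' by unfold_locales (rule G')
  let ?U = "insert a ((u \<circ> h) ` {..<t} \<union> (v \<circ> h) ` {..<t})"
  have U: "?U \<subseteq> fst G'"
    using hub G'.adjD(2) by (auto simp: G'.hub_def G'.nbhd_def)
  then interpret U: sgraph "induced_subgraph G' ?U" by (rule G'.sgraph_induced_subgraph)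
  have "U.hub {a} {..<t} (u \<circ> h) (v \<circ> h)"
    by (rule G'.hub_induced_subgraph[OF hub U]) auto
  then have "graph_iso (friendship_graph t) (induced_subgraph G' ?U)"
    by (rule U.friendship_graph_iso) simp
  then have "induced_minor (friendship_graph t) (induced_subgraph G' ?U)"
    unfolding induced_minor_def by blast
  with steps G' U show ?thesis
    by (blast intro: induced_minor_steps induced_minor_induced_subgraph)
qed

end

section \<open>Contacts of an induced path\<close>

definition spaced :: "nat set \<Rightarrow> bool" where
  "spaced T \<longleftrightarrow> (\<forall>i\<in>T. \<forall>j\<in>T. i < j \<longrightarrow> i + 3 \<le> j)"

text \<open>Leaving out the two positions in front of each later element of \<open>T\<close> cuts the path into segments that are
  pairwise non-adjacent and contain one element of \<open>T\<close> each.\<close>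

definition kept_positions :: "nat set \<Rightarrow> nat \<Rightarrow> nat set" where
  "kept_positions T m = {k. k < m \<and> (\<exists>i\<in>T. i \<le> k) \<and> Suc k \<notin> T \<and> Suc (Suc k) \<notin> T}"

definition last_upto :: "nat set \<Rightarrow> nat \<Rightarrow> nat" where
  "last_upto T k = Max {i \<in> T. i \<le> k}"

lemma last_upto:
  assumes "k \<in> kept_positions T m"
  shows "last_upto T k \<in> T" "last_upto T k \<le> k" "i \<in> T \<Longrightarrow> i \<le> k \<Longrightarrow> i \<le> last_upto T k"
proof -
  have "finite {i \<in> T. i \<le> k}" "{i \<in> T. i \<le> k} \<noteq> {}" using assms by (auto simp: kept_positions_def)
  from Max_in[OF this] Max_ge[OF this(1)]
  show "last_upto T k \<in> T" "last_upto T k \<le> k" "i \<in> T \<Longrightarrow> i \<le> k \<Longrightarrow> i \<le> last_upto T k"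
    by (auto simp: last_upto_def)
qed

lemma kept_positions_segment:
  assumes k: "k \<in> kept_positions T m" and j: "last_upto T k \<le> j" "j \<le> k"
  shows "j \<in> kept_positions T m"
proof -
  have "i \<le> j" if i: "i \<in> T" "i \<le> Suc (Suc j)" for i
  proof (cases "i \<le> k")
    case True
    then show ?thesis using last_upto(3)[OF k i(1)] j by simp
  next
    case False
    moreover have "i \<noteq> Suc k" "i \<noteq> Suc (Suc k)" using k i(1) by (auto simp: kept_positions_def)
    ultimately show ?thesis using i(2) j by simp
  qed
  from this[of "Suc j"] this[of "Suc (Suc j)"] show ?thesis
    using last_upto(1)[OF k] j k by (auto simp: kept_positions_def)
qed

lemma spaced_subset_kept_positions: "spaced T \<Longrightarrow> T \<subseteq> {..<m} \<Longrightarrow> T \<subseteq> kept_positions T m"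
  unfolding spaced_def kept_positions_def by fastforce

lemma spaced_predecessor:
  assumes "spaced T" "i \<in> T" "i < m" "l \<in> T" "l < i"
  shows "3 \<le> i" "i - 3 \<in> kept_positions T m"
proof -
  have l: "l + 3 \<le> i" using assms by (auto simp: spaced_def)
  then show "3 \<le> i" by simp
  have "i - 2 \<notin> T" "i - 1 \<notin> T" using assms(1,2) l by (fastforce simp: spaced_def)+
  moreover have "Suc (i - 3) = i - 2" "Suc (Suc (i - 3)) = i - 1" using l by auto
  ultimately show "i - 3 \<in> kept_positions T m"
    using assms(3,4) l by (auto simp: kept_positions_def intro!: bexI[of _ l])
qed

context sgraph
begin

definition induced_path :: "(nat \<Rightarrow> 'a) \<Rightarrow> nat \<Rightarrow> bool" where
  "induced_path p m \<longleftrightarrow> p ` {..<m} \<subseteq> V \<and>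
     (\<forall>i<m. \<forall>j<m. (p i = p j \<longleftrightarrow> i = j) \<and> (adj (p i) (p j) \<longleftrightarrow> i = Suc j \<or> j = Suc i))"

definition contacts :: "(nat \<Rightarrow> 'a) \<Rightarrow> nat \<Rightarrow> 'a set \<Rightarrow> 'a set" where
  "contacts p m D = {x \<in> p ` {..<m}. \<exists>z\<in>nbhd D. adj x z}"

lemma induced_path_in_V: "induced_path p m \<Longrightarrow> i < m \<Longrightarrow> p i \<in> V"
  by (auto simp: induced_path_def)

lemma induced_path_eq_iff: "induced_path p m \<Longrightarrow> i < m \<Longrightarrow> j < m \<Longrightarrow> p i = p j \<longleftrightarrow> i = j"
  by (simp add: induced_path_def)

lemma induced_path_adj_iff:
  "induced_path p m \<Longrightarrow> i < m \<Longrightarrow> j < m \<Longrightarrow> adj (p i) (p j) \<longleftrightarrow> i = Suc j \<or> j = Suc i"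
  by (simp add: induced_path_def)

lemma induced_path_snoc:
  assumes p: "induced_path p m" and z: "z \<in> V" "\<And>i. i < m \<Longrightarrow> z \<noteq> p i \<and> (adj (p i) z \<longleftrightarrow> Suc i = m)"
  shows "induced_path (p(m := z)) (Suc m)"
proof -
  let ?p = "p(m := z)"
  have "(?p i = ?p j \<longleftrightarrow> i = j) \<and> (adj (?p i) (?p j) \<longleftrightarrow> i = Suc j \<or> j = Suc i)"
    if "i < Suc m" "j < Suc m" for i j
  proof (cases "i = m"; cases "j = m")
    assume "i = m" "j \<noteq> m"
    then show ?thesis using that z(2)[of j] adj_commute[of z "p j"] by auto
  next
    assume "i \<noteq> m" "j = m"
    then show ?thesis using that z(2)[of i] by auto
  qed (use that p in \<open>auto simp: induced_path_def\<close>)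
  moreover have "?p ` {..<Suc m} \<subseteq> V" using p z(1) by (auto simp: induced_path_def less_Suc_eq)
  ultimately show ?thesis unfolding induced_path_def by blast
qed

lemma connected_segment:
  assumes "induced_path p m" "b < m" "a \<le> b"
  shows "connected (p ` {a..b})"
  using assms(3,2)
proof (induction b rule: dec_induct)
  case (step k)
  have "connected (insert (p (Suc k)) (p ` {a..k}))"
    by (rule connected_insert[of _ "p k"]) (use step assms(1) in \<open>auto simp: induced_path_adj_iff\<close>)
  moreover have "insert (p (Suc k)) (p ` {a..k}) = p ` {a..Suc k}"
    using step.hyps by (auto simp: atLeastAtMostSuc_conv)
  ultimately show ?case by simp
qed simp

text \<open>For the contacts \<open>T\<close> of the path and neighbours \<open>z i\<close> of \<open>p i\<close> in \<open>nbhd D\<close>, this set is a hub for the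
  edges \<open>p (i - 2), p (i - 1)\<close> in front of the contacts \<open>i\<close> other than the first.\<close>

definition contact_hub :: "'a set \<Rightarrow> (nat \<Rightarrow> 'a) \<Rightarrow> nat \<Rightarrow> (nat \<Rightarrow> 'a) \<Rightarrow> nat set \<Rightarrow> 'a set" where
  "contact_hub D p m z T =
     D \<union> (\<Union>k\<in>kept_positions T m. insert (z (last_upto T k)) (p ` {last_upto T k..k}))"

lemma path_in_contact_hub_iff:
  assumes p: "induced_path p m" and apart: "p ` {..<m} \<inter> closed_nbhd D = {}"
    and z: "\<And>i. i \<in> T \<Longrightarrow> z i \<in> nbhd D" and k: "k < m"
  shows "p k \<in> contact_hub D p m z T \<longleftrightarrow> k \<in> kept_positions T m"
proof
  assume "p k \<in> contact_hub D p m z T"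
  moreover have "p k \<notin> closed_nbhd D" using apart k by blast
  then have "p k \<notin> D" "\<And>i. i \<in> T \<Longrightarrow> p k \<noteq> z i"
    using z unfolding nbhd_def closed_nbhd_def by fastforce+
  ultimately obtain l i where l: "l \<in> kept_positions T m" "last_upto T l \<le> i" "i \<le> l" and "p k = p i"
    using last_upto(1) by (auto simp: contact_hub_def)
  moreover have "i \<in> kept_positions T m" by (rule kept_positions_segment[OF l])
  ultimately show "k \<in> kept_positions T m"
    using k induced_path_eq_iff[OF p, of k i] by (auto simp: kept_positions_def)
next
  assume k: "k \<in> kept_positions T m"
  then have "p k \<in> p ` {last_upto T k..k}" using last_upto(2) by auto
  with k show "p k \<in> contact_hub D p m z T" unfolding contact_hub_def by blast
qed

lemma contact_hub_connected:
  assumes p: "induced_path p m" and D: "connected D" "D \<subseteq> V"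
    and z: "\<And>i. i \<in> T \<Longrightarrow> z i \<in> nbhd D \<and> adj (p i) (z i)"
  shows "connected (contact_hub D p m z T)" "contact_hub D p m z T \<subseteq> V"
proof -
  show "connected (contact_hub D p m z T)"
    unfolding contact_hub_def
  proof (rule connected_UN[OF D(1)])
    fix k assume k: "k \<in> kept_positions T m"
    then have "k < m" by (simp add: kept_positions_def)
    then show "connected (insert (z (last_upto T k)) (p ` {last_upto T k..k}))"
      using last_upto(1,2)[OF k] z
      by (intro connected_insert[of _ "p (last_upto T k)"] connected_segment[OF p]) auto
    show "touches D (insert (z (last_upto T k)) (p ` {last_upto T k..k}))"
      using z[OF last_upto(1)[OF k]] by (auto simp: touches_def nbhd_def)
  qed
  have "z (last_upto T k) \<in> V" "p ` {last_upto T k..k} \<subseteq> V" if "k \<in> kept_positions T m" for k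
    using z[OF last_upto(1)[OF that]] adjD(2) induced_path_in_V[OF p] that
    by (auto simp: kept_positions_def)
  then show "contact_hub D p m z T \<subseteq> V"
    using D(2) unfolding contact_hub_def by blast
qed

lemma spaced_pairs_induced_matching:
  assumes p: "induced_path p m" and J: "spaced J" "\<And>i. i \<in> J \<Longrightarrow> 3 \<le> i \<and> i < m"
  shows "induced_matching J (\<lambda>i. p (i - 2)) (\<lambda>i. p (i - 1))"
  unfolding induced_matching_def
proof (intro conjI ballI impI)
  fix i assume "i \<in> J"
  then show "adj (p (i - 2)) (p (i - 1))" using J(2)[of i] by (auto simp: induced_path_adj_iff[OF p])
next
  fix i j assume ij: "i \<in> J" "j \<in> J" "i \<noteq> j"
  then have "i + 3 \<le> j \<or> j + 3 \<le> i"
    using J(1) by (cases i j rule: linorder_cases) (auto simp: spaced_def)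
  with J(2)[OF ij(1)] J(2)[OF ij(2)]
  show "\<not> adj (p (i - 2)) (p (j - 2))" "\<not> adj (p (i - 2)) (p (j - 1))" "\<not> adj (p (i - 1)) (p (j - 1))"
    by (auto simp: induced_path_adj_iff[OF p])
qed

end

locale friendship_free = sgraph G for G :: "'a ugraph" +
  fixes t :: nat
  assumes friendship_free: "\<not> induced_minor (friendship_graph t) G"
begin

lemma hub_card_less: "hub S J u v \<Longrightarrow> card J < t"
  using hub_induced_minor friendship_free not_less by blast

lemma spaced_contacts_le:
  assumes p: "induced_path p m" and D: "connected D" "D \<subseteq> V"
    and apart: "p ` {..<m} \<inter> closed_nbhd D = {}"
    and T: "spaced T" "T \<subseteq> {..<m}" "\<And>i. i \<in> T \<Longrightarrow> \<exists>z\<in>nbhd D. adj (p i) z"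
  shows "card T \<le> t"
proof (cases "T = {}")
  case False
  have finT: "finite T" using T(2) finite_subset by blast
  obtain z where z: "\<And>i. i \<in> T \<Longrightarrow> z i \<in> nbhd D \<and> adj (p i) (z i)" using T(3) by metis
  define S where "S = contact_hub D p m z T"
  define J where "J = T - {Min T}"
  have J: "i \<in> T" "i < m" "3 \<le> i" "i - 3 \<in> kept_positions T m" if "i \<in> J" for i
  proof -
    show "i \<in> T" "i < m" using that T(2) by (auto simp: J_def)
    moreover have "Min T \<in> T" using finT False by simp
    moreover have "Min T < i" using that Min_le[OF finT, of i] le_neq_implies_less unfolding J_def by blast
    ultimately show "3 \<le> i" "i - 3 \<in> kept_positions T m"
      by (rule spaced_predecessor[OF T(1)])+
  qed
  have path_in_S: "p k \<in> S \<longleftrightarrow> k \<in> kept_positions T m" if "k < m" for k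
    unfolding S_def using z that by (intro path_in_contact_hub_iff[OF p apart]) auto
  have "p (i - 2) \<in> nbhd S \<and> p (i - 1) \<in> nbhd S" if i: "i \<in> J" for i
  proof -
    have "Suc (Suc (i - 2)) = i" "Suc (i - 1) = i" using J[OF i] by auto
    then have "p (i - 2) \<notin> S" "p (i - 1) \<notin> S"
      using J[OF i] by (auto simp: path_in_S kept_positions_def)
    moreover have "p (i - 3) \<in> S" "p i \<in> S"
      using J[OF i] spaced_subset_kept_positions[OF T(1,2)] by (auto simp: path_in_S)
    moreover have "adj (p (i - 3)) (p (i - 2))" "adj (p i) (p (i - 1))"
      using J[OF i] by (auto simp: induced_path_adj_iff[OF p])
    ultimately show ?thesis unfolding nbhd_def by blast
  qed
  moreover have "spaced J" using T(1) by (auto simp: spaced_def J_def)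
  then have "induced_matching J (\<lambda>i. p (i - 2)) (\<lambda>i. p (i - 1))"
    by (rule spaced_pairs_induced_matching[OF p]) (use J in auto)
  moreover have "connected S" "S \<subseteq> V" unfolding S_def by (rule contact_hub_connected[OF p D z]; assumption)+
  moreover have "finite J" using finT by (simp add: J_def)
  ultimately have "hub S J (\<lambda>i. p (i - 2)) (\<lambda>i. p (i - 1))"
    by (simp add: hub_def image_subset_iff)
  then have "card J < t" by (rule hub_card_less)
  then show ?thesis using finT False by (simp add: J_def card_Diff_singleton)
qed simp

lemma card_contacts_le:
  assumes p: "induced_path p m" and D: "connected D" "D \<subseteq> V"
    and apart: "p ` {..<m} \<inter> closed_nbhd D = {}"
  shows "card (contacts p m D) \<le> 3 * t"
proof -
  define T where "T = {i. i < m \<and> (\<exists>z\<in>nbhd D. adj (p i) z)}"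
  have residue: "card {i \<in> T. i mod 3 = r} \<le> t" for r
  proof (rule spaced_contacts_le[OF p D apart])
    have "i + 3 \<le> j" if "i mod 3 = r" "j mod 3 = r" "i < j" for i j :: nat
      using that by presburger
    then show "spaced {i \<in> T. i mod 3 = r}" by (auto simp: spaced_def)
  qed (auto simp: T_def)
  have "T = (\<Union>r\<in>{..<3}. {i \<in> T. i mod 3 = r})" by auto
  then have "card T \<le> (\<Sum>r<3. card {i \<in> T. i mod 3 = r})"
    using card_UN_le[of "{..<3::nat}" "\<lambda>r. {i \<in> T. i mod 3 = r}"] by simp
  also have "\<dots> \<le> 3 * t" using sum_mono[of "{..<3::nat}", OF residue] by simp
  finally have "card T \<le> 3 * t" .
  moreover have "contacts p m D = p ` T" by (auto simp: T_def contacts_def)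
  moreover have "card (p ` T) \<le> card T" by (rule card_image_le) (simp add: T_def)
  ultimately show ?thesis by simp
qed

end

section \<open>Induced matchings touching a neighbourhood\<close>

definition dominating :: "('a \<Rightarrow> 'a \<Rightarrow> bool) \<Rightarrow> 'a set \<Rightarrow> 'a set \<Rightarrow> bool" where
  "dominating R J Z \<longleftrightarrow> Z \<subseteq> J \<and> (\<forall>i\<in>J - Z. \<exists>l\<in>Z. R i l)"

lemma minimal_dominating_complement:
  assumes Z: "dominating R J Z" "\<And>Z'. dominating R J Z' \<Longrightarrow> Z' \<subseteq> Z \<Longrightarrow> Z' = Z"
    and R: "\<And>i. i \<in> J \<Longrightarrow> \<exists>j\<in>J. j \<noteq> i \<and> R i j" "symp R"
  shows "dominating R J (J - Z)"
proof -
  have "\<exists>l\<in>J - Z. R z l" if z: "z \<in> Z" for z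
  proof (rule ccontr)
    assume no: "\<not> (\<exists>l\<in>J - Z. R z l)"
    obtain j where j: "j \<in> J" "j \<noteq> z" "R z j" using R(1)[of z] z Z(1) by (auto simp: dominating_def)
    have "\<exists>l\<in>Z - {z}. R i l" if i: "i \<in> J - (Z - {z})" for i
    proof (cases "i = z")
      case True
      then show ?thesis using j no by auto
    next
      case False
      then obtain l where "l \<in> Z" "R i l" using i Z(1) by (auto simp: dominating_def)
      moreover have "l \<noteq> z" using False calculation i no sympD[OF R(2)] by blast
      ultimately show ?thesis by blast
    qed
    then have "dominating R J (Z - {z})" using Z(1) by (auto simp: dominating_def)
    with Z(2)[of "Z - {z}"] z show False by auto
  qed
  then show ?thesis by (auto simp: dominating_def)
qed

lemma ore_domination:
  assumes J: "finite J" and R: "\<And>i. i \<in> J \<Longrightarrow> \<exists>j\<in>J. j \<noteq> i \<and> R i j" "symp R"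
  shows "\<exists>Z. dominating R J Z \<and> card J \<le> 2 * card (J - Z)"
proof -
  have "finite {Z. dominating R J Z}" "dominating R J J"
    using J by (auto simp: dominating_def intro: finite_subset[of _ "Pow J"])
  then obtain Z where Z: "dominating R J Z" "\<And>Z'. dominating R J Z' \<Longrightarrow> Z' \<subseteq> Z \<Longrightarrow> Z' = Z"
    using finite_has_minimal2[of "{Z. dominating R J Z}" J] by auto
  have ZJ: "Z \<subseteq> J" using Z(1) by (simp add: dominating_def)
  then have "card J = card Z + card (J - Z)" "J - (J - Z) = Z"
    using J by (auto simp: card_Diff_subset card_mono finite_subset)
  then show ?thesis
    using Z(1) minimal_dominating_complement[OF Z R] by (metis add_le_mono1 le_cases mult_2 add.commute)
qed

lemma ex_small_fibre:
  assumes "finite J" "J \<noteq> {}"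
  shows "\<exists>i\<in>J. card {k \<in> J. f k = i} \<le> 1"
proof (rule ccontr)
  assume "\<not> ?thesis"
  then have "(\<Sum>i\<in>J. 2) \<le> (\<Sum>i\<in>J. card {k \<in> J. f k = i})"
    by (intro sum_mono) auto
  also have "\<dots> = card (\<Union>i\<in>J. {k \<in> J. f k = i})"
    using assms(1) by (intro card_UN_disjoint[symmetric]) auto
  also have "\<dots> \<le> card J" using assms(1) by (intro card_mono) auto
  finally show False using assms by (simp add: card_gt_0_iff)
qed

lemma functional_independent:
  assumes "finite J" "\<And>i. i \<in> J \<Longrightarrow> f i \<noteq> i"
  shows "\<exists>J'\<subseteq>J. (\<forall>i\<in>J'. f i \<notin> J') \<and> card J \<le> 3 * card J'"
  using assms
proof (induction "card J" arbitrary: J rule: less_induct)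
  case less
  show ?case
  proof (cases "J = {}")
    case False
    obtain i where i: "i \<in> J" "card {k \<in> J. f k = i} \<le> 1"
      using ex_small_fibre[OF less.prems(1) False] by blast
    define K where "K = insert i (insert (f i) {k \<in> J. f k = i})"
    have K: "finite K" "card K \<le> 3"
      using less.prems(1) i(2) card_insert_le_m1[of 2 "{k \<in> J. f k = i}" "f i"]
        card_insert_le_m1[of 3 "insert (f i) {k \<in> J. f k = i}" i] by (auto simp: K_def)
    have "card (J - K) < card J"
      using i(1) less.prems(1) by (intro psubset_card_mono) (auto simp: K_def)
    then obtain J' where J': "J' \<subseteq> J - K" "\<forall>i\<in>J'. f i \<notin> J'" "card (J - K) \<le> 3 * card J'"
      using less.hyps[of "J - K"] less.prems by blast
    have "card J \<le> card (J - K) + 3"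
      using K card_Un_le[of "J - K" K] card_mono[of "(J - K) \<union> K" J] less.prems(1) by auto
    moreover have "finite J'" "i \<notin> J'"
      using J'(1) less.prems(1) finite_subset by (auto simp: K_def)
    ultimately have "card J \<le> 3 * card (insert i J')" using J'(3) by simp
    moreover have "insert i J' \<subseteq> J" "\<forall>k\<in>insert i J'. f k \<notin> insert i J'"
      using J'(1,2) i(1) less.prems(2)[OF i(1)] by (auto simp: K_def)
    ultimately show ?thesis by blast
  qed auto
qed

context sgraph
begin

definition degree :: "'a \<Rightarrow> nat" where
  "degree v = card {w. adj v w}"

definition linked :: "'a set \<Rightarrow> 'a \<Rightarrow> 'a \<Rightarrow> bool" where
  "linked R a b \<longleftrightarrow> (\<exists>Q. connected Q \<and> Q \<subseteq> R \<and> touches Q {a} \<and> touches Q {b})"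

lemma finite_neighbours: "finite {w. adj v w}"
  by (rule finite_subset[OF _ finite_V]) (auto dest: adjD)

lemma other_neighbour:
  assumes "2 \<le> degree v"
  obtains w where "adj v w" "w \<noteq> x"
proof -
  have "\<not> {w. adj v w} \<subseteq> {x}"
    using assms card_mono[of "{x}" "{w. adj v w}"] by (auto simp: degree_def)
  then show ?thesis using that by blast
qed

lemma independent_terminals_linked:
  assumes C: "connected C" "T \<subseteq> C" and T: "\<And>x y. x \<in> T \<Longrightarrow> y \<in> T \<Longrightarrow> \<not> adj x y"
    and a: "a \<in> T" "T \<noteq> {a}"
  shows "\<exists>b\<in>T. b \<noteq> a \<and> linked (C - T) a b"
proof -
  define Y where "Y = insert a (\<Union>y\<in>{y \<in> C - T. adj a y}. component (C - T) y)"
  have "Y \<subseteq> C" "Y \<inter> T \<subseteq> {a}" using component_subset[of "C - T"] C(2) a(1) by (auto simp: Y_def)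
  moreover from this have "Y \<noteq> C" using C(2) a by blast
  moreover have "Y \<noteq> {}" by (simp add: Y_def)
  ultimately obtain p b where pb: "p \<in> Y" "b \<in> C - Y" "adj p b"
    using connected_leaving_edge[OF C(1)] by metis
  have b: "b \<in> T" "b \<noteq> a"
    using pb component_self[of b "C - T"] by (auto simp: Y_def dest: component_closed)
  with pb T[OF a(1)] obtain y where y: "y \<in> C - T" "adj a y" "p \<in> component (C - T) y"
    by (auto simp: Y_def)
  have "linked (C - T) a b"
    unfolding linked_def
  proof (intro exI conjI)
    show "connected (component (C - T) y)" by (rule component_connected[OF y(1)])
    show "component (C - T) y \<subseteq> C - T" by (rule component_subset)
    show "touches (component (C - T) y) {a}"
      using component_self[OF y(1)] adj_sym[OF y(2)] by (auto simp: touches_def)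
    show "touches (component (C - T) y) {b}" using y(3) pb(3) by (auto simp: touches_def)
  qed
  with b show ?thesis by blast
qed

lemma connected_spider:
  assumes "\<And>l. l \<in> Z \<Longrightarrow> adj v (b l) \<and> adj (b l) (x l)"
  shows "connected ({v} \<union> (\<Union>l\<in>Z. {b l, x l}))"
proof (rule connected_UN)
  fix l assume l: "l \<in> Z"
  show "connected {b l, x l}"
    using connected_insert[of "{x l}" "x l" "b l"] assms[OF l] adj_sym by auto
  show "touches {v} {b l, x l}" using assms[OF l] by (auto simp: touches_def)
qed simp

lemma terminals_hub:
  assumes J: "finite J" "induced_matching J b x" and v: "v \<in> V" "\<And>i. i \<in> J \<Longrightarrow> adj v (b i)"
    and C: "C \<subseteq> V" "v \<notin> C" "\<And>i. i \<in> J \<Longrightarrow> b i \<notin> C \<and> x i \<in> C"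
    and Z: "dominating (\<lambda>i j. linked (C - x ` J) (x i) (x j)) J Z"
  shows "\<exists>S. hub S (J - Z) b x"
proof -
  have ZJ: "Z \<subseteq> J" using Z by (simp add: dominating_def)
  have "\<forall>i\<in>J - Z. \<exists>l\<in>Z. linked (C - x ` J) (x i) (x l)" using Z by (simp add: dominating_def)
  then obtain l Q where lQ: "\<And>i. i \<in> J - Z \<Longrightarrow> l i \<in> Z" "\<And>i. i \<in> J - Z \<Longrightarrow> connected (Q i)"
      "\<And>i. i \<in> J - Z \<Longrightarrow> Q i \<subseteq> C - x ` J"
      "\<And>i. i \<in> J - Z \<Longrightarrow> touches (Q i) {x i}" "\<And>i. i \<in> J - Z \<Longrightarrow> touches (Q i) {x (l i)}"
    unfolding linked_def by metis
  have bx: "adj (b i) (x i)" if "i \<in> J" for i using J(2) that by (auto simp: induced_matching_def)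
  define S0 where "S0 = {v} \<union> (\<Union>l\<in>Z. {b l, x l})"
  define S where "S = S0 \<union> (\<Union>i\<in>J - Z. Q i)"
  have "connected S0"
    unfolding S0_def using ZJ bx v(2) by (intro connected_spider) auto
  then have "connected S"
    unfolding S_def
  proof (rule connected_UN)
    fix i assume i: "i \<in> J - Z"
    show "connected (Q i)" by (rule lQ(2)[OF i])
    show "touches S0 (Q i)"
      using lQ(1,5)[OF i] adj_sym by (fastforce simp: touches_def S0_def)
  qed
  moreover have "S \<subseteq> V"
    using v bx lQ(3) ZJ C(1) unfolding S_def S0_def by (blast dest: adjD)
  moreover have "b i \<in> nbhd S \<and> x i \<in> nbhd S" if i: "i \<in> J - Z" for i
  proof -
    have "b i \<noteq> v" "x i \<noteq> v" using v(2)[of i] adj_irrefl C i by auto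
    moreover have "b i \<noteq> b l" "b i \<noteq> x l" "x i \<noteq> b l" "x i \<noteq> x l" if "l \<in> Z" for l
      using that ZJ i induced_matching_distinct[OF J(2), of i l] induced_matching_distinct[OF J(2), of l i]
      by (auto 0 3)
    ultimately have "b i \<notin> S" "x i \<notin> S" using C(3)[of i] i lQ(3) unfolding S_def S0_def by blast+
    moreover have "v \<in> S" by (simp add: S_def S0_def)
    moreover obtain q where "q \<in> Q i" "adj q (x i)"
      using lQ(3,4)[OF i] i by (auto simp: touches_def)
    moreover from this have "q \<in> S" using i by (auto simp: S_def)
    ultimately show ?thesis using v(2)[of i] i unfolding nbhd_def by blast
  qed
  ultimately have "hub S (J - Z) b x"
    using J induced_matching_subset[OF J(2), of "J - Z"] by (auto simp: hub_def)
  then show ?thesis by blast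
qed

lemma parts_hub:
  assumes J: "finite J" "induced_matching J b x" and S: "connected S" "S \<subseteq> V" "b ` J \<subseteq> nbhd S"
    and X: "\<And>i. i \<in> J \<Longrightarrow> connected (X i)" "\<And>i. i \<in> J \<Longrightarrow> X i \<subseteq> V - S" "\<And>i. i \<in> J \<Longrightarrow> x i \<in> X i"
    and disjoint: "disjoint_family_on X J" "\<And>i j. i \<in> J \<Longrightarrow> j \<in> J \<Longrightarrow> b i \<notin> X j"
    and y: "\<And>i. i \<in> J \<Longrightarrow> \<exists>y\<in>X i - {x i}. y \<in> nbhd S"
  shows "\<exists>S'. hub S' J b x"
proof -
  obtain y where y: "\<And>i. i \<in> J \<Longrightarrow> y i \<in> X i - {x i}" "\<And>i. i \<in> J \<Longrightarrow> y i \<in> nbhd S"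
    using y by metis
  define Q where "Q i = component (X i - {x i}) (y i)" for i
  define S' where "S' = S \<union> (\<Union>i\<in>J. Q i)"
  have Q: "connected (Q i)" "Q i \<subseteq> X i - {x i}" "y i \<in> Q i" if "i \<in> J" for i
    using y(1)[OF that] component_connected component_subset component_self by (simp_all add: Q_def)
  have "connected S'"
    unfolding S'_def
  proof (rule connected_UN[OF S(1)])
    fix i assume i: "i \<in> J"
    show "connected (Q i)" by (rule Q(1)[OF i])
    show "touches S (Q i)" using y(2)[OF i] Q(3)[OF i] by (auto simp: touches_def nbhd_def)
  qed
  moreover have "S' \<subseteq> V" using S(2) Q(2) X(2) unfolding S'_def by blast
  moreover have "b i \<in> nbhd S'" if i: "i \<in> J" for i
  proof -
    have "b i \<notin> Q j" if "j \<in> J" for j using disjoint(2)[OF i that] Q(2)[OF that] by blast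
    then show ?thesis using S(3) i by (auto simp: S'_def nbhd_def)
  qed
  moreover have "x i \<in> nbhd S'" if i: "i \<in> J" for i
  proof -
    have "x i \<notin> Q j" if j: "j \<in> J" for j
      using disjoint_family_onD[OF disjoint(1) i j] X(3)[OF i] Q(2)[OF j] by (cases "i = j") auto
    then have "x i \<notin> S'" using X(2,3)[OF i] by (auto simp: S'_def)
    moreover have "Q i \<subseteq> X i" "Q i \<noteq> {}" "Q i \<noteq> X i" using Q[OF i] X(3)[OF i] by auto
    then obtain p q where pq: "p \<in> Q i" "q \<in> X i - Q i" "adj p q"
      using connected_leaving_edge[OF X(1)[OF i]] by metis
    moreover have "q = x i"
      using pq component_closed[of p "X i - {x i}" "y i" q] unfolding Q_def by blast
    moreover have "p \<in> S'" using pq(1) i by (auto simp: S'_def)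
    ultimately show ?thesis unfolding nbhd_def by blast
  qed
  ultimately have "hub S' J b x" using J by (auto simp: hub_def)
  then show ?thesis by blast
qed

text \<open>Take a maximal connected set \<open>Q\<close> containing \<open>b\<close> that misses some edge of \<open>X\<close>: all the missed edges
  meet in a neighbour of \<open>Q\<close>, so their other ends, having degree at least 2, are neighbours of \<open>Q\<close> too.\<close>

lemma pendant_edge:
  assumes X: "connected X" "finite X" "b \<notin> X" "x \<in> X" "adj b x"
    and closed: "\<And>p q. p \<in> X \<Longrightarrow> adj p q \<Longrightarrow> q \<in> insert b X"
    and deg: "\<And>p. p \<in> X \<Longrightarrow> 2 \<le> degree p"
  shows "\<exists>Q p q. b \<in> Q \<and> Q \<subseteq> insert b X \<and> connected Q \<and> adj p q \<and> {p, q} \<subseteq> X \<inter> nbhd Q"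
proof -
  define misses where "misses Q \<longleftrightarrow> b \<in> Q \<and> Q \<subseteq> insert b X \<and> connected Q \<and>
    (\<exists>p q. p \<in> X - Q \<and> q \<in> X - Q \<and> adj p q)" for Q
  have "misses {b}"
  proof -
    obtain q where "adj x q" "q \<noteq> b" using other_neighbour[OF deg[OF X(4)]] .
    with closed[OF X(4)] X(3,4) show ?thesis by (auto simp: misses_def)
  qed
  moreover have "finite {Q. misses Q}"
    using X(2) by (auto simp: misses_def intro: finite_subset[of _ "Pow (insert b X)"])
  ultimately obtain Q where Q: "misses Q" and Q_max: "\<And>Q'. misses Q' \<Longrightarrow> Q \<subseteq> Q' \<Longrightarrow> Q = Q'"
    using finite_has_maximal2[of "{Q. misses Q}" "{b}"] by auto
  then have Q': "b \<in> Q" "Q \<subseteq> insert b X" "connected Q" by (auto simp: misses_def)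
  obtain p q where pq: "p \<in> X - Q" "q \<in> X - Q" "adj p q" using Q by (auto simp: misses_def)
  have "connected (insert b X)" using connected_insert[OF X(1,4)] X(5) adj_sym by blast
  then obtain s r where sr: "s \<in> Q" "r \<in> insert b X - Q" "adj s r"
    using connected_leaving_edge[OF _ Q'(2)] Q'(1) pq by blast
  then have r: "r \<in> X - Q" using Q'(1) by auto
  have meets: "p' = r \<or> q' = r" if "p' \<in> X - Q" "q' \<in> X - Q" "adj p' q'" for p' q'
  proof (rule ccontr)
    assume "\<not> ?thesis"
    then have "misses (insert r Q)"
      using Q' r that connected_insert[OF Q'(3) sr(1,3)] by (auto simp: misses_def)
    with Q_max[of "insert r Q"] r show False by auto
  qed
  obtain p' where p': "p' \<in> X - Q" "adj p' r" using meets[OF pq] pq adj_sym by blast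
  obtain q' where q': "adj p' q'" "q' \<noteq> r" using other_neighbour[OF deg] p'(1) by blast
  have "q' \<in> insert b X" "p' \<noteq> r" using closed[of p' q'] p' q'(1) by auto
  then have "q' \<in> Q" using meets[of p' q'] p'(1) q' Q'(1) by blast
  then have "{p', r} \<subseteq> X \<inter> nbhd Q" using p'(1) q'(1) adj_sym r sr by (auto simp: nbhd_def)
  with Q' p'(2) show ?thesis by blast
qed

end

locale attached_matching = friendship_free +
  fixes v :: 'a and J :: "'b set" and b x :: "'b \<Rightarrow> 'a"
  assumes min_degree: "p \<in> V \<Longrightarrow> 2 \<le> degree p"
    and v: "v \<in> V" and finite_J: "finite J" and matching: "induced_matching J b x"
    and attached: "i \<in> J \<Longrightarrow> adj v (b i) \<and> x i \<noteq> v \<and> \<not> adj v (x i)"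
begin

definition rest :: "'a set" where
  "rest = V - {v} - b ` J"

definition part :: "'b \<Rightarrow> 'a set" where
  "part i = component rest (x i)"

lemma matching_edge: "i \<in> J \<Longrightarrow> adj (b i) (x i)"
  using matching by (simp add: induced_matching_def)

lemma b_neq_v: "i \<in> J \<Longrightarrow> b i \<noteq> v"
  using attached adjD(3) by blast

lemma x_in_rest: "i \<in> J \<Longrightarrow> x i \<in> rest"
  using attached[of i] adjD(2)[OF matching_edge, of i] induced_matching_distinct(1)[OF matching, of _ i]
  by (force simp: rest_def)

lemma part_connected: "i \<in> J \<Longrightarrow> connected (part i)"
  and x_in_part: "i \<in> J \<Longrightarrow> x i \<in> part i"
  using x_in_rest by (simp_all add: part_def component_connected component_self)

lemma part_subset: "part i \<subseteq> V - {v} - b ` J"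
  using component_subset[of rest] by (simp add: part_def rest_def)

lemma part_closed: "p \<in> part i \<Longrightarrow> adj p q \<Longrightarrow> q \<in> rest \<Longrightarrow> q \<in> part i"
  unfolding part_def by (rule component_closed)

lemma part_leaving_edge: "p \<in> part i \<Longrightarrow> adj p q \<Longrightarrow> q \<notin> part i \<Longrightarrow> q = v \<or> q \<in> b ` J"
  using part_closed adjD(2) by (auto simp: rest_def)

lemma parts_disjoint: "part i \<noteq> part j \<Longrightarrow> part i \<inter> part j = {}"
  unfolding part_def using component_eq by blast

lemma card_same_part_le: "card {i \<in> J. part i = C} \<le> 2 * t"
proof (cases "card {i \<in> J. part i = C} \<le> 1")
  case True
  have "hub {v} ({} :: 'b set) b x" using v by (simp add: hub_def induced_matching_def)
  then have "0 < t" using hub_card_less by fastforce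
  with True show ?thesis by linarith
next
  case False
  define I where "I = {i \<in> J. part i = C}"
  have I: "finite I" "induced_matching I b x"
    using finite_J induced_matching_subset[OF matching] by (auto simp: I_def)
  have x_eq: "x i = x j \<longleftrightarrow> i = j" if "i \<in> I" "j \<in> I" for i j
    using induced_matching_distinct(3)[OF I(2) that] .
  have C: "x ` I \<subseteq> C" using x_in_part by (auto simp: I_def)
  have linked: "\<exists>j\<in>I. j \<noteq> i \<and> linked (C - x ` I) (x i) (x j)" if i: "i \<in> I" for i
  proof -
    have "\<exists>y\<in>x ` I. y \<noteq> x i \<and> linked (C - x ` I) (x i) y"
    proof (rule independent_terminals_linked[OF _ C])
      show "connected C" using i part_connected by (auto simp: I_def)
      show "\<not> adj y z" if "y \<in> x ` I" "z \<in> x ` I" for y z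
        using that induced_matching_adj(3)[OF I(2)] by auto
      show "x ` I \<noteq> {x i}"
      proof
        assume "x ` I = {x i}"
        then have "I \<subseteq> {i}" using x_eq i by blast
        then show False using False card_mono[of "{i}" I] by (simp add: I_def)
      qed
    qed (use i in simp)
    then show ?thesis by auto
  qed
  have "symp (\<lambda>i j. linked (C - x ` I) (x i) (x j))" by (auto simp: linked_def intro: sympI)
  then obtain Z where Z: "dominating (\<lambda>i j. linked (C - x ` I) (x i) (x j)) I Z" "card I \<le> 2 * card (I - Z)"
    using ore_domination[OF I(1) linked] by blast
  have "\<exists>S. hub S (I - Z) b x"
  proof (rule terminals_hub[OF I v _ _ _ _ Z(1)])
    have "I \<noteq> {}" using False unfolding I_def[symmetric] by force
    then obtain i where "i \<in> I" by blast
    then have "C \<subseteq> V - {v} - b ` J" using part_subset[of i] by (auto simp: I_def)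
    then show "C \<subseteq> V" "v \<notin> C" "\<And>i. i \<in> I \<Longrightarrow> b i \<notin> C \<and> x i \<in> C" using C by (auto simp: I_def)
  qed (use attached in \<open>auto simp: I_def\<close>)
  then have "card (I - Z) < t" using hub_card_less by blast
  with Z(2) show ?thesis by (simp add: I_def)
qed

definition transversal :: "'b set \<Rightarrow> bool" where
  "transversal I \<longleftrightarrow> I \<subseteq> J \<and> inj_on part I"

lemma transversal_subset: "transversal I \<Longrightarrow> I' \<subseteq> I \<Longrightarrow> transversal I'"
  by (auto simp: transversal_def intro: inj_on_subset)

lemma transversal_finite: "transversal I \<Longrightarrow> finite I"
  using finite_J finite_subset by (auto simp: transversal_def)

lemma transversal_matching: "transversal I \<Longrightarrow> induced_matching I b x"
  using matching by (auto simp: transversal_def intro: induced_matching_subset)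

lemma transversal_disjoint: "transversal I \<Longrightarrow> disjoint_family_on part I"
  using parts_disjoint unfolding transversal_def disjoint_family_on_def inj_on_def by blast

lemma large_transversal: "\<exists>I. transversal I \<and> card J \<le> 2 * t * card I"
proof -
  obtain I where I: "I \<subseteq> J" "inj_on part I" "part ` I = part ` J"
    using subset_image_inj[of "part ` J" part J] by auto
  have "card J = card (\<Union>C\<in>part ` J. {i \<in> J. part i = C})" by (rule arg_cong[of _ _ card]) auto
  also have "\<dots> \<le> (\<Sum>C\<in>part ` J. card {i \<in> J. part i = C})" by (rule card_UN_le) (simp add: finite_J)
  also have "\<dots> \<le> (\<Sum>C\<in>part ` J. 2 * t)" by (intro sum_mono card_same_part_le)
  also have "\<dots> = 2 * t * card I" using card_image[OF I(2)] I(3) by simp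
  finally show ?thesis using I by (auto simp: transversal_def)
qed

lemma card_parts_near_centre_less:
  assumes I: "transversal I" and y: "\<And>i. i \<in> I \<Longrightarrow> \<exists>y\<in>part i. adj v y"
  shows "card I < t"
proof -
  have IJ: "I \<subseteq> J" using I by (simp add: transversal_def)
  have "\<exists>S. hub S I b x"
  proof (rule parts_hub[of I b x "{v}" part])
    show "b ` I \<subseteq> nbhd {v}" using IJ attached b_neq_v by (auto simp: nbhd_def)
    show "\<exists>y\<in>part i - {x i}. y \<in> nbhd {v}" if i: "i \<in> I" for i
    proof -
      obtain y where "y \<in> part i" "adj v y" using y[OF i] by blast
      moreover from this have "y \<noteq> x i" "y \<noteq> v" using attached[of i] i IJ adjD(3) by blast+
      ultimately show ?thesis by (auto simp: nbhd_def)
    qed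
    show "part i \<subseteq> V - {v}" "b i \<notin> part j" if "i \<in> I" "j \<in> I" for i j
      using part_subset that IJ by blast+
  qed (use I IJ v in \<open>auto intro: transversal_finite transversal_matching transversal_disjoint
      part_connected x_in_part\<close>)
  then show ?thesis using hub_card_less by blast
qed

lemma card_parts_near_others_le:
  assumes I: "transversal I" and y: "\<And>i. i \<in> I \<Longrightarrow> \<exists>j\<in>J. j \<noteq> i \<and> (\<exists>y\<in>part i. adj (b j) y)"
  shows "card I \<le> 3 * t"
proof -
  obtain f where f: "\<And>i. i \<in> I \<Longrightarrow> f i \<in> J \<and> f i \<noteq> i \<and> (\<exists>y\<in>part i. adj (b (f i)) y)"
    using y by metis
  obtain I' where I': "I' \<subseteq> I" "\<forall>i\<in>I'. f i \<notin> I'" "card I \<le> 3 * card I'"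
    using functional_independent[OF transversal_finite[OF I], of f] f by blast
  have T: "transversal I'" using transversal_subset[OF I I'(1)] .
  have I'J: "I' \<subseteq> J" using T by (simp add: transversal_def)
  define S where "S = {v} \<union> (\<Union>i\<in>I'. {b (f i)})"
  have b_in_S: "b i \<in> S \<longleftrightarrow> i \<in> f ` I'" if "i \<in> J" for i
    using b_neq_v[OF that] f I'(1) induced_matching_distinct(2)[OF matching that] unfolding S_def by blast
  have "\<exists>S'. hub S' I' b x"
  proof (rule parts_hub[of I' b x S part])
    show "connected S"
      unfolding S_def by (rule connected_UN) (use f I'(1) attached in \<open>auto simp: touches_def\<close>)
    show "S \<subseteq> V" using v f I'(1) matching_edge[THEN adjD(1)] by (auto simp: S_def)
    show "b ` I' \<subseteq> nbhd S"
    proof (rule image_subsetI)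
      fix i assume "i \<in> I'"
      then have "b i \<notin> S" "adj v (b i)" using b_in_S attached I'(2) I'J by blast+
      then show "b i \<in> nbhd S" by (auto simp: nbhd_def S_def)
    qed
    show "part i \<subseteq> V - S" "b i \<notin> part j" if "i \<in> I'" "j \<in> I'" for i j
      using part_subset that I'J f I'(1) unfolding S_def by blast+
    show "\<exists>y\<in>part i - {x i}. y \<in> nbhd S" if i: "i \<in> I'" for i
    proof -
      have fi: "f i \<in> J" "f i \<noteq> i" and "b (f i) \<in> S" using f i I'(1) by (auto simp: S_def)
      moreover obtain y where y: "y \<in> part i" "adj (b (f i)) y" using f i I'(1) by blast
      moreover have "y \<noteq> x i" using induced_matching_adj(1)[OF matching fi(1), of i] fi(2) y(2) i I'J by auto
      moreover have "y \<notin> S" using y(1) part_subset[of i] f I'(1) unfolding S_def by blast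
      ultimately show ?thesis by (auto simp: nbhd_def)
    qed
  qed (use T I'J in \<open>auto intro: transversal_finite transversal_matching transversal_disjoint
      part_connected x_in_part\<close>)
  then have "card I' < t" using hub_card_less by blast
  with I'(3) show ?thesis by simp
qed

lemma pendant_part_edge:
  assumes i: "i \<in> J" and pendant: "\<And>p q. p \<in> part i \<Longrightarrow> adj p q \<Longrightarrow> q \<in> insert (b i) (part i)"
  shows "\<exists>Q p q. b i \<in> Q \<and> Q \<subseteq> insert (b i) (part i) \<and> connected Q \<and> adj p q \<and> {p, q} \<subseteq> part i \<inter> nbhd Q"
proof (rule pendant_edge[where x = "x i"])
  show "finite (part i)" using part_subset finite_V by (meson Diff_subset finite_subset subset_trans)
  show "b i \<notin> part i" using i part_subset by blast
  show "2 \<le> degree p" if "p \<in> part i" for p using part_subset that min_degree by blast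
qed (use i pendant part_connected x_in_part matching_edge in auto)

lemma card_pendant_parts_less:
  assumes I: "transversal I" and pendant: "\<And>i p q. i \<in> I \<Longrightarrow> p \<in> part i \<Longrightarrow> adj p q \<Longrightarrow> q \<in> insert (b i) (part i)"
  shows "card I < t"
proof -
  have IJ: "I \<subseteq> J" using I by (simp add: transversal_def)
  have "\<exists>Q p q. b i \<in> Q \<and> Q \<subseteq> insert (b i) (part i) \<and> connected Q \<and> adj p q \<and> {p, q} \<subseteq> part i \<inter> nbhd Q"
    if "i \<in> I" for i
    using that IJ pendant by (intro pendant_part_edge) auto
  then obtain Q p q where Q: "\<And>i. i \<in> I \<Longrightarrow> b i \<in> Q i" "\<And>i. i \<in> I \<Longrightarrow> Q i \<subseteq> insert (b i) (part i)"
      "\<And>i. i \<in> I \<Longrightarrow> connected (Q i)" "\<And>i. i \<in> I \<Longrightarrow> adj (p i) (q i)"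
      "\<And>i. i \<in> I \<Longrightarrow> {p i, q i} \<subseteq> part i \<inter> nbhd (Q i)"
    by metis
  define S where "S = {v} \<union> (\<Union>i\<in>I. Q i)"
  have "connected S"
    unfolding S_def
  proof (rule connected_UN)
    fix i assume i: "i \<in> I"
    show "connected (Q i)" by (rule Q(3)[OF i])
    show "touches {v} (Q i)" using Q(1)[OF i] attached[of i] i IJ by (auto simp: touches_def)
  qed simp
  moreover have "S \<subseteq> V"
    using v Q(2) part_subset matching_edge[THEN adjD(1)] IJ unfolding S_def by blast
  moreover have disjoint: "part i \<inter> part j = {}" if "i \<in> I" "j \<in> I" "i \<noteq> j" for i j
    using disjoint_family_onD[OF transversal_disjoint[OF I]] that by blast
  have "\<not> adj y z" if "i \<in> I" "j \<in> I" "i \<noteq> j" "y \<in> part i" "z \<in> part j" for i j y z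
    using disjoint[OF that(1-3)] pendant[OF that(1,4)] part_subset[of j] that(1,5) IJ by blast
  then have "induced_matching I p q"
    using Q(4,5) unfolding induced_matching_def by blast
  moreover have "y \<in> nbhd S" if i: "i \<in> I" and y: "y \<in> part i \<inter> nbhd (Q i)" for i y
  proof -
    have "y \<notin> Q j" if j: "j \<in> I" for j
    proof (cases "i = j")
      case True
      then show ?thesis using y by (simp add: nbhd_def)
    next
      case False
      then show ?thesis using disjoint[OF i j] y Q(2)[OF j] part_subset[of i] j IJ by blast
    qed
    then have "y \<notin> S" using y part_subset[of i] by (auto simp: S_def)
    then show ?thesis using y i by (auto simp: nbhd_def S_def)
  qed
  ultimately have "hub S I p q"
    using Q(5) transversal_finite[OF I] by (auto simp: hub_def)
  then show ?thesis by (rule hub_card_less)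
qed

lemma card_attached_matching_le: "card J \<le> 10 * t * t"
proof -
  obtain I where I: "transversal I" "card J \<le> 2 * t * card I" using large_transversal by blast
  define I_centre where "I_centre = {i \<in> I. \<exists>y\<in>part i. adj v y}"
  define I_others where "I_others = {i \<in> I. \<exists>j\<in>J. j \<noteq> i \<and> (\<exists>y\<in>part i. adj (b j) y)}"
  define I_pendant where "I_pendant = {i \<in> I. \<forall>p\<in>part i. \<forall>q. adj p q \<longrightarrow> q \<in> insert (b i) (part i)}"
  have "i \<in> I_centre \<union> I_others" if i: "i \<in> I" "i \<notin> I_pendant" for i
  proof -
    obtain p q where pq: "p \<in> part i" "adj p q" "q \<notin> insert (b i) (part i)" using i by (auto simp: I_pendant_def)
    then consider "q = v" | j where "j \<in> J" "j \<noteq> i" "q = b j"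
      using part_leaving_edge[OF pq(1,2)] by blast
    then show ?thesis using i(1) pq(1) adj_sym[OF pq(2)] by cases (auto simp: I_centre_def I_others_def)
  qed
  then have "I \<subseteq> I_centre \<union> I_others \<union> I_pendant" by blast
  moreover have trans: "transversal I_centre" "transversal I_others" "transversal I_pendant"
    by (rule transversal_subset[OF I(1)]; auto simp: I_centre_def I_others_def I_pendant_def)+
  ultimately have "card I \<le> card (I_centre \<union> I_others \<union> I_pendant)" by (intro card_mono) (auto intro: transversal_finite)
  also have "\<dots> \<le> card I_centre + card I_others + card I_pendant"
    using card_Un_le[of "I_centre \<union> I_others" I_pendant] card_Un_le[of I_centre I_others] by linarith
  also have "\<dots> \<le> 5 * t"
    using card_parts_near_centre_less[OF trans(1)] card_parts_near_others_le[OF trans(2)]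
      card_pendant_parts_less[OF trans(3)] unfolding I_centre_def I_others_def I_pendant_def by fastforce
  finally have "2 * t * card I \<le> 2 * t * (5 * t)" by (rule mult_le_mono2)
  with I(2) have "card J \<le> 2 * t * (5 * t)" by (rule order_trans)
  then show ?thesis by (simp add: mult.assoc mult.left_commute)
qed

end

context friendship_free
begin

lemma card_matching_near_vertex_le:
  assumes deg: "\<And>p. p \<in> V \<Longrightarrow> 2 \<le> degree p" and v: "v \<in> V"
    and J: "finite J" "induced_matching J b x" "b ` J \<subseteq> closed_nbhd {v}"
  shows "card J \<le> 13 * t * t"
proof -
  define J_base where "J_base = {i \<in> J. b i = v}"
  define J_tip where "J_tip = {i \<in> J. x i = v}"
  define J_triangle where "J_triangle = {i \<in> J. adj v (b i) \<and> adj v (x i)}"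
  define J_attached where "J_attached = {i \<in> J. adj v (b i) \<and> x i \<noteq> v \<and> \<not> adj v (x i)}"
  have fin: "finite J_base" "finite J_tip" "finite J_triangle" "finite J_attached"
    using J(1) by (auto simp: J_base_def J_tip_def J_triangle_def J_attached_def)
  moreover have "J \<subseteq> J_base \<union> J_tip \<union> J_triangle \<union> J_attached"
    using J(3) by (auto simp: J_base_def J_tip_def J_triangle_def J_attached_def closed_nbhd_def)
  ultimately have "card J \<le> card (J_base \<union> J_tip \<union> J_triangle \<union> J_attached)" by (intro card_mono) auto
  also have "\<dots> \<le> card J_base + card J_tip + card J_triangle + card J_attached"
    using card_Un_le[of "J_base \<union> J_tip \<union> J_triangle" J_attached] card_Un_le[of "J_base \<union> J_tip" J_triangle] card_Un_le[of J_base J_tip] by linarith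
  finally have "card J \<le> card J_base + card J_tip + card J_triangle + card J_attached" .
  moreover have "card J_base \<le> 1" "card J_tip \<le> 1"
    using fin induced_matching_distinct[OF J(2)] unfolding J_base_def J_tip_def One_nat_def
    by (auto simp: card_le_Suc0_iff_eq)
  moreover have "hub {v} J_triangle b x"
    using v fin(3) induced_matching_subset[OF J(2), of J_triangle] by (auto simp: hub_def nbhd_def J_triangle_def)
  then have "card J_triangle < t" by (rule hub_card_less)
  moreover interpret attached_matching G t v J_attached b x
    using deg v fin(4) induced_matching_subset[OF J(2), of J_attached]
    by unfold_locales (auto simp: J_attached_def)
  have "card J_attached \<le> 10 * t * t" by (rule card_attached_matching_le)
  moreover have "t \<le> t * t" "1 \<le> t * t" using calculation(4) by (auto simp: Suc_le_eq)
  ultimately show ?thesis by linarith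
qed

theorem card_matching_near_set_le:
  assumes deg: "\<And>p. p \<in> V \<Longrightarrow> 2 \<le> degree p" and X: "X \<subseteq> V"
    and J: "finite J" "induced_matching J b x" "b ` J \<subseteq> closed_nbhd X"
  shows "card J \<le> card X * (13 * t * t)"
proof -
  define J' where "J' v = {i \<in> J. b i \<in> closed_nbhd {v}}" for v
  have finX: "finite X" using X finite_V finite_subset by blast
  have "J = (\<Union>v\<in>X. J' v)" using J(3) by (fastforce simp: closed_nbhd_def J'_def)
  then have "card J \<le> (\<Sum>v\<in>X. card (J' v))" using card_UN_le[OF finX, of J'] by simp
  also have "\<dots> \<le> (\<Sum>v\<in>X. 13 * t * t)"
  proof (rule sum_mono)
    fix v assume "v \<in> X"
    then show "card (J' v) \<le> 13 * t * t"
      using X J by (intro card_matching_near_vertex_le[OF deg, of v _ b x])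
        (auto simp: J'_def intro: induced_matching_subset)
  qed
  finally show ?thesis by simp
qed

end

section \<open>Greedy choice of vertices of degree at most one\<close>

context sgraph
begin

lemma independent_set_iff: "independent_set G S \<longleftrightarrow> S \<subseteq> V \<and> (\<forall>x\<in>S. \<forall>y\<in>S. \<not> adj x y)"
  unfolding independent_set_def indep_def adj_def[symmetric] by (metis adj_irrefl)

lemma independent_set_subset: "independent_set G S \<Longrightarrow> T \<subseteq> S \<Longrightarrow> independent_set G T"
  by (auto simp: independent_set_iff)

lemma independent_set_finite: "independent_set G S \<Longrightarrow> finite S"
  using finite_V finite_subset by (auto simp: independent_set_iff)

lemma ex_maximum_independent_set: "\<exists>I. maximum_independent_set G I"
proof -
  let ?\<I> = "{I. independent_set G I}"
  have "finite ?\<I>" "{} \<in> ?\<I>"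
    using finite_V by (auto simp: independent_set_iff intro: finite_subset[of _ "Pow V"])
  then have "Max (card ` ?\<I>) \<in> card ` ?\<I>" "\<forall>I\<in>?\<I>. card I \<le> Max (card ` ?\<I>)"
    by (auto intro!: Max_in)
  then show ?thesis unfolding maximum_independent_set_def by (metis imageE mem_Collect_eq)
qed

lemma maximum_independent_set_dominating:
  assumes "maximum_independent_set G I" "b \<in> V - I"
  shows "\<exists>y\<in>I. adj b y"
proof (rule ccontr)
  assume no: "\<not> (\<exists>y\<in>I. adj b y)"
  have I: "independent_set G I" using assms(1) by (simp add: maximum_independent_set_def)
  with no assms(2) have "independent_set G (insert b I)"
    unfolding independent_set_iff using adj_sym adj_irrefl by blast
  then have "card (insert b I) \<le> card I" using assms(1) by (simp add: maximum_independent_set_def)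
  then show False using independent_set_finite[OF I] assms(2) by simp
qed

lemma independent_set_induced_subgraph_iff:
  "A \<subseteq> V \<Longrightarrow> independent_set (induced_subgraph G A) S \<longleftrightarrow> independent_set G S \<and> S \<subseteq> A"
  unfolding sgraph.independent_set_iff[OF sgraph_induced_subgraph] independent_set_iff
  by (simp add: adj_induced_subgraph) blast

definition reduced :: "'a set \<Rightarrow> 'a set \<Rightarrow> bool" where
  "reduced A S \<longleftrightarrow> A \<subseteq> V \<and> independent_set G S \<and> A \<inter> closed_nbhd S = {} \<and>
     (\<forall>I. independent_set G I \<longrightarrow> (\<exists>I'\<subseteq>A. independent_set G I' \<and> card I \<le> card S + card I'))"

lemma reduced_V: "reduced V {}"
  unfolding reduced_def by (auto simp: independent_set_iff closed_nbhd_def)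

lemma card_independent_set_closed_nbhd_le:
  assumes "card {w \<in> A. adj v w} \<le> 1" "independent_set G I" "I \<subseteq> A"
  shows "card (I \<inter> closed_nbhd {v}) \<le> 1"
proof -
  have "finite {w \<in> A. adj v w}" by (rule finite_subset[OF _ finite_neighbours]) auto
  then have "x = y" if "x \<in> A" "y \<in> A" "adj v x" "adj v y" for x y
    using assms(1) that by (auto simp: card_le_Suc0_iff_eq One_nat_def)
  then have "x = y" if "x \<in> I \<inter> closed_nbhd {v}" "y \<in> I \<inter> closed_nbhd {v}" for x y
    using that assms(2,3) adj_sym unfolding independent_set_iff closed_nbhd_def by blast
  moreover have "finite I" by (rule independent_set_finite) fact
  ultimately show ?thesis by (simp add: card_le_Suc0_iff_eq One_nat_def)
qed

lemma reduced_insert: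
  assumes red: "reduced A S" and v: "v \<in> A" "card {w \<in> A. adj v w} \<le> 1"
  shows "reduced (A - closed_nbhd {v}) (insert v S)"
proof -
  have A: "A \<subseteq> V" and S: "independent_set G S" "A \<inter> closed_nbhd S = {}"
    using red by (auto simp: reduced_def)
  then have "v \<notin> S" using v(1) by (auto simp: closed_nbhd_def)
  then have card_S: "card (insert v S) = Suc (card S)" using independent_set_finite[OF S(1)] by simp
  have "\<exists>I'\<subseteq>A - closed_nbhd {v}. independent_set G I' \<and> card I \<le> card (insert v S) + card I'"
    if I: "independent_set G I" for I
  proof -
    obtain I' where I': "I' \<subseteq> A" "independent_set G I'" "card I \<le> card S + card I'"
      using red I unfolding reduced_def by blast
    have "card I' \<le> card (I' \<inter> closed_nbhd {v}) + card (I' - closed_nbhd {v})"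
      using card_Un_le[of "I' \<inter> closed_nbhd {v}" "I' - closed_nbhd {v}"] by (simp add: Int_Diff_Un)
    also have "\<dots> \<le> 1 + card (I' - closed_nbhd {v})"
      using card_independent_set_closed_nbhd_le[OF v(2) I'(2,1)] by simp
    finally have "card I \<le> card (insert v S) + card (I' - closed_nbhd {v})" using I'(3) card_S by simp
    moreover have "independent_set G (I' - closed_nbhd {v})" using I'(2) by (rule independent_set_subset) auto
    ultimately show ?thesis using I'(1) by (intro exI[of _ "I' - closed_nbhd {v}"]) auto
  qed
  moreover have "independent_set G (insert v S)"
  proof -
    have "\<not> adj v x \<and> \<not> adj x v" if "x \<in> S" for x
      using S(2) v(1) that adj_sym unfolding closed_nbhd_def by blast
    then show ?thesis using S(1) A v(1) by (auto simp: independent_set_iff)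
  qed
  moreover have "(A - closed_nbhd {v}) \<inter> closed_nbhd (insert v S) = {}"
    using S(2) by (auto simp: closed_nbhd_def)
  ultimately show ?thesis using A unfolding reduced_def by blast
qed

lemma reduced_maximum_independent_set:
  assumes red: "reduced A S" and R: "maximum_independent_set (induced_subgraph G A) R"
  shows "maximum_independent_set G (S \<union> R)"
proof -
  have A: "A \<subseteq> V" and S: "independent_set G S" "A \<inter> closed_nbhd S = {}"
    using red by (auto simp: reduced_def)
  have R': "independent_set G R" "R \<subseteq> A"
    "\<And>I. independent_set G I \<Longrightarrow> I \<subseteq> A \<Longrightarrow> card I \<le> card R"
    using R independent_set_induced_subgraph_iff[OF A] by (auto simp: maximum_independent_set_def)
  have "\<not> adj x y" if "x \<in> S \<union> R" "y \<in> S \<union> R" for x y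
    using that S R'(1,2) adj_sym unfolding independent_set_iff closed_nbhd_def by blast
  then have "independent_set G (S \<union> R)" using S(1) R'(1) by (auto simp: independent_set_iff)
  moreover have "card I \<le> card (S \<union> R)" if I: "independent_set G I" for I
  proof -
    obtain I' where "I' \<subseteq> A" "independent_set G I'" "card I \<le> card S + card I'"
      using red I unfolding reduced_def by blast
    moreover from this have "card I' \<le> card R" by (intro R'(3))
    moreover have "card (S \<union> R) = card S + card R"
      using S R' by (intro card_Un_disjoint independent_set_finite) (auto simp: closed_nbhd_def)
    ultimately show ?thesis by simp
  qed
  ultimately show ?thesis by (simp add: maximum_independent_set_def)
qed

end

section \<open>Traces of maximal independent sets\<close>

definition (in sgraph) matching_list :: "('a \<times> 'a) list \<Rightarrow> bool" where
  "matching_list M \<longleftrightarrow> (\<forall>(u, v)\<in>set M. adj u v) \<and>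
     sorted_wrt (\<lambda>(u, v) (u', v'). \<not> adj u u' \<and> \<not> adj u v' \<and> \<not> adj v u' \<and> \<not> adj v v') M"

lemma (in sgraph) matching_list_induced_matching:
  assumes "matching_list M"
  shows "induced_matching {..<length M} (\<lambda>i. fst (M ! i)) (\<lambda>i. snd (M ! i))"
proof -
  have lt: "\<not> adj (fst (M ! i)) (fst (M ! j)) \<and> \<not> adj (fst (M ! i)) (snd (M ! j)) \<and>
      \<not> adj (snd (M ! i)) (fst (M ! j)) \<and> \<not> adj (snd (M ! i)) (snd (M ! j))"
    if "i < j" "j < length M" for i j
    using assms that unfolding matching_list_def sorted_wrt_iff_nth_less by (auto simp: case_prod_beta)
  have "adj (fst (M ! i)) (snd (M ! i))" if "i < length M" for i
    using assms nth_mem[OF that] unfolding matching_list_def by (auto simp: case_prod_beta)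
  moreover have "\<not> adj (fst (M ! i)) (fst (M ! j)) \<and> \<not> adj (fst (M ! i)) (snd (M ! j)) \<and>
      \<not> adj (snd (M ! i)) (snd (M ! j))" if "i < length M" "j < length M" "i \<noteq> j" for i j
    using lt[of i j] lt[of j i] that adj_commute by (metis linorder_neqE_nat)
  ultimately show ?thesis by (auto simp: induced_matching_def)
qed

locale ordered_sgraph = sgraph G for G :: "'a::wellorder ugraph"
begin

function fits :: "'a set \<Rightarrow> 'a \<Rightarrow> bool" where
  "fits Q w \<longleftrightarrow> w \<in> Q \<and> (\<forall>w'. w' < w \<longrightarrow> fits Q w' \<longrightarrow> \<not> adj w' w)"
  by pat_completeness auto
termination by (relation "inv_image {(x, y). x < y} snd") (auto intro: wf)

declare fits.simps [simp del]

definition first_fit :: "'a set \<Rightarrow> 'a set" where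
  "first_fit Q = {w. fits Q w}"

lemma first_fit_iff: "w \<in> first_fit Q \<longleftrightarrow> w \<in> Q \<and> (\<forall>w'\<in>first_fit Q. w' < w \<longrightarrow> \<not> adj w' w)"
  using fits.simps[of Q w] by (auto simp: first_fit_def)

lemma first_fit_eqI:
  assumes "\<And>w. w \<in> S \<longleftrightarrow> w \<in> Q \<and> (\<forall>w'\<in>S. w' < w \<longrightarrow> \<not> adj w' w)"
  shows "first_fit Q = S"
proof -
  have "w \<in> first_fit Q \<longleftrightarrow> w \<in> S" for w
  proof (induction w rule: less_induct)
    case (less w)
    then show ?case using assms[of w] first_fit_iff[of w Q] by blast
  qed
  then show ?thesis by blast
qed

lemma first_fit_subset: "first_fit Q \<subseteq> Q"
  using first_fit_iff by blast

lemma first_fit_independent: "Q \<subseteq> V \<Longrightarrow> independent_set G (first_fit Q)"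
  unfolding independent_set_iff using first_fit_iff adj_sym adj_irrefl
  by (metis linorder_neqE subset_eq)

definition kept :: "'a set \<Rightarrow> ('a \<times> 'a) list \<Rightarrow> 'a \<Rightarrow> bool" where
  "kept B M w \<longleftrightarrow> (\<forall>(u, v)\<in>set M. v \<notin> B \<or> w < v \<longrightarrow> \<not> adj u w \<and> \<not> adj v w)"

definition trace :: "'a set \<Rightarrow> ('a \<times> 'a) list \<Rightarrow> 'a set" where
  "trace B M = first_fit {w \<in> B. kept B M w}"

text \<open>The pairs \<open>M\<close> are found by decreasing elimination of the vertices, those outside \<open>B\<close> first: a pair
  \<open>(u, v)\<close> is recorded whenever the eliminated vertex \<open>v \<in> I\<close> is the only neighbour in \<open>I\<close> of some
  remaining \<open>u \<in> B\<close>. The set \<open>H\<close> contains the remaining vertices.\<close>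

definition encodes :: "'a set \<Rightarrow> 'a set \<Rightarrow> 'a set \<Rightarrow> ('a \<times> 'a) list \<Rightarrow> bool" where
  "encodes B I H M \<longleftrightarrow> set M \<subseteq> (B \<inter> H) \<times> H \<and> matching_list M \<and>
     (\<forall>w\<in>B \<inter> H. w \<in> I \<longleftrightarrow> kept B M w \<and> (\<forall>w'\<in>I \<inter> B \<inter> H. w' < w \<longrightarrow> \<not> adj w' w))"

definition eliminable :: "'a set \<Rightarrow> 'a set \<Rightarrow> 'a \<Rightarrow> bool" where
  "eliminable B H v \<longleftrightarrow> v \<in> H \<and> (v \<in> B \<longrightarrow> H \<subseteq> B \<and> (\<forall>w\<in>H. w \<le> v))"

definition dominates_rest :: "'a set \<Rightarrow> 'a set \<Rightarrow> 'a set \<Rightarrow> bool" where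
  "dominates_rest B I H \<longleftrightarrow> (\<forall>b\<in>B \<inter> H - I. \<exists>y\<in>I \<inter> H. adj b y)"

lemma ex_eliminable:
  assumes "finite H" "H \<noteq> {}"
  shows "\<exists>v. eliminable B H v"
proof (cases "H \<subseteq> B")
  case True
  then show ?thesis using assms by (intro exI[of _ "Max H"]) (auto simp: eliminable_def)
qed (auto simp: eliminable_def)

lemma eliminable_kept:
  assumes "eliminable B H v" "v \<in> B" "set M \<subseteq> X \<times> H"
  shows "kept B M v"
  using assms unfolding eliminable_def kept_def by (fastforce simp: not_less)

lemma eliminable_less: "eliminable B H v \<Longrightarrow> w \<in> B \<inter> H \<Longrightarrow> w' \<in> B \<Longrightarrow> w' < w \<Longrightarrow> w' \<noteq> v"
  by (auto simp: eliminable_def not_less[symmetric])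

lemma encodes_Nil: "encodes B I {} []"
  by (simp add: encodes_def matching_list_def)

lemma encodes_Cons:
  assumes I: "independent_set G I" and v: "eliminable B H v" "v \<in> I"
    and u: "u \<in> B \<inter> H" "adj u v" "\<And>y. y \<in> I \<inter> H \<Longrightarrow> adj u y \<Longrightarrow> y = v"
    and M: "encodes B I (H - closed_nbhd {u, v}) M"
  shows "encodes B I H ((u, v) # M)"
proof -
  define H' where "H' = H - closed_nbhd {u, v}"
  have H': "w \<in> H' \<longleftrightarrow> w \<in> H \<and> \<not> adj v w \<and> \<not> adj u w" for w
    using u(2) adj_sym[OF u(2)] by (auto simp: H'_def closed_nbhd_def)
  have vH: "v \<in> H" using v(1) by (simp add: eliminable_def)
  have not_adj: "\<not> adj x y" if "x \<in> I" "y \<in> I" for x y using I that by (simp add: independent_set_iff)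
  have I_H: "w \<in> H' \<or> w = v" if "w \<in> I \<inter> H" for w
    using that u(3)[of w] not_adj[OF v(2), of w] by (auto simp: H')
  have M': "set M \<subseteq> (B \<inter> H') \<times> H'" "matching_list M"
    "\<And>w. w \<in> B \<inter> H' \<Longrightarrow> w \<in> I \<longleftrightarrow> kept B M w \<and> (\<forall>w'\<in>I \<inter> B \<inter> H'. w' < w \<longrightarrow> \<not> adj w' w)"
    using M unfolding encodes_def H'_def by blast+
  have pairs: "set ((u, v) # M) \<subseteq> (B \<inter> H) \<times> H" using M'(1) u(1) vH by (auto simp: H')
  moreover have "matching_list ((u, v) # M)"
    using M'(1,2) u(2) unfolding matching_list_def by (auto simp: H')
  moreover have "w \<in> I \<longleftrightarrow> kept B ((u, v) # M) w \<and> (\<forall>w'\<in>I \<inter> B \<inter> H. w' < w \<longrightarrow> \<not> adj w' w)"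
    if w: "w \<in> B \<inter> H" for w
  proof -
    consider (eliminated) "w = v" | (dropped) "w \<noteq> v" "adj v w \<or> adj u w" | (remaining) "w \<in> H'"
      using w by (auto simp: H')
    then show ?thesis
    proof cases
      case eliminated
      then show ?thesis using eliminable_kept[OF v(1) _ pairs] w v(2) not_adj by blast
    next
      case dropped
      then have "w \<notin> I" using not_adj[OF v(2), of w] u(3)[of w] w by auto
      moreover have "v \<notin> B \<or> w < v" using dropped(1) v(1) w by (auto simp: eliminable_def order.strict_iff_order)
      then have "\<not> kept B ((u, v) # M) w" using dropped(2) by (auto simp: kept_def)
      ultimately show ?thesis by simp
    next
      case remaining
      then have "kept B ((u, v) # M) w \<longleftrightarrow> kept B M w" by (auto simp: kept_def H')
      moreover have "(\<forall>w'\<in>I \<inter> B \<inter> H. w' < w \<longrightarrow> \<not> adj w' w) \<longleftrightarrow>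
          (\<forall>w'\<in>I \<inter> B \<inter> H'. w' < w \<longrightarrow> \<not> adj w' w)"
        using I_H eliminable_less[OF v(1) w] H' by blast
      ultimately show ?thesis using M'(3)[of w] remaining w by simp
    qed
  qed
  ultimately show ?thesis unfolding encodes_def by blast
qed

lemma encodes_remove:
  assumes I: "independent_set G I" and v: "eliminable B H v" and dom: "dominates_rest B I H"
    and M: "encodes B I (H - {v}) M"
  shows "encodes B I H M"
proof -
  have M': "set M \<subseteq> (B \<inter> (H - {v})) \<times> (H - {v})" "matching_list M"
    "\<And>w. w \<in> B \<inter> (H - {v}) \<Longrightarrow>
      w \<in> I \<longleftrightarrow> kept B M w \<and> (\<forall>w'\<in>I \<inter> B \<inter> (H - {v}). w' < w \<longrightarrow> \<not> adj w' w)"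
    using M by (auto simp: encodes_def)
  have "w \<in> I \<longleftrightarrow> kept B M w \<and> (\<forall>w'\<in>I \<inter> B \<inter> H. w' < w \<longrightarrow> \<not> adj w' w)"
    if w: "w \<in> B \<inter> H" for w
  proof (cases "w = v")
    case True
    then have top: "H \<subseteq> B" "\<And>x. x \<in> H \<Longrightarrow> x \<le> w" using v w by (auto simp: eliminable_def)
    have "kept B M w" using True w M'(1) by (intro eliminable_kept[of B H w M B]) (use v in auto)
    moreover have "\<exists>w'\<in>I \<inter> B \<inter> H. w' < w \<and> adj w' w" if wI: "w \<notin> I"
    proof -
      obtain y where "y \<in> I \<inter> H" "adj w y" using dom w wI by (auto simp: dominates_rest_def)
      moreover from this have "y < w" using top(2)[of y] adjD(3)[of w y] by auto
      ultimately show ?thesis using top(1) adj_sym by blast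
    qed
    moreover have "\<not> adj w' w" if "w \<in> I" "w' \<in> I" for w'
      using I that by (simp add: independent_set_iff)
    ultimately show ?thesis by blast
  next
    case False
    then show ?thesis using M'(3)[of w] eliminable_less[OF v w] w by blast
  qed
  then show ?thesis using M'(1,2) unfolding encodes_def by blast
qed

lemma dominates_rest_Diff_closed_nbhd:
  assumes I: "independent_set G I" and dom: "dominates_rest B I H"
    and u: "v \<in> I" "u \<in> B \<inter> H" "adj u v" "\<And>y. y \<in> I \<inter> H \<Longrightarrow> adj u y \<Longrightarrow> y = v"
  shows "dominates_rest B I (H - closed_nbhd {u, v})"
  unfolding dominates_rest_def
proof
  fix b assume b: "b \<in> B \<inter> (H - closed_nbhd {u, v}) - I"
  then obtain y where y: "y \<in> I \<inter> H" "adj b y" using dom unfolding dominates_rest_def by blast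
  then have "y \<noteq> v" "b \<noteq> u" using b adj_sym by (auto simp: closed_nbhd_def)
  then have "y \<in> H - closed_nbhd {u, v}"
    using y u I adj_sym unfolding closed_nbhd_def independent_set_iff by blast
  with y show "\<exists>y\<in>I \<inter> (H - closed_nbhd {u, v}). adj b y" by blast
qed

lemma dominates_rest_remove:
  assumes dom: "dominates_rest B I H"
    and v: "\<And>u. v \<in> I \<Longrightarrow> u \<in> B \<inter> H \<Longrightarrow> adj u v \<Longrightarrow> \<exists>y\<in>I \<inter> H. adj u y \<and> y \<noteq> v"
  shows "dominates_rest B I (H - {v})"
  unfolding dominates_rest_def
proof
  fix b assume b: "b \<in> B \<inter> (H - {v}) - I"
  then obtain y where y: "y \<in> I \<inter> H" "adj b y" using dom unfolding dominates_rest_def by blast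
  show "\<exists>y\<in>I \<inter> (H - {v}). adj b y"
  proof (cases "y = v")
    case True
    then obtain y' where "y' \<in> I \<inter> H" "adj b y'" "y' \<noteq> v" using v[of b] y b by auto
    then show ?thesis by blast
  qed (use y in blast)
qed

lemma ex_encodes:
  assumes "finite H" "independent_set G I" "dominates_rest B I H"
  shows "\<exists>M. encodes B I H M"
  using assms(1,3)
proof (induction "card H" arbitrary: H rule: less_induct)
  case less
  show ?case
  proof (cases "H = {}")
    case True
    then show ?thesis using encodes_Nil by blast
  next
    case False
    then obtain v where v: "eliminable B H v" using ex_eliminable less.prems(1) by blast
    then have vH: "v \<in> H" by (simp add: eliminable_def)
    show ?thesis
    proof (cases "v \<in> I \<and> (\<exists>u\<in>B \<inter> H. adj u v \<and> (\<forall>y\<in>I \<inter> H. adj u y \<longrightarrow> y = v))")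
      case True
      then obtain u where u: "v \<in> I" "u \<in> B \<inter> H" "adj u v" "\<And>y. y \<in> I \<inter> H \<Longrightarrow> adj u y \<Longrightarrow> y = v"
        by blast
      let ?H = "H - closed_nbhd {u, v}"
      have "dominates_rest B I ?H" using assms(2) less.prems(2) u by (rule dominates_rest_Diff_closed_nbhd)
      moreover have "card ?H < card H"
        using vH less.prems(1) by (intro psubset_card_mono) (auto simp: closed_nbhd_def)
      ultimately obtain M where "encodes B I ?H M" using less.hyps[of ?H] less.prems(1) by blast
      then show ?thesis using encodes_Cons[OF assms(2) v u] by blast
    next
      case False
      then have "dominates_rest B I (H - {v})" using less.prems(2) by (intro dominates_rest_remove) blast+
      moreover have "card (H - {v}) < card H"
        using vH less.prems(1) by (intro psubset_card_mono) auto
      ultimately obtain M where "encodes B I (H - {v}) M" using less.hyps[of "H - {v}"] less.prems(1) by blast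
      then show ?thesis using encodes_remove[OF assms(2) v less.prems(2)] by blast
    qed
  qed
qed

theorem ex_trace:
  assumes "independent_set G I" "\<And>b. b \<in> V - I \<Longrightarrow> \<exists>y\<in>I. adj b y" "B \<subseteq> V"
  shows "\<exists>M. set M \<subseteq> B \<times> V \<and> matching_list M \<and> trace B M = I \<inter> B"
proof -
  have IV: "I \<subseteq> V" using assms(1) by (simp add: independent_set_iff)
  have "dominates_rest B I V" using assms(2) IV unfolding dominates_rest_def by blast
  then obtain M where M: "encodes B I V M" using ex_encodes[OF finite_V assms(1)] by blast
  have "trace B M = I \<inter> B"
    unfolding trace_def
    by (rule first_fit_eqI) (use M assms(3) in \<open>auto simp: encodes_def\<close>)
  with M assms(3) show ?thesis by (auto simp: encodes_def)
qed

end

section \<open>Dynamic programming over dominated separators\<close>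

definition best :: "'a set list \<Rightarrow> 'a set \<Rightarrow> 'a set" where
  "best L T = foldl (\<lambda>b S. if S \<subseteq> T \<and> card b < card S then S else b) {} L"

lemma best_Nil [simp]: "best [] T = {}"
  by (simp add: best_def)

lemma best_snoc: "best (L @ [S]) T = (if S \<subseteq> T \<and> card (best L T) < card S then S else best L T)"
  by (simp add: best_def)

lemma best_in: "best L T \<in> insert {} (set L)"
  by (induction L rule: rev_induct) (auto simp: best_snoc)

lemma best_subset: "best L T \<subseteq> T"
  by (induction L rule: rev_induct) (auto simp: best_snoc)

lemma card_le_best: "S \<in> set L \<Longrightarrow> S \<subseteq> T \<Longrightarrow> card S \<le> card (best L T)"
  by (induction L rule: rev_induct) (auto simp: best_snoc)

lemma best_append_empty: "best (L @ replicate k {}) T = best L T"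
proof (induction k)
  case (Suc k)
  have "L @ replicate (Suc k) {} = (L @ replicate k {}) @ [{}]" by (simp add: replicate_append_same)
  then show ?case using Suc by (simp only: best_snoc card.empty) simp
qed simp

text \<open>A code consists of the separator vertices \<open>X\<close>, the next path vertex \<open>p\<close>, a vertex \<open>c\<close> of the
  current component, and the pairs \<open>M\<close> of the trace; \<open>None\<close> for \<open>c\<close> stands for the whole graph.\<close>

type_synonym 'a code = "'a list \<times> 'a \<times> 'a option \<times> ('a \<times> 'a) list"

context ordered_sgraph
begin

definition bag :: "'a set \<Rightarrow> 'a set" where
  "bag X = V \<inter> closed_nbhd X"

definition away :: "'a set \<Rightarrow> 'a set" where
  "away S = {v. \<forall>u\<in>S. \<not> adj u v}"

definition region :: "'a set \<Rightarrow> 'a option \<Rightarrow> 'a set" where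
  "region X c = (case c of None \<Rightarrow> V - bag X | Some c \<Rightarrow> component (V - bag X) c)"

definition assemble :: "'a set list \<Rightarrow> 'a set \<Rightarrow> 'a \<Rightarrow> 'a option \<Rightarrow> 'a set \<Rightarrow> 'a set" where
  "assemble L X p c S =
     (let B = bag (insert p X); W = region X c \<inter> away (S \<inter> bag X)
      in (S \<inter> W) \<union> (\<Union>c'\<in>W - B. best L (component (V - B) c' \<inter> away S)))"

definition step :: "'a set list \<Rightarrow> 'a code \<Rightarrow> 'a set" where
  "step L = (\<lambda>(X, p, c, M). assemble L (set X) p c (trace (bag (insert p (set X))) M))"

definition run :: "'a set list \<Rightarrow> 'a code list \<Rightarrow> 'a set list" where
  "run L cs = foldl (\<lambda>L g. L @ [step L g]) L cs"

definition rounds :: "'a code list \<Rightarrow> nat \<Rightarrow> 'a set list" where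
  "rounds cs r = run [] (concat (replicate r cs))"

lemma bag_subset: "bag X \<subseteq> V"
  by (simp add: bag_def)

lemma bag_mono: "X \<subseteq> Y \<Longrightarrow> bag X \<subseteq> bag Y"
  by (auto simp: bag_def closed_nbhd_def)

lemma bag_empty [simp]: "bag {} = {}"
  by (simp add: bag_def closed_nbhd_def)

lemma region_subset: "region X c \<subseteq> V"
  using component_subset[of "V - bag X"] by (auto simp: region_def split: option.splits)

lemma assemble_independent:
  assumes S: "independent_set G S" and L: "\<And>U. U \<in> set L \<Longrightarrow> independent_set G U"
  shows "independent_set G (assemble L X p c S)"
proof -
  define B where "B = bag (insert p X)"
  define W where "W = region X c \<inter> away (S \<inter> bag X)"
  define T where "T c' = best L (component (V - B) c' \<inter> away S)" for c'
  have assemble: "assemble L X p c S = (S \<inter> W) \<union> (\<Union>c'\<in>W - B. T c')"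
    by (simp add: assemble_def B_def W_def T_def Let_def)
  have T: "T c' \<subseteq> component (V - B) c'" "T c' \<subseteq> away S" "independent_set G (T c')" for c'
  proof -
    show "T c' \<subseteq> component (V - B) c'" "T c' \<subseteq> away S"
      using best_subset[of L "component (V - B) c' \<inter> away S"] by (auto simp: T_def)
    have "T c' \<in> insert {} (set L)" unfolding T_def by (rule best_in)
    then show "independent_set G (T c')" using L by (auto simp: independent_set_iff)
  qed
  have parts: "\<not> adj x y" if x: "x \<in> T c1" and y: "y \<in> T c2" for c1 c2 x y
  proof
    assume xy: "adj x y"
    have "x \<in> component (V - B) c1" "y \<in> component (V - B) c2" using T(1) x y by auto
    moreover from this xy have "y \<in> component (V - B) c1"
      using component_closed component_subset by blast
    ultimately have "T c1 = T c2" unfolding T_def using component_eq by metis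
    then show False using T(3)[of c2] x y xy by (auto simp: independent_set_iff)
  qed
  have "\<not> adj x y \<and> \<not> adj y x" if "x \<in> S" "y \<in> T c'" for x y c'
    using T(2)[of c'] that adj_sym unfolding away_def by blast
  then have "\<not> adj x y" if "x \<in> assemble L X p c S" "y \<in> assemble L X p c S" for x y
    using that S parts unfolding assemble independent_set_iff by auto
  moreover have "assemble L X p c S \<subseteq> V"
    using S T(3) unfolding assemble independent_set_iff by blast
  ultimately show ?thesis by (simp add: independent_set_iff)
qed

lemma step_independent:
  assumes "\<And>U. U \<in> set L \<Longrightarrow> independent_set G U"
  shows "independent_set G (step L g)"
proof -
  obtain X p c M where g: "g = (X, p, c, M)" by (cases g)
  have "independent_set G (trace (bag (insert p (set X))) M)"
    unfolding trace_def using bag_subset by (intro first_fit_independent) auto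
  then show ?thesis unfolding g step_def prod.case using assms by (rule assemble_independent)
qed

lemma run_simps [simp]: "run L [] = L" "run L (cs @ cs') = run (run L cs) cs'"
  "run L (g # cs) = run (L @ [step L g]) cs"
  by (simp_all add: run_def)

lemma length_run: "length (run L cs) = length L + length cs"
  by (induction cs arbitrary: L) auto

lemma run_independent:
  "(\<And>U. U \<in> set L \<Longrightarrow> independent_set G U) \<Longrightarrow> U \<in> set (run L cs) \<Longrightarrow> independent_set G U"
proof (induction cs arbitrary: L)
  case (Cons g cs)
  have "independent_set G (step L g)" using Cons.prems(1) by (rule step_independent)
  then show ?case using Cons.IH[of "L @ [step L g]"] Cons.prems by auto
qed simp

lemma run_mono: "set L \<subseteq> set (run L cs)"
proof (induction cs arbitrary: L)
  case (Cons g cs)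
  have "set L \<subseteq> set (L @ [step L g])" by auto
  also have "\<dots> \<subseteq> set (run (L @ [step L g]) cs)" by (rule Cons.IH)
  finally show ?case by simp
qed simp

lemma run_step:
  assumes "g \<in> set cs"
  obtains L' where "set L \<subseteq> set L'" "step L' g \<in> set (run L cs)"
proof -
  obtain cs1 cs2 where cs: "cs = cs1 @ g # cs2" using assms by (metis split_list)
  have "step (run L cs1) g \<in> set (run L cs)"
    unfolding cs using run_mono[of "run L cs1 @ [step (run L cs1) g]" cs2] by auto
  then show ?thesis using run_mono that by blast
qed

lemma rounds_Suc: "rounds cs (Suc r) = run (rounds cs r) cs"
proof -
  have "concat (replicate (Suc r) cs) = concat (replicate r cs) @ cs"
    by (induction r) simp_all
  then show ?thesis by (simp add: rounds_def del: replicate_Suc)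
qed

lemma rounds_independent: "U \<in> set (rounds cs r) \<Longrightarrow> independent_set G U"
  unfolding rounds_def by (rule run_independent[of "[]"]) auto

end

lemma card_le_card_parts:
  assumes fin: "finite \<D>" "\<And>D. D \<in> \<D> \<Longrightarrow> finite D" "finite U"
    and disjoint: "\<And>D D'. D \<in> \<D> \<Longrightarrow> D' \<in> \<D> \<Longrightarrow> D \<noteq> D' \<Longrightarrow> D \<inter> D' = {}"
    and A: "A \<subseteq> A0 \<union> \<Union>\<D>" "A0 \<subseteq> U" "A0 \<inter> \<Union>\<D> = {}"
    and f: "\<And>D. D \<in> \<D> \<Longrightarrow> f D \<subseteq> D \<inter> U" "\<And>D. D \<in> \<D> \<Longrightarrow> card (A \<inter> D) \<le> card (f D)"
  shows "card A \<le> card U"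
proof -
  have fin_f: "finite (f D)" if "D \<in> \<D>" for D using f(1)[OF that] fin(2)[OF that] finite_subset by blast
  have A0: "finite A0" using A(2) fin(3) finite_subset by blast
  have "finite (A0 \<union> (\<Union>D\<in>\<D>. A \<inter> D))" using A0 fin by auto
  then have "card A \<le> card (A0 \<union> (\<Union>D\<in>\<D>. A \<inter> D))" using A(1) by (intro card_mono) auto
  also have "\<dots> \<le> card A0 + (\<Sum>D\<in>\<D>. card (A \<inter> D))"
    using card_Un_le[of A0 "\<Union>D\<in>\<D>. A \<inter> D"] card_UN_le[OF fin(1), of "\<lambda>D. A \<inter> D"] by linarith
  also have "\<dots> \<le> card A0 + (\<Sum>D\<in>\<D>. card (f D))" using f(2) by (simp add: sum_mono)
  also have "(\<Sum>D\<in>\<D>. card (f D)) = card (\<Union>D\<in>\<D>. f D)"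
    using fin(1) fin_f disjoint f(1) by (intro card_UN_disjoint[symmetric]) blast+
  also have "card A0 + card (\<Union>D\<in>\<D>. f D) = card (A0 \<union> (\<Union>D\<in>\<D>. f D))"
    using A0 fin(1) fin_f A(3) f(1) by (intro card_Un_disjoint[symmetric]) blast+
  also have "\<dots> \<le> card U" using fin(3) A(2) f(1) by (intro card_mono) auto
  finally show ?thesis .
qed

context ordered_sgraph
begin

lemma card_le_card_components:
  assumes I: "I \<subseteq> V" and T: "\<And>c. c \<in> T - B \<Longrightarrow> component (V - B) c \<subseteq> T"
    and f: "\<And>c. c \<in> I \<inter> T - B \<Longrightarrow> f (component (V - B) c) \<subseteq> component (V - B) c \<inter> U"
      "\<And>c. c \<in> I \<inter> T - B \<Longrightarrow> card (I \<inter> component (V - B) c) \<le> card (f (component (V - B) c))"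
    and U: "finite U" "I \<inter> T \<inter> B \<subseteq> U"
  shows "card (I \<inter> T) \<le> card U"
proof (rule card_le_card_parts[of "component (V - B) ` (I \<inter> T - B)" U "I \<inter> T" "I \<inter> T \<inter> B" f])
  have "finite I" using I finite_V finite_subset by blast
  then show "finite (component (V - B) ` (I \<inter> T - B))" by simp
  show "finite D" if "D \<in> component (V - B) ` (I \<inter> T - B)" for D
    using that component_subset[of "V - B"] finite_V by (auto intro: finite_subset)
  show "D \<inter> D' = {}" if "D \<in> component (V - B) ` (I \<inter> T - B)" "D' \<in> component (V - B) ` (I \<inter> T - B)"
    "D \<noteq> D'" for D D'
    using that component_eq by (metis (no_types, lifting) disjoint_iff imageE)
  show "I \<inter> T \<subseteq> I \<inter> T \<inter> B \<union> \<Union> (component (V - B) ` (I \<inter> T - B))"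
    using component_self[of _ "V - B"] I by auto
  show "I \<inter> T \<inter> B \<inter> \<Union> (component (V - B) ` (I \<inter> T - B)) = {}"
    using component_subset[of "V - B"] by auto
  show "card (I \<inter> T \<inter> D) \<le> card (f D)" if D: "D \<in> component (V - B) ` (I \<inter> T - B)" for D
  proof -
    obtain c where c: "c \<in> I \<inter> T - B" "D = component (V - B) c" using D by blast
    then have "I \<inter> T \<inter> D = I \<inter> D" using T[of c] by auto
    then show ?thesis using f(2)[OF c(1)] c(2) by simp
  qed
qed (use f(1) U in auto)

text \<open>The invariant of Gyarfas's path argument; the last conjunct permits prolonging the path towards \<open>D\<close>.\<close>

definition gyarfas_path :: "(nat \<Rightarrow> 'a) \<Rightarrow> nat \<Rightarrow> 'a set \<Rightarrow> bool" where
  "gyarfas_path p m D \<longleftrightarrow> induced_path p m \<and> connected D \<and> D \<subseteq> V \<and>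
     p ` {..<m} \<inter> closed_nbhd D = {} \<and> nbhd D \<subseteq> closed_nbhd (p ` {..<m}) \<and>
     (0 < m \<longrightarrow> (\<exists>z\<in>nbhd D. \<forall>i<m. adj (p i) z \<longleftrightarrow> Suc i = m))"

lemma gyarfas_path_not_adj:
  assumes "gyarfas_path p m D" "i < m" "x \<in> D"
  shows "p i \<noteq> x" "\<not> adj (p i) x"
proof -
  have "p i \<notin> closed_nbhd D" using assms(1,2) unfolding gyarfas_path_def by blast
  then show "p i \<noteq> x" "\<not> adj (p i) x" using assms(3) adj_sym unfolding closed_nbhd_def by blast+
qed

lemma contacts_dominate:
  assumes "gyarfas_path p m D"
  shows "nbhd D \<subseteq> closed_nbhd (contacts p m D)"
proof
  fix z assume z: "z \<in> nbhd D"
  then obtain d where d: "d \<in> D" "adj d z" by (auto simp: nbhd_def)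
  have "z \<noteq> p i" if "i < m" for i
    using gyarfas_path_not_adj(2)[OF assms that d(1)] d(2) adj_sym by blast
  moreover have "z \<in> closed_nbhd (p ` {..<m})" using assms z unfolding gyarfas_path_def by blast
  ultimately obtain i where "i < m" "adj (p i) z" unfolding closed_nbhd_def by auto
  then show "z \<in> closed_nbhd (contacts p m D)" using z by (auto simp: closed_nbhd_def contacts_def)
qed

lemma contacts_disjoint: "gyarfas_path p m D \<Longrightarrow> D \<inter> closed_nbhd (contacts p m D) = {}"
  using gyarfas_path_not_adj by (fastforce simp: closed_nbhd_def contacts_def)

lemma contacts_subset: "gyarfas_path p m D \<Longrightarrow> contacts p m D \<subseteq> V"
  unfolding gyarfas_path_def contacts_def induced_path_def by auto

lemma component_minus_contacts:
  assumes "gyarfas_path p m D" "c \<in> D"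
  shows "component (V - bag (contacts p m D)) c = D"
proof (rule component_eqI)
  show "connected D" "c \<in> D" using assms by (auto simp: gyarfas_path_def)
  show "D \<subseteq> V - bag (contacts p m D)"
    using contacts_disjoint[OF assms(1)] assms(1) by (auto simp: bag_def gyarfas_path_def)
  show "y \<in> D" if "x \<in> D" "adj x y" "y \<in> V - bag (contacts p m D)" for x y
    using that contacts_dominate[OF assms(1)] unfolding bag_def nbhd_def by blast
qed

lemma gyarfas_next_vertex:
  assumes path: "gyarfas_path p m D"
  shows "\<exists>z\<in>V. D \<inter> closed_nbhd {z} \<noteq> {} \<and> (\<forall>i<m. z \<noteq> p i \<and> (adj (p i) z \<longleftrightarrow> Suc i = m))"
proof (cases "m = 0")
  case True
  have "D \<noteq> {}" "D \<subseteq> V" using path connected_nonempty by (auto simp: gyarfas_path_def)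
  then show ?thesis using True by (auto simp: closed_nbhd_def)
next
  case False
  then obtain z where z: "z \<in> nbhd D" "\<forall>i<m. adj (p i) z \<longleftrightarrow> Suc i = m"
    using path by (auto simp: gyarfas_path_def)
  then obtain d where d: "d \<in> D" "adj d z" by (auto simp: nbhd_def)
  have "z \<in> V" using adjD(2)[OF d(2)] .
  moreover have "d \<in> D \<inter> closed_nbhd {z}" using d adj_sym by (auto simp: closed_nbhd_def)
  moreover have "z \<noteq> p i" if "i < m" for i
    using gyarfas_path_not_adj(2)[OF path that d(1)] d(2) adj_sym by blast
  ultimately show ?thesis using z(2) by blast
qed

lemma component_minus_next_bag_psubset:
  assumes path: "gyarfas_path p m D" and z: "D \<inter> closed_nbhd {z} \<noteq> {}"
  defines "B \<equiv> bag (insert z (contacts p m D))"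
  assumes c: "c \<in> D"
  shows "component (V - B) c \<subset> D"
proof -
  have "V - B \<subseteq> V - bag (contacts p m D)"
    unfolding B_def using bag_mono[of "contacts p m D" "insert z (contacts p m D)"] by blast
  then have "component (V - B) c \<subseteq> D"
    using component_mono component_minus_contacts[OF path c] by blast
  moreover have "D \<inter> B \<noteq> {}" using z path by (auto simp: gyarfas_path_def B_def bag_def closed_nbhd_def)
  then have "component (V - B) c \<noteq> D" using component_subset[of "V - B" c] by blast
  ultimately show ?thesis by blast
qed

lemma gyarfas_path_extend:
  assumes path: "gyarfas_path p m D"
    and z: "z \<in> V" "D \<inter> closed_nbhd {z} \<noteq> {}" "\<And>i. i < m \<Longrightarrow> z \<noteq> p i \<and> (adj (p i) z \<longleftrightarrow> Suc i = m)"
  defines "B \<equiv> bag (insert z (contacts p m D))"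
  assumes c: "c \<in> D - B"
  shows "gyarfas_path (p(m := z)) (Suc m) (component (V - B) c)" "component (V - B) c \<subset> D"
proof -
  define D' where "D' = component (V - B) c"
  let ?p = "p(m := z)"
  have DV: "D \<subseteq> V" and D: "connected D" using path by (auto simp: gyarfas_path_def)
  have D'_subset: "D' \<subseteq> V - B" unfolding D'_def by (rule component_subset)
  have psubset: "D' \<subset> D"
    unfolding D'_def B_def by (rule component_minus_next_bag_psubset) (use path z(2) c in auto)
  then show "component (V - B) c \<subset> D" by (simp add: D'_def)
  have D': "connected D'" unfolding D'_def using c DV by (intro component_connected) auto
  have leaving: "y \<in> B" if "x \<in> D'" "adj x y" "y \<notin> D'" for x y
    using that component_closed[of x "V - B" c y] adjD(2) unfolding D'_def by blast
  have z_apart: "z \<noteq> x \<and> \<not> adj z x" if "x \<in> D'" for x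
    using D'_subset that by (auto simp: B_def bag_def closed_nbhd_def)
  have p_apart: "p i \<noteq> x \<and> \<not> adj (p i) x" if "i < m" "x \<in> D" for i x
    using gyarfas_path_not_adj[OF path that] by blast
  have "?p i \<noteq> x \<and> \<not> adj (?p i) x" if "i < Suc m" "x \<in> D'" for i x
    using that z_apart[of x] p_apart[of i x] psubset by (auto simp: less_Suc_eq)
  then have "?p i \<notin> closed_nbhd D'" if "i < Suc m" for i
    using that adj_sym unfolding closed_nbhd_def by blast
  then have apart: "?p ` {..<Suc m} \<inter> closed_nbhd D' = {}" by blast
  have "insert z (contacts p m D) \<subseteq> ?p ` {..<Suc m}"
    by (auto simp: contacts_def image_iff less_Suc_eq)
  then have "B \<subseteq> closed_nbhd (?p ` {..<Suc m})" unfolding B_def bag_def closed_nbhd_def by blast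
  moreover have "nbhd D' \<subseteq> B" using leaving by (auto simp: nbhd_def)
  ultimately have dominated: "nbhd D' \<subseteq> closed_nbhd (?p ` {..<Suc m})" by blast
  obtain a b where ab: "a \<in> D'" "b \<in> D - D'" "adj a b"
    using connected_leaving_edge[OF D _ connected_nonempty[OF D']] psubset by blast
  have "b \<in> B" "b \<notin> closed_nbhd (contacts p m D)"
    using leaving[OF ab(1,3)] ab(2) contacts_disjoint[OF path] by auto
  moreover have "b \<noteq> z" using z_apart[OF ab(1)] adj_sym[OF ab(3)] by blast
  ultimately have "adj z b" by (auto simp: B_def bag_def closed_nbhd_def)
  then have "b \<in> nbhd D' \<and> (\<forall>i<Suc m. adj (?p i) b \<longleftrightarrow> Suc i = Suc m)"
    using ab p_apart[of _ b] by (auto simp: nbhd_def less_Suc_eq)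
  then have prolongable: "\<exists>y\<in>nbhd D'. \<forall>i<Suc m. adj (?p i) y \<longleftrightarrow> Suc i = Suc m" by blast
  have "induced_path ?p (Suc m)"
    by (rule induced_path_snoc) (use path z(1,3) in \<open>auto simp: gyarfas_path_def\<close>)
  moreover have "D' \<subseteq> V" using D'_subset by blast
  ultimately have "gyarfas_path ?p (Suc m) D'"
    using D' apart dominated prolongable by (simp only: gyarfas_path_def simp_thms)
  then show "gyarfas_path ?p (Suc m) (component (V - B) c)" by (simp add: D'_def)
qed

end

section \<open>Completeness of the dynamic program\<close>

lemma ex_padded_list:
  assumes "finite X" "card X \<le> k"
  shows "\<exists>xs. length xs = k \<and> X \<subseteq> set xs \<and> set xs \<subseteq> insert d X"
proof -
  obtain ys where "set ys = X" "length ys = card X"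
    using finite_distinct_list[OF assms(1)] distinct_card by metis
  then show ?thesis using assms(2) by (intro exI[of _ "ys @ replicate (k - card X) d"]) auto
qed

definition separator_size :: "nat \<Rightarrow> nat" where
  "separator_size t = 3 * t"

definition trace_size :: "nat \<Rightarrow> nat" where
  "trace_size t = Suc (separator_size t) * (13 * t * t)"

locale min_degree_two_friendship_free = ordered_sgraph G + friendship_free G t
  for G :: "'a::wellorder ugraph" and t +
  fixes none :: 'a
  assumes min_degree: "p \<in> V \<Longrightarrow> 2 \<le> degree p" and none_notin: "none \<notin> V"
begin

definition valid_code :: "'a code \<Rightarrow> bool" where
  "valid_code = (\<lambda>(X, p, c, M). length X = separator_size t \<and> length M = trace_size t \<and>
     insert p (set X) \<subseteq> insert none V \<and> set M \<subseteq> insert none V \<times> insert none V \<and> set_option c \<subseteq> V)"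

lemma none_not_adj: "\<not> adj none x" "\<not> adj x none"
  using none_notin adjD by blast+

lemma kept_append_none: "kept B (M @ replicate k (none, none)) w \<longleftrightarrow> kept B M w"
  using none_not_adj unfolding kept_def by (auto simp: set_replicate_conv_if)

lemma bag_padded:
  assumes "X \<subseteq> Y" "Y \<subseteq> insert none X"
  shows "bag Y = bag X"
proof
  show "bag X \<subseteq> bag Y" using assms(1) by (rule bag_mono)
  show "bag Y \<subseteq> bag X"
    using assms(2) none_notin none_not_adj unfolding bag_def closed_nbhd_def by blast
qed

lemma assemble_cong:
  "bag X = bag Y \<Longrightarrow> bag (insert p X) = bag (insert p Y) \<Longrightarrow> assemble L X p c S = assemble L Y p c S"
  by (simp add: assemble_def region_def split: option.split)

context
  fixes I :: "'a set"
  assumes maximum: "maximum_independent_set G I"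
begin

lemma I_independent: "independent_set G I"
  using maximum by (simp add: maximum_independent_set_def)

lemma I_subset: "I \<subseteq> V"
  using I_independent by (simp add: independent_set_iff)

lemma I_not_adj: "x \<in> I \<Longrightarrow> y \<in> I \<Longrightarrow> \<not> adj x y"
  using I_independent by (simp add: independent_set_iff)

lemma ex_trace_code:
  assumes "X \<subseteq> V" "card X \<le> Suc (separator_size t)"
  shows "\<exists>M. length M = trace_size t \<and> set M \<subseteq> insert none V \<times> insert none V \<and>
    trace (bag X) M = I \<inter> bag X"
proof -
  obtain M where M: "set M \<subseteq> bag X \<times> V" "matching_list M" "trace (bag X) M = I \<inter> bag X"
    using ex_trace[OF I_independent maximum_independent_set_dominating[OF maximum] bag_subset] by blast
  have "fst (M ! i) \<in> closed_nbhd X" if "i < length M" for i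
    using M(1) nth_mem[OF that] by (cases "M ! i") (auto simp: bag_def)
  then have "card {..<length M} \<le> card X * (13 * t * t)"
    using min_degree assms(1)
    by (intro card_matching_near_set_le[OF _ _ _ matching_list_induced_matching[OF M(2)]]) auto
  also have "\<dots> \<le> trace_size t" unfolding trace_size_def by (rule mult_le_mono1[OF assms(2)])
  finally have len: "length M \<le> trace_size t" by simp
  define M' where "M' = M @ replicate (trace_size t - length M) (none, none)"
  have "trace (bag X) M' = I \<inter> bag X" using M(3) by (simp add: M'_def trace_def kept_append_none)
  moreover have "set M' \<subseteq> insert none V \<times> insert none V"
    using M(1) bag_subset by (auto simp: M'_def set_replicate_conv_if)
  moreover have "length M' = trace_size t" using len by (simp add: M'_def)
  ultimately show ?thesis by blast
qed

lemma ex_step_code: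
  assumes X: "X \<subseteq> V" "card X \<le> separator_size t" and z: "z \<in> V" and c: "c \<in> V"
  shows "\<exists>g. valid_code g \<and> (\<forall>L. step L g = assemble L X z (Some c) (I \<inter> bag (insert z X)))"
proof -
  have finX: "finite X" using X(1) finite_V finite_subset by blast
  then obtain xs where xs: "length xs = separator_size t" "X \<subseteq> set xs" "set xs \<subseteq> insert none X"
    using ex_padded_list[OF _ X(2)] by blast
  have "card (insert z X) \<le> Suc (separator_size t)" using X(2) finX by (simp add: card_insert_if)
  then obtain M where M: "length M = trace_size t" "set M \<subseteq> insert none V \<times> insert none V"
      "trace (bag (insert z X)) M = I \<inter> bag (insert z X)"
    using ex_trace_code[of "insert z X"] X(1) z by auto
  have bags: "bag (set xs) = bag X" "bag (insert z (set xs)) = bag (insert z X)"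
    by (rule bag_padded; use xs in auto)+
  have "valid_code (xs, z, Some c, M)" using xs M X(1) z c by (auto simp: valid_code_def)
  moreover have "step L (xs, z, Some c, M) = assemble L X z (Some c) (I \<inter> bag (insert z X))" for L
    using assemble_cong[OF bags] by (simp add: step_def bags M(3))
  ultimately show ?thesis by blast
qed

definition solves :: "(nat \<Rightarrow> 'a) \<Rightarrow> nat \<Rightarrow> 'a set \<Rightarrow> 'a set \<Rightarrow> bool" where
  "solves p m D U \<longleftrightarrow> U \<subseteq> D \<inter> away (I \<inter> closed_nbhd (contacts p m D)) \<and> card (I \<inter> D) \<le> card U"

lemma solves_away:
  assumes "gyarfas_path p m D" "solves p m D U" "D \<inter> B = {}"
  shows "U \<subseteq> D \<inter> away (I \<inter> B)"
proof -
  have U: "U \<subseteq> D" "U \<subseteq> away (I \<inter> closed_nbhd (contacts p m D))"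
    using assms(2) by (auto simp: solves_def)
  have "\<not> adj u v" if "v \<in> U" "u \<in> I \<inter> B" for u v
  proof
    assume uv: "adj u v"
    have "v \<in> D" "u \<notin> D" using U(1) that assms(3) by auto
    then have "u \<in> nbhd D" using adj_sym[OF uv] by (auto simp: nbhd_def)
    then have "u \<in> closed_nbhd (contacts p m D)" using contacts_dominate[OF assms(1)] by blast
    then show False using U(2) that uv by (auto simp: away_def)
  qed
  then show ?thesis using U(1) by (auto simp: away_def)
qed

lemma assemble_solves:
  fixes z :: 'a
  assumes path: "gyarfas_path p m D" and c: "c \<in> D"
  defines "X \<equiv> contacts p m D"
  defines "B \<equiv> bag (insert z X)"
  assumes parts: "\<And>c'. c' \<in> D - B \<Longrightarrow> gyarfas_path (p(m := z)) (Suc m) (component (V - B) c') \<and>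
      component (V - B) c' \<subset> D \<and> (\<exists>U\<in>set L. solves (p(m := z)) (Suc m) (component (V - B) c') U)"
  shows "solves p m D (assemble L X z (Some c) (I \<inter> B))"
proof -
  define W where "W = D \<inter> away (I \<inter> closed_nbhd X)"
  define f where "f D' = best L (D' \<inter> away (I \<inter> B))" for D'
  define U where "U = assemble L X z (Some c) (I \<inter> B)"
  have DV: "D \<subseteq> V" using path by (simp add: gyarfas_path_def)
  have f: "f D' \<subseteq> D' \<inter> away (I \<inter> B)" for D' unfolding f_def by (rule best_subset)
  have XB: "bag X \<subseteq> B" unfolding B_def by (rule bag_mono) auto
  have IB: "I \<inter> B \<inter> bag X = I \<inter> closed_nbhd X" using XB I_subset by (auto simp: bag_def)
  have IW: "I \<inter> D \<subseteq> W" using I_not_adj by (auto simp: W_def away_def)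
  have U: "U = (I \<inter> B \<inter> W) \<union> (\<Union>c'\<in>W - B. f (component (V - B) c'))"
    using component_minus_contacts[OF path c, folded X_def]
    by (simp add: U_def assemble_def region_def IB flip: B_def W_def f_def)
  have UW: "U \<subseteq> W"
  proof -
    have "f (component (V - B) c') \<subseteq> W" if "c' \<in> W - B" for c'
      using parts[of c'] f[of "component (V - B) c'"] that IB[symmetric] by (auto simp: W_def away_def)
    then show ?thesis unfolding U by blast
  qed
  have "card (I \<inter> D) \<le> card U"
  proof (rule card_le_card_components[OF I_subset, where B = B and f = f])
    show "component (V - B) c' \<subseteq> D" if "c' \<in> D - B" for c' using parts[OF that] by blast
    show "finite U" using UW DV finite_V by (auto simp: W_def intro: finite_subset)
    show "I \<inter> D \<inter> B \<subseteq> U" using IW unfolding U by blast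
    fix c' assume c': "c' \<in> I \<inter> D - B"
    define D' where "D' = component (V - B) c'"
    have "f D' \<subseteq> U" using IW c' unfolding U D'_def by blast
    then show "f (component (V - B) c') \<subseteq> component (V - B) c' \<inter> U" using f by (auto simp: D'_def)
    obtain U' where path': "gyarfas_path (p(m := z)) (Suc m) D'" and U': "U' \<in> set L" "solves (p(m := z)) (Suc m) D' U'"
      using parts[of c'] c' by (auto simp: D'_def)
    have "D' \<inter> B = {}" using component_subset[of "V - B" c'] by (auto simp: D'_def)
    then have "card U' \<le> card (f D')"
      unfolding f_def using U'(1) solves_away[OF path' U'(2)] by (intro card_le_best) auto
    then show "card (I \<inter> component (V - B) c') \<le> card (f (component (V - B) c'))"
      using U'(2) unfolding solves_def D'_def by linarith
  qed
  then show ?thesis using UW unfolding solves_def W_def U_def X_def by blast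
qed

lemma ex_solving_code:
  assumes path: "gyarfas_path p m D" and L: "\<And>p' m' D'. gyarfas_path p' m' D' \<Longrightarrow> card D' < card D \<Longrightarrow>
      \<exists>U\<in>set L. solves p' m' D' U"
  shows "\<exists>g. valid_code g \<and> (\<forall>L'. set L \<subseteq> set L' \<longrightarrow> solves p m D (step L' g))"
proof -
  define X where "X = contacts p m D"
  have D: "connected D" "D \<subseteq> V" using path by (auto simp: gyarfas_path_def)
  obtain z where z: "z \<in> V" "D \<inter> closed_nbhd {z} \<noteq> {}"
      "\<And>i. i < m \<Longrightarrow> z \<noteq> p i \<and> (adj (p i) z \<longleftrightarrow> Suc i = m)"
    using gyarfas_next_vertex[OF path] by blast
  obtain c where c: "c \<in> D" using connected_nonempty[OF D(1)] by blast
  have "X \<subseteq> V" using contacts_subset[OF path] by (simp add: X_def)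
  moreover have "card X \<le> separator_size t"
    using card_contacts_le path unfolding X_def separator_size_def gyarfas_path_def by blast
  ultimately obtain g where g: "valid_code g"
      "\<And>L'. step L' g = assemble L' X z (Some c) (I \<inter> bag (insert z X))"
    using ex_step_code[of X z c] z(1) c D(2) by blast
  have "solves p m D (step L' g)" if L': "set L \<subseteq> set L'" for L'
    unfolding g(2) X_def
  proof (rule assemble_solves[OF path c])
    let ?B = "bag (insert z (contacts p m D))"
    fix c' assume c': "c' \<in> D - ?B"
    note extend = gyarfas_path_extend[OF path z c']
    moreover have "card (component (V - ?B) c') < card D"
      using extend(2) D(2) finite_V by (intro psubset_card_mono) (auto intro: finite_subset)
    ultimately show "gyarfas_path (p(m := z)) (Suc m) (component (V - ?B) c') \<and>
        component (V - ?B) c' \<subset> D \<and>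
        (\<exists>U\<in>set L'. solves (p(m := z)) (Suc m) (component (V - ?B) c') U)"
      using L L' by blast
  qed
  with g(1) show ?thesis by blast
qed

lemma rounds_solve:
  assumes cs: "\<And>g. valid_code g \<Longrightarrow> g \<in> set cs"
  shows "gyarfas_path p m D \<Longrightarrow> card D \<le> r \<Longrightarrow> \<exists>U\<in>set (rounds cs r). solves p m D U"
proof (induction r arbitrary: p m D)
  case 0
  then have "D \<noteq> {}" "finite D"
    using connected_nonempty finite_V finite_subset by (auto simp: gyarfas_path_def)
  then show ?case using 0 by simp
next
  case (Suc r)
  have "\<exists>U\<in>set (rounds cs r). solves p' m' D' U" if "gyarfas_path p' m' D'" "card D' < card D" for p' m' D'
    using Suc.IH[OF that(1)] that(2) Suc.prems(2) by simp
  then obtain g where g: "valid_code g"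
      "\<And>L. set (rounds cs r) \<subseteq> set L \<Longrightarrow> solves p m D (step L g)"
    using ex_solving_code[OF Suc.prems(1)] by blast
  obtain L where "set (rounds cs r) \<subseteq> set L" "step L g \<in> set (rounds cs (Suc r))"
    unfolding rounds_Suc by (rule run_step[OF cs[OF g(1)]])
  then show ?case using g(2) by blast
qed

definition initial_code :: "'a code" where
  "initial_code = (replicate (separator_size t) none, none, None, replicate (trace_size t) (none, none))"

lemma valid_initial_code: "valid_code initial_code"
  by (auto simp: initial_code_def valid_code_def)

lemma step_initial_code: "step L initial_code = (\<Union>c\<in>V. best L (component V c))"
proof -
  let ?xs = "replicate (separator_size t) none"
  have "bag Y = {}" if "Y \<subseteq> {none}" for Y using bag_padded[of "{}" Y] that by simp
  then have bags: "bag (set ?xs) = {}" "bag (insert none (set ?xs)) = {}"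
    by (simp_all add: set_replicate_conv_if)
  have "trace {} M = {}" for M using first_fit_subset[of "{w \<in> {}. kept {} M w}"] by (simp add: trace_def)
  then show ?thesis
    by (simp add: initial_code_def step_def assemble_def bags region_def away_def)
qed

lemma card_I_le_rounds:
  assumes cs: "\<And>g. valid_code g \<Longrightarrow> g \<in> set cs" and r: "card V \<le> r"
  shows "card I \<le> card (best (rounds cs (Suc r)) V)"
proof -
  obtain L where L: "set (rounds cs r) \<subseteq> set L" "step L initial_code \<in> set (rounds cs (Suc r))"
    unfolding rounds_Suc by (rule run_step[OF cs[OF valid_initial_code]])
  define U where "U = step L initial_code"
  have U: "U = (\<Union>c\<in>V. best L (component V c))" unfolding U_def by (rule step_initial_code)
  have UV: "U \<subseteq> V" unfolding U by (intro UN_least order_trans[OF best_subset component_subset])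
  have "card (I \<inter> V) \<le> card U"
  proof (rule card_le_card_components[OF I_subset, where B = "{}" and f = "best L"])
    show "component (V - {}) c \<subseteq> V" for c using component_subset by auto
    show "finite U" using UV finite_V finite_subset by blast
    fix c assume c: "c \<in> I \<inter> V - {}"
    then show "best L (component (V - {}) c) \<subseteq> component (V - {}) c \<inter> U"
      using best_subset[of L "component V c"] unfolding U by auto
    define D where "D = component V c"
    have D: "connected D" "D \<subseteq> V" using c component_connected component_subset by (auto simp: D_def)
    have "nbhd D = {}"
      using component_closed[of _ V c] adjD(2) unfolding nbhd_def D_def by blast
    then have "gyarfas_path p 0 D" for p using D by (auto simp: gyarfas_path_def induced_path_def)
    moreover have "card D \<le> r" using r card_mono[OF finite_V D(2)] by simp
    ultimately obtain U' where "U' \<in> set (rounds cs r)" "U' \<subseteq> D" "card (I \<inter> D) \<le> card U'"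
      using rounds_solve[OF cs] unfolding solves_def by blast
    then have "card (I \<inter> D) \<le> card (best L D)"
      using L(1) card_le_best[of U' L D] by auto
    then show "card (I \<inter> component (V - {}) c) \<le> card (best L (component (V - {}) c))"
      by (simp add: D_def)
  qed auto
  moreover have "I \<inter> V = I" using I_subset by auto
  ultimately show ?thesis using card_le_best[OF L(2), of V] UV by (simp add: U_def)
qed

end

theorem rounds_maximum_independent_set:
  assumes "\<And>g. valid_code g \<Longrightarrow> g \<in> set cs" "card V \<le> r"
  shows "maximum_independent_set G (best (rounds cs (Suc r)) V)"
proof -
  obtain I where I: "maximum_independent_set G I" using ex_maximum_independent_set by blast
  have "independent_set G (best (rounds cs (Suc r)) V)"
    using best_in[of "rounds cs (Suc r)" V] rounds_independent by (auto simp: independent_set_iff)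
  moreover have "card I \<le> card (best (rounds cs (Suc r)) V)" using card_I_le_rounds[OF I assms] .
  ultimately show ?thesis using I unfolding maximum_independent_set_def by (meson order_trans)
qed

end

section \<open>A loop language\<close>

datatype var = Digit nat | Local nat

datatype arr = Input | Core | Greedy | Sep_Bag | Bag | Trace | Reached | Region | Target | Best | Assembled | Table

datatype expr =
    Var var
  | Num nat
  | Plus expr expr
  | Minus expr expr
  | Read arr expr
  | Cond expr expr expr
  | Total var expr

datatype com =
    Noop
  | Assign var expr
  | Write arr expr expr
  | Then com com (infixr ";;" 60)
  | Branch expr com com
  | Loop var com

type_synonym store = "(var \<Rightarrow> nat) \<times> (arr \<Rightarrow> nat \<Rightarrow> nat)"

abbreviation set_var :: "var \<Rightarrow> nat \<Rightarrow> store \<Rightarrow> store" where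
  "set_var x v \<sigma> \<equiv> ((fst \<sigma>)(x := v), snd \<sigma>)"

text \<open>Sums and loops range over \<open>0, \<dots>, n\<close>; the array \<open>Input\<close> has \<open>n\<^sup>2\<close> cells, and writing beyond
  them has no effect.\<close>

fun expr_val :: "nat \<Rightarrow> store \<Rightarrow> expr \<Rightarrow> nat" where
  "expr_val n \<sigma> (Var x) = fst \<sigma> x"
| "expr_val n \<sigma> (Num c) = c"
| "expr_val n \<sigma> (Plus a b) = expr_val n \<sigma> a + expr_val n \<sigma> b"
| "expr_val n \<sigma> (Minus a b) = expr_val n \<sigma> a - expr_val n \<sigma> b"
| "expr_val n \<sigma> (Read a e) = snd \<sigma> a (expr_val n \<sigma> e)"
| "expr_val n \<sigma> (Cond c a b) = (if expr_val n \<sigma> c \<noteq> 0 then expr_val n \<sigma> a else expr_val n \<sigma> b)"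
| "expr_val n \<sigma> (Total x e) = (\<Sum>i<Suc n. expr_val n (set_var x i \<sigma>) e)"

definition array_write :: "nat \<Rightarrow> arr \<Rightarrow> nat \<Rightarrow> nat \<Rightarrow> store \<Rightarrow> store" where
  "array_write n a i v \<sigma> =
     (if a = Input \<and> n * n \<le> i then \<sigma> else (fst \<sigma>, (snd \<sigma>)(a := (snd \<sigma> a)(i := v))))"

fun sem :: "nat \<Rightarrow> com \<Rightarrow> store \<Rightarrow> store" where
  "sem n Noop \<sigma> = \<sigma>"
| "sem n (Assign x e) \<sigma> = set_var x (expr_val n \<sigma> e) \<sigma>"
| "sem n (Write a e1 e2) \<sigma> = array_write n a (expr_val n \<sigma> e1) (expr_val n \<sigma> e2) \<sigma>"
| "sem n (c ;; d) \<sigma> = sem n d (sem n c \<sigma>)"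
| "sem n (Branch e c d) \<sigma> = (if expr_val n \<sigma> e \<noteq> 0 then sem n c \<sigma> else sem n d \<sigma>)"
| "sem n (Loop x c) \<sigma> = foldl (\<lambda>\<sigma> i. sem n c (set_var x i \<sigma>)) \<sigma> [0..<Suc n]"

section \<open>Compilation to random access machines\<close>

definition size_reg :: reg where "size_reg = 0"
definition bound_reg :: reg where "bound_reg = 1"
definition square_reg :: reg where "square_reg = 2"

fun var_reg :: "var \<Rightarrow> reg" where
  "var_reg (Digit i) = 4 * i + 3"
| "var_reg (Local i) = 4 * i + 5"

definition tmp :: "nat \<Rightarrow> reg" where
  "tmp d = 2 * d + 4"

fun arr_index :: "arr \<Rightarrow> nat" where
  "arr_index Input = 0" | "arr_index Core = 1" | "arr_index Greedy = 2" | "arr_index Sep_Bag = 3"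
| "arr_index Bag = 4" | "arr_index Trace = 5" | "arr_index Reached = 6" | "arr_index Region = 7"
| "arr_index Target = 8" | "arr_index Best = 9" | "arr_index Assembled = 10" | "arr_index Table = 11"

definition cell :: "nat \<Rightarrow> arr \<Rightarrow> nat \<Rightarrow> nat" where
  "cell n a i = n * n + 16 * i + arr_index a"

lemma var_reg_eq_iff [simp]: "var_reg x = var_reg y \<longleftrightarrow> x = y"
  by (cases x; cases y) (simp_all, presburger+)

lemma tmp_eq_iff [simp]: "tmp d = tmp e \<longleftrightarrow> d = e"
  by (simp add: tmp_def)

lemma var_reg_neq_tmp [simp]: "var_reg x \<noteq> tmp d" "tmp d \<noteq> var_reg x"
  by (cases x; simp add: tmp_def; presburger)+

lemma fixed_reg_distinct [simp]:
  "size_reg \<noteq> bound_reg" "size_reg \<noteq> square_reg" "bound_reg \<noteq> square_reg"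
  "bound_reg \<noteq> size_reg" "square_reg \<noteq> size_reg" "square_reg \<noteq> bound_reg"
  by (simp_all add: size_reg_def bound_reg_def square_reg_def)

lemma var_reg_neq_fixed_reg [simp]:
  "var_reg x \<noteq> size_reg" "var_reg x \<noteq> bound_reg" "var_reg x \<noteq> square_reg"
  "size_reg \<noteq> var_reg x" "bound_reg \<noteq> var_reg x" "square_reg \<noteq> var_reg x"
  by (cases x; simp add: size_reg_def bound_reg_def square_reg_def)+

lemma tmp_neq_fixed_reg [simp]:
  "tmp d \<noteq> size_reg" "tmp d \<noteq> bound_reg" "tmp d \<noteq> square_reg"
  "size_reg \<noteq> tmp d" "bound_reg \<noteq> tmp d" "square_reg \<noteq> tmp d"
  by (auto simp: tmp_def size_reg_def bound_reg_def square_reg_def)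

lemma cell_eq_iff: "cell n a i = cell n b j \<longleftrightarrow> a = b \<and> i = j"
proof
  assume "cell n a i = cell n b j"
  then have "16 * i + arr_index a = 16 * j + arr_index b" by (simp add: cell_def)
  moreover have "arr_index c < 16" for c by (cases c) simp_all
  from this[of a] this[of b] calculation have "i = j" "arr_index a = arr_index b" by presburger+
  then show "a = b \<and> i = j" by (cases a; cases b) simp_all
qed simp

fun block :: "prog list \<Rightarrow> prog" where
  "block [] = Skip"
| "block (P # Ps) = Seq P (block Ps)"

definition address_prog :: "arr \<Rightarrow> nat \<Rightarrow> prog" where
  "address_prog a d = block [Add (tmp d) (tmp d) (tmp d), Add (tmp d) (tmp d) (tmp d),
     Add (tmp d) (tmp d) (tmp d), Add (tmp d) (tmp d) (tmp d),
     Const (tmp (Suc d)) (arr_index a), Add (tmp d) (tmp d) (tmp (Suc d)), Add (tmp d) (tmp d) square_reg]"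

definition total_init :: "var \<Rightarrow> nat \<Rightarrow> prog" where
  "total_init x d = block [Copy (tmp d) (var_reg x), Const (tmp (Suc d)) 0, Const (var_reg x) 0,
     Sub (tmp (Suc (Suc d))) bound_reg (var_reg x)]"

definition total_exit :: "var \<Rightarrow> nat \<Rightarrow> prog" where
  "total_exit x d = block [Copy (var_reg x) (tmp d), Copy (tmp d) (tmp (Suc d))]"

definition total_body :: "var \<Rightarrow> (nat \<Rightarrow> prog) \<Rightarrow> nat \<Rightarrow> prog" where
  "total_body x E d = Seq (E (Suc (Suc d)))
     (block [Add (tmp (Suc d)) (tmp (Suc d)) (tmp (Suc (Suc d))), Const (tmp (Suc (Suc d))) 1,
        Add (var_reg x) (var_reg x) (tmp (Suc (Suc d))), Sub (tmp (Suc (Suc d))) bound_reg (var_reg x)])"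

definition loop_body :: "var \<Rightarrow> (nat \<Rightarrow> prog) \<Rightarrow> nat \<Rightarrow> prog" where
  "loop_body x P d = Seq (Copy (var_reg x) (tmp d)) (Seq (P (Suc d))
     (block [Const (tmp (Suc d)) 1, Add (tmp d) (tmp d) (tmp (Suc d)), Sub (tmp (Suc d)) bound_reg (tmp d)]))"

text \<open>\<open>compile_expr e d\<close> leaves the value of \<open>e\<close> in \<open>tmp d\<close> and does not change \<open>tmp d'\<close> for \<open>d' < d\<close>.\<close>

fun compile_expr :: "expr \<Rightarrow> nat \<Rightarrow> prog" where
  "compile_expr (Var x) d = Copy (tmp d) (var_reg x)"
| "compile_expr (Num c) d = Const (tmp d) c"
| "compile_expr (Plus a b) d =
     Seq (compile_expr a d) (Seq (compile_expr b (Suc d)) (Add (tmp d) (tmp d) (tmp (Suc d))))"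
| "compile_expr (Minus a b) d =
     Seq (compile_expr a d) (Seq (compile_expr b (Suc d)) (Sub (tmp d) (tmp d) (tmp (Suc d))))"
| "compile_expr (Read a e) d = Seq (compile_expr e d)
     (if a = Input
      then Seq (Sub (tmp (Suc d)) square_reg (tmp d))
        (IfNZ (tmp (Suc d)) (Load (tmp d) (tmp d)) (Const (tmp d) 0))
      else Seq (address_prog a d) (Load (tmp d) (tmp d)))"
| "compile_expr (Cond c a b) d = Seq (compile_expr c d) (IfNZ (tmp d) (compile_expr a d) (compile_expr b d))"
| "compile_expr (Total x e) d = Seq (total_init x d)
     (Seq (WhileNZ (tmp (Suc (Suc d))) (total_body x (compile_expr e) d)) (total_exit x d))"

fun compile :: "com \<Rightarrow> nat \<Rightarrow> prog" where
  "compile Noop d = Skip"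
| "compile (Assign x e) d = Seq (compile_expr e d) (Copy (var_reg x) (tmp d))"
| "compile (Write a e1 e2) d = Seq (compile_expr e1 d) (if a = Input
     then Seq (compile_expr e2 (Suc d)) (Seq (Sub (tmp (Suc (Suc d))) square_reg (tmp d))
       (IfNZ (tmp (Suc (Suc d))) (Store (tmp d) (tmp (Suc d))) Skip))
     else Seq (address_prog a d) (Seq (compile_expr e2 (Suc d)) (Store (tmp d) (tmp (Suc d)))))"
| "compile (c1 ;; c2) d = Seq (compile c1 d) (compile c2 d)"
| "compile (Branch e c1 c2) d = Seq (compile_expr e d) (IfNZ (tmp d) (compile c1 d) (compile c2 d))"
| "compile (Loop x c) d = Seq (block [Const (tmp d) 0, Sub (tmp (Suc d)) bound_reg (tmp d)])
     (WhileNZ (tmp (Suc d)) (loop_body x (compile c) d))"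

subsection \<open>Execution within a time bound\<close>

definition runs :: "prog \<Rightarrow> state \<Rightarrow> nat \<Rightarrow> (state \<Rightarrow> bool) \<Rightarrow> bool" where
  "runs P s T Q \<longleftrightarrow> (\<exists>k s'. exec P s k s' \<and> k \<le> T \<and> Q s')"

lemma runs_conseq: "runs P s T Q \<Longrightarrow> T \<le> T' \<Longrightarrow> (\<And>s'. Q s' \<Longrightarrow> Q' s') \<Longrightarrow> runs P s T' Q'"
  unfolding runs_def by (meson order_trans)

lemma runs_Seq:
  "runs P s T R \<Longrightarrow> (\<And>s'. R s' \<Longrightarrow> runs P' s' T' Q) \<Longrightarrow> runs (Seq P P') s (T + T') Q"
  unfolding runs_def by (meson exec.Seq add_mono)

lemma runs_If:
  assumes "fst s x \<noteq> 0 \<Longrightarrow> runs P s T Q" "fst s x = 0 \<Longrightarrow> runs P' s T' Q"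
  shows "runs (IfNZ x P P') s (T + T' + 1) Q"
proof (cases "fst s x = 0")
  case True
  then obtain k s' where "exec P' s k s'" "k \<le> T'" "Q s'" using assms(2) by (auto simp: runs_def)
  then show ?thesis
    unfolding runs_def using exec.IfFalse[OF True, of P' k s' P] by (intro exI[of _ "1 + k"] exI[of _ s']) auto
next
  case False
  then obtain k s' where "exec P s k s'" "k \<le> T" "Q s'" using assms(1) by (auto simp: runs_def)
  then show ?thesis
    unfolding runs_def using exec.IfTrue[OF False, of P k s' P'] by (intro exI[of _ "1 + k"] exI[of _ s']) auto
qed

lemma runs_While:
  assumes body: "\<And>i s. i < N \<Longrightarrow> Inv i s \<Longrightarrow> fst s x \<noteq> 0 \<and> runs P s T (Inv (Suc i))"
    and exit: "\<And>s. Inv N s \<Longrightarrow> fst s x = 0"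
    and "Inv 0 s"
  shows "runs (WhileNZ x P) s (N * (T + 1) + 1) (Inv N)"
proof -
  have "runs (WhileNZ x P) s ((N - i) * (T + 1) + 1) (Inv N)" if "i \<le> N" "Inv i s" for i s
    using that
  proof (induction "N - i" arbitrary: i s)
    case 0
    then have "i = N" by simp
    then show ?case
      unfolding runs_def using 0 exit exec.WhileFalse[of s x P] by (intro exI[of _ 1] exI[of _ s]) auto
  next
    case (Suc k)
    then have i: "i < N" "k = N - Suc i" "Suc i \<le> N" by auto
    obtain j s' where s': "fst s x \<noteq> 0" "exec P s j s'" "j \<le> T" "Inv (Suc i) s'"
      using body[OF i(1) Suc.prems(2)] unfolding runs_def by blast
    obtain l s'' where s'': "exec (WhileNZ x P) s' l s''" "l \<le> (N - Suc i) * (T + 1) + 1" "Inv N s''"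
      using Suc.hyps(1)[OF i(2,3) s'(4)] unfolding runs_def by blast
    have "N - i = Suc (N - Suc i)" using i by simp
    then have "1 + j + l \<le> (N - i) * (T + 1) + 1" using s'(3) s''(2) by simp
    then show ?case
      unfolding runs_def using exec.WhileTrue[OF s'(1,2) s''(1)] s''(3) by blast
  qed
  from this[of 0 s] assms(3) show ?thesis by simp
qed

fun is_instr :: "prog \<Rightarrow> bool" where
  "is_instr (Seq P Q) = False"
| "is_instr (IfNZ x P Q) = False"
| "is_instr (WhileNZ x P) = False"
| "is_instr _ = True"

fun effect :: "prog \<Rightarrow> state \<Rightarrow> state" where
  "effect (Const x c) s = ((fst s)(x := c), snd s)"
| "effect (Copy x y) s = ((fst s)(x := fst s y), snd s)"
| "effect (Add x y z) s = ((fst s)(x := fst s y + fst s z), snd s)"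
| "effect (Sub x y z) s = ((fst s)(x := fst s y - fst s z), snd s)"
| "effect (Load x y) s = ((fst s)(x := snd s (fst s y)), snd s)"
| "effect (Store x y) s = (fst s, (snd s)(fst s x := fst s y))"
| "effect _ s = s"

lemma runs_instr:
  assumes "is_instr P" "Q (effect P s)"
  shows "runs P s 1 Q"
proof -
  have "exec P s 1 (effect P s)"
    using assms(1) by (cases s; cases P) (auto intro: exec.intros[unfolded One_nat_def])
  with assms(2) show ?thesis unfolding runs_def by blast
qed

lemma runs_block:
  "list_all is_instr Ps \<Longrightarrow> Q (fold effect Ps s) \<Longrightarrow> runs (block Ps) s (Suc (length Ps)) Q"
proof (induction Ps arbitrary: s)
  case Nil
  then show ?case using runs_instr[of Skip Q s] by simp
next
  case (Cons P Ps)
  have "runs (Seq P (block Ps)) s (1 + Suc (length Ps)) Q"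
    using Cons by (intro runs_Seq[OF runs_instr[of P "\<lambda>s'. s' = effect P s"]]) auto
  then show ?case by simp
qed

subsection \<open>Representation of stores\<close>

definition represents :: "nat \<Rightarrow> store \<Rightarrow> state \<Rightarrow> bool" where
  "represents n \<sigma> s \<longleftrightarrow> fst s size_reg = n \<and> fst s bound_reg = Suc n \<and> fst s square_reg = n * n \<and>
     (\<forall>x. fst s (var_reg x) = fst \<sigma> x) \<and>
     (\<forall>a i. a \<noteq> Input \<longrightarrow> snd s (cell n a i) = snd \<sigma> a i) \<and>
     (\<forall>i. snd \<sigma> Input i = (if i < n * n then snd s i else 0))"

lemma representsD:
  assumes "represents n \<sigma> s"
  shows "fst s bound_reg = Suc n" "fst s square_reg = n * n" "fst s (var_reg x) = fst \<sigma> x"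
    "a \<noteq> Input \<Longrightarrow> snd s (cell n a i) = snd \<sigma> a i"
    "snd \<sigma> Input i = (if i < n * n then snd s i else 0)"
  using assms by (simp_all add: represents_def)

lemma represents_tmp [simp]: "represents n \<sigma> (r(tmp d := v), m) \<longleftrightarrow> represents n \<sigma> (r, m)"
  by (simp add: represents_def)

lemma represents_collapse [simp]: "m = snd s \<Longrightarrow> represents n \<sigma> (fst s, m) \<longleftrightarrow> represents n \<sigma> s"
  by simp

lemma represents_var:
  "represents n \<sigma> s \<Longrightarrow> represents n (set_var x v \<sigma>) ((fst s)(var_reg x := v), snd s)"
  by (auto simp: represents_def)

lemma represents_cong:
  "represents n \<sigma> s \<Longrightarrow> (\<And>y. \<forall>d. y \<noteq> tmp d \<Longrightarrow> r y = fst s y) \<Longrightarrow> represents n \<sigma> (r, snd s)"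
  by (simp add: represents_def)

lemma represents_array_write:
  assumes "represents n \<sigma> s"
  shows "a \<noteq> Input \<Longrightarrow> represents n (array_write n a i v \<sigma>) (fst s, (snd s)(cell n a i := v))"
    and "i < n * n \<Longrightarrow> represents n (array_write n Input i v \<sigma>) (fst s, (snd s)(i := v))"
  using assms by (auto simp: represents_def array_write_def cell_eq_iff) (auto simp: cell_def)

definition computes :: "nat \<Rightarrow> store \<Rightarrow> nat \<Rightarrow> nat \<Rightarrow> state \<Rightarrow> state \<Rightarrow> bool" where
  "computes n \<sigma> d v s s' \<longleftrightarrow> represents n \<sigma> s' \<and> snd s' = snd s \<and> fst s' (tmp d) = v \<and>
     (\<forall>d'<d. fst s' (tmp d') = fst s (tmp d'))"

definition evaluates :: "nat \<Rightarrow> (nat \<Rightarrow> prog) \<Rightarrow> nat \<Rightarrow> (store \<Rightarrow> nat) \<Rightarrow> bool" where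
  "evaluates n E T f \<longleftrightarrow>
     (\<forall>\<sigma> s d. represents n \<sigma> s \<longrightarrow> runs (E d) s T (computes n \<sigma> d (f \<sigma>) s))"

definition implements :: "nat \<Rightarrow> (nat \<Rightarrow> prog) \<Rightarrow> nat \<Rightarrow> (store \<Rightarrow> store) \<Rightarrow> bool" where
  "implements n P T F \<longleftrightarrow>
     (\<forall>\<sigma> s d. represents n \<sigma> s \<longrightarrow>
        runs (P d) s T (\<lambda>s'. represents n (F \<sigma>) s' \<and> (\<forall>d'<d. fst s' (tmp d') = fst s (tmp d'))))"

lemma evaluatesD: "evaluates n E T f \<Longrightarrow> represents n \<sigma> s \<Longrightarrow> runs (E d) s T (computes n \<sigma> d (f \<sigma>) s)"
  unfolding evaluates_def by blast

lemma implementsD: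
  "implements n P T F \<Longrightarrow> represents n \<sigma> s \<Longrightarrow>
    runs (P d) s T (\<lambda>s'. represents n (F \<sigma>) s' \<and> (\<forall>d'<d. fst s' (tmp d') = fst s (tmp d')))"
  unfolding implements_def by blast

subsection \<open>Correctness of compiled expressions\<close>

lemma evaluates_instr:
  assumes "\<And>d. is_instr (I d)"
    "\<And>\<sigma> s d. represents n \<sigma> s \<Longrightarrow> effect (I d) s = ((fst s)(tmp d := f \<sigma>), snd s)"
  shows "evaluates n I 1 f"
  unfolding evaluates_def
proof (intro allI impI)
  fix \<sigma> s d assume "represents n \<sigma> s"
  then show "runs (I d) s 1 (computes n \<sigma> d (f \<sigma>) s)"
    using assms by (intro runs_instr) (simp_all add: computes_def)
qed

lemma evaluates_binary:
  assumes A: "evaluates n A S f" and B: "evaluates n B T g"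
    and I: "\<And>d. is_instr (I d)"
      "\<And>d s. effect (I d) s = ((fst s)(tmp d := h (fst s (tmp d)) (fst s (tmp (Suc d)))), snd s)"
  shows "evaluates n (\<lambda>d. Seq (A d) (Seq (B (Suc d)) (I d))) (S + (T + 1)) (\<lambda>\<sigma>. h (f \<sigma>) (g \<sigma>))"
  unfolding evaluates_def
proof (intro allI impI)
  fix \<sigma> s d assume s: "represents n \<sigma> s"
  show "runs (Seq (A d) (Seq (B (Suc d)) (I d))) s (S + (T + 1)) (computes n \<sigma> d (h (f \<sigma>) (g \<sigma>)) s)"
  proof (rule runs_Seq[OF evaluatesD[OF A s]])
    fix s1 assume s1: "computes n \<sigma> d (f \<sigma>) s s1"
    then have "represents n \<sigma> s1" by (simp add: computes_def)
    then show "runs (Seq (B (Suc d)) (I d)) s1 (T + 1) (computes n \<sigma> d (h (f \<sigma>) (g \<sigma>)) s)"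
    proof (rule runs_Seq[OF evaluatesD[OF B]])
      fix s2 assume "computes n \<sigma> (Suc d) (g \<sigma>) s1 s2"
      with s1 I show "runs (I d) s2 1 (computes n \<sigma> d (h (f \<sigma>) (g \<sigma>)) s)"
        by (intro runs_instr) (auto simp: computes_def)
    qed
  qed
qed

lemma evaluates_Read_Input:
  assumes E: "evaluates n E T f"
  shows "evaluates n (\<lambda>d. Seq (E d) (Seq (Sub (tmp (Suc d)) square_reg (tmp d))
      (IfNZ (tmp (Suc d)) (Load (tmp d) (tmp d)) (Const (tmp d) 0)))) (T + 4) (\<lambda>\<sigma>. snd \<sigma> Input (f \<sigma>))"
  unfolding evaluates_def
proof (intro allI impI)
  fix \<sigma> s d assume "represents n \<sigma> s"
  then show "runs (Seq (E d) (Seq (Sub (tmp (Suc d)) square_reg (tmp d))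
      (IfNZ (tmp (Suc d)) (Load (tmp d) (tmp d)) (Const (tmp d) 0)))) s (T + 4)
      (computes n \<sigma> d (snd \<sigma> Input (f \<sigma>)) s)" (is "runs (Seq _ ?P) _ _ ?Q")
  proof (rule runs_Seq[OF evaluatesD[OF E]])
    fix s1 assume s1: "computes n \<sigma> d (f \<sigma>) s s1"
    then have rep: "represents n \<sigma> s1" by (simp add: computes_def)
    have "runs ?P s1 (1 + (1 + 1 + 1)) ?Q"
      using s1 representsD(2,5)[OF rep]
      by (intro runs_Seq[OF runs_instr[where Q = "\<lambda>s2. s2 = effect (Sub (tmp (Suc d)) square_reg (tmp d)) s1"]]
          runs_If runs_instr) (auto simp: computes_def)
    then show "runs ?P s1 4 ?Q" by (rule runs_conseq) auto
  qed
qed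

lemma runs_address_prog:
  assumes "represents n \<sigma> s"
  shows "runs (address_prog a d) s 8 (computes n \<sigma> d (cell n a (fst s (tmp d))) s)"
proof -
  have "runs (address_prog a d) s (Suc 7) (computes n \<sigma> d (cell n a (fst s (tmp d))) s)"
    unfolding address_prog_def using assms representsD(2)[OF assms]
    by (intro runs_conseq[OF runs_block]) (auto simp: computes_def cell_def)
  then show ?thesis by simp
qed

lemma evaluates_Read:
  assumes E: "evaluates n E T f" and a: "a \<noteq> Input"
  shows "evaluates n (\<lambda>d. Seq (E d) (Seq (address_prog a d) (Load (tmp d) (tmp d)))) (T + (8 + 1))
    (\<lambda>\<sigma>. snd \<sigma> a (f \<sigma>))"
  unfolding evaluates_def
proof (intro allI impI)
  fix \<sigma> s d assume s: "represents n \<sigma> s"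
  show "runs (Seq (E d) (Seq (address_prog a d) (Load (tmp d) (tmp d)))) s (T + (8 + 1))
      (computes n \<sigma> d (snd \<sigma> a (f \<sigma>)) s)"
  proof (rule runs_Seq[OF evaluatesD[OF E s]])
    fix s1 assume s1: "computes n \<sigma> d (f \<sigma>) s s1"
    then have rep: "represents n \<sigma> s1" by (simp add: computes_def)
    then show "runs (Seq (address_prog a d) (Load (tmp d) (tmp d))) s1 (8 + 1)
        (computes n \<sigma> d (snd \<sigma> a (f \<sigma>)) s)"
    proof (rule runs_Seq[OF runs_address_prog])
      fix s2 assume "computes n \<sigma> d (cell n a (fst s1 (tmp d))) s1 s2"
      with s1 show "runs (Load (tmp d) (tmp d)) s2 1 (computes n \<sigma> d (snd \<sigma> a (f \<sigma>)) s)"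
        using representsD(4)[OF rep a, of "f \<sigma>"] by (intro runs_instr) (auto simp: computes_def)
    qed
  qed
qed

lemma evaluates_Cond:
  assumes C: "evaluates n C R f" and A: "evaluates n A S g" and B: "evaluates n B T h"
  shows "evaluates n (\<lambda>d. Seq (C d) (IfNZ (tmp d) (A d) (B d))) (R + (S + T + 1))
    (\<lambda>\<sigma>. if f \<sigma> \<noteq> 0 then g \<sigma> else h \<sigma>)"
  unfolding evaluates_def
proof (intro allI impI)
  fix \<sigma> s d assume s: "represents n \<sigma> s"
  show "runs (Seq (C d) (IfNZ (tmp d) (A d) (B d))) s (R + (S + T + 1))
      (computes n \<sigma> d (if f \<sigma> \<noteq> 0 then g \<sigma> else h \<sigma>) s)"
  proof (intro runs_Seq[OF evaluatesD[OF C s]] runs_If)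
    fix s1 assume s1: "computes n \<sigma> d (f \<sigma>) s s1"
    then have rep: "represents n \<sigma> s1" by (simp add: computes_def)
    show "runs (A d) s1 S (computes n \<sigma> d (if f \<sigma> \<noteq> 0 then g \<sigma> else h \<sigma>) s)" if "fst s1 (tmp d) \<noteq> 0"
      using that s1 by (intro runs_conseq[OF evaluatesD[OF A rep]]) (auto simp: computes_def)
    show "runs (B d) s1 T (computes n \<sigma> d (if f \<sigma> \<noteq> 0 then g \<sigma> else h \<sigma>) s)" if "fst s1 (tmp d) = 0"
      using that s1 by (intro runs_conseq[OF evaluatesD[OF B rep]]) (auto simp: computes_def)
  qed
qed

definition total_inv :: "nat \<Rightarrow> store \<Rightarrow> var \<Rightarrow> (store \<Rightarrow> nat) \<Rightarrow> nat \<Rightarrow> state \<Rightarrow> nat \<Rightarrow> state \<Rightarrow> bool" where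
  "total_inv n \<sigma> x f d s i s' \<longleftrightarrow>
     represents n (set_var x i \<sigma>) s' \<and> snd s' = snd s \<and> fst s' (tmp d) = fst \<sigma> x \<and>
     fst s' (tmp (Suc d)) = (\<Sum>j<i. f (set_var x j \<sigma>)) \<and>
     fst s' (tmp (Suc (Suc d))) = Suc n - i \<and> (\<forall>d'<d. fst s' (tmp d') = fst s (tmp d'))"

lemma total_body_inv:
  assumes E: "evaluates n E T f" and i: "i < Suc n" and inv: "total_inv n \<sigma> x f d s i s1"
  shows "runs (total_body x E d) s1 (T + 5) (total_inv n \<sigma> x f d s (Suc i))"
proof -
  let ?\<sigma> = "\<lambda>i. set_var x i \<sigma>"
  have rep: "represents n (?\<sigma> i) s1" using inv by (simp add: total_inv_def)
  show ?thesis
    unfolding total_body_def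
  proof (rule runs_Seq[OF evaluatesD[OF E rep]])
    fix s2 assume s2: "computes n (?\<sigma> i) (Suc (Suc d)) (f (?\<sigma> i)) s1 s2"
    then have rep2: "represents n (?\<sigma> i) s2" by (simp add: computes_def)
    have "snd s2 = snd s" using s2 inv by (simp add: computes_def total_inv_def)
    then have "represents n (?\<sigma> (Suc i)) ((fst s2)(var_reg x := Suc i), snd s)"
      using represents_var[OF rep2, of x "Suc i"] by simp
    then have rep3: "represents n (?\<sigma> (Suc i)) (r, snd s)"
      if "\<And>y. \<forall>d. y \<noteq> tmp d \<Longrightarrow> r y = ((fst s2)(var_reg x := Suc i)) y" for r
      using represents_cong[of n "?\<sigma> (Suc i)" "((fst s2)(var_reg x := Suc i), snd s)" r] that by simp
    show "runs (block [Add (tmp (Suc d)) (tmp (Suc d)) (tmp (Suc (Suc d))), Const (tmp (Suc (Suc d))) 1,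
        Add (var_reg x) (var_reg x) (tmp (Suc (Suc d))), Sub (tmp (Suc (Suc d))) bound_reg (var_reg x)])
        s2 5 (total_inv n \<sigma> x f d s (Suc i))"
      using s2 inv i
      by (intro runs_conseq[OF runs_block])
        (auto simp: total_inv_def computes_def representsD(1,3)[OF rep2] intro!: rep3)
  qed
qed

lemma runs_total_init:
  assumes "represents n \<sigma> s"
  shows "runs (total_init x d) s 5 (total_inv n \<sigma> x f d s 0)"
proof -
  have "represents n (set_var x 0 \<sigma>) ((fst s)(var_reg x := 0), snd s)"
    using assms by (intro represents_var) simp
  then have "represents n (set_var x 0 \<sigma>) (r, snd s)"
    if "\<And>y. \<forall>d. y \<noteq> tmp d \<Longrightarrow> r y = ((fst s)(var_reg x := 0)) y" for r
    using represents_cong[of n "set_var x 0 \<sigma>" "((fst s)(var_reg x := 0), snd s)" r] that by simp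
  note rep = this
  show ?thesis
    unfolding total_init_def
    by (intro runs_conseq[OF runs_block]) (auto simp: total_inv_def representsD(1,3)[OF assms] intro!: rep)
qed

lemma runs_total_exit:
  assumes inv: "total_inv n \<sigma> x f d s (Suc n) s'"
  shows "runs (total_exit x d) s' 3 (computes n \<sigma> d (\<Sum>i<Suc n. f (set_var x i \<sigma>)) s)"
proof -
  have "represents n (set_var x (Suc n) \<sigma>) s'" "snd s' = snd s" using inv by (simp_all add: total_inv_def)
  from represents_var[OF this(1), of x "fst \<sigma> x"] this(2)
  have "represents n \<sigma> ((fst s')(var_reg x := fst \<sigma> x), snd s)" by simp
  with inv show ?thesis
    unfolding total_exit_def by (intro runs_conseq[OF runs_block]) (auto simp: computes_def total_inv_def)
qed

lemma evaluates_Total: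
  assumes E: "evaluates n E T f"
  shows "evaluates n (\<lambda>d. Seq (total_init x d)
      (Seq (WhileNZ (tmp (Suc (Suc d))) (total_body x E d)) (total_exit x d)))
    (5 + (Suc n * (T + 5 + 1) + 1 + 3)) (\<lambda>\<sigma>. \<Sum>i<Suc n. f (set_var x i \<sigma>))"
  unfolding evaluates_def
proof (intro allI impI)
  fix \<sigma> s d assume s: "represents n \<sigma> s"
  let ?Inv = "total_inv n \<sigma> x f d s"
  show "runs (Seq (total_init x d) (Seq (WhileNZ (tmp (Suc (Suc d))) (total_body x E d)) (total_exit x d))) s
    (5 + (Suc n * (T + 5 + 1) + 1 + 3)) (computes n \<sigma> d (\<Sum>i<Suc n. f (set_var x i \<sigma>)) s)"
  proof (rule runs_Seq[OF runs_total_init[OF s]])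
    fix s1 assume "?Inv 0 s1"
    then have "runs (WhileNZ (tmp (Suc (Suc d))) (total_body x E d)) s1 (Suc n * (T + 5 + 1) + 1) (?Inv (Suc n))"
    proof (rule runs_While[rotated 2])
      show "fst s2 (tmp (Suc (Suc d))) \<noteq> 0 \<and> runs (total_body x E d) s2 (T + 5) (?Inv (Suc i))"
        if "i < Suc n" "?Inv i s2" for i s2
        using that total_body_inv[OF E that] by (simp add: total_inv_def)
    qed (simp add: total_inv_def)
    then show "runs (Seq (WhileNZ (tmp (Suc (Suc d))) (total_body x E d)) (total_exit x d)) s1
        (Suc n * (T + 5 + 1) + 1 + 3) (computes n \<sigma> d (\<Sum>i<Suc n. f (set_var x i \<sigma>)) s)"
      by (rule runs_Seq) (rule runs_total_exit)
  qed
qed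

fun expr_time :: "nat \<Rightarrow> expr \<Rightarrow> nat" where
  "expr_time n (Var x) = 1"
| "expr_time n (Num c) = 1"
| "expr_time n (Plus a b) = expr_time n a + (expr_time n b + 1)"
| "expr_time n (Minus a b) = expr_time n a + (expr_time n b + 1)"
| "expr_time n (Read a e) = expr_time n e + (8 + 1)"
| "expr_time n (Cond c a b) = expr_time n c + (expr_time n a + expr_time n b + 1)"
| "expr_time n (Total x e) = 5 + (Suc n * (expr_time n e + 5 + 1) + 1 + 3)"

lemma evaluates_mono: "evaluates n E T f \<Longrightarrow> T \<le> T' \<Longrightarrow> evaluates n E T' f"
  unfolding evaluates_def by (blast intro: runs_conseq)

lemma evaluates_compile_expr: "evaluates n (compile_expr e) (expr_time n e) (\<lambda>\<sigma>. expr_val n \<sigma> e)"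
proof (induction e)
  case (Var x)
  have "evaluates n (\<lambda>d. Copy (tmp d) (var_reg x)) 1 (\<lambda>\<sigma>. fst \<sigma> x)"
    by (rule evaluates_instr) (simp_all add: representsD(3))
  then show ?case by simp
next
  case (Num c)
  have "evaluates n (\<lambda>d. Const (tmp d) c) 1 (\<lambda>\<sigma>. c)" by (rule evaluates_instr) simp_all
  then show ?case by simp
next
  case (Plus a b)
  from evaluates_binary[OF Plus, of "\<lambda>d. Add (tmp d) (tmp d) (tmp (Suc d))" "(+)"] show ?case by simp
next
  case (Minus a b)
  from evaluates_binary[OF Minus, of "\<lambda>d. Sub (tmp d) (tmp d) (tmp (Suc d))" "(-)"] show ?case by simp
next
  case (Read a e)
  then show ?case
    using evaluates_Read_Input[OF Read, THEN evaluates_mono] evaluates_Read[OF Read]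
    by (cases "a = Input") simp_all
next
  case (Total x e)
  show ?case using evaluates_Total[OF Total] by simp
next
  case (Cond c a b)
  from evaluates_Cond[OF Cond] show ?case by simp
qed

subsection \<open>Correctness of compiled commands\<close>

lemma implements_Assign:
  assumes E: "evaluates n E T f"
  shows "implements n (\<lambda>d. Seq (E d) (Copy (var_reg x) (tmp d))) (T + 1)
    (\<lambda>\<sigma>. set_var x (f \<sigma>) \<sigma>)"
  unfolding implements_def
proof (intro allI impI runs_Seq[OF evaluatesD[OF E]])
  fix \<sigma> s d s1 assume s1: "computes n \<sigma> d (f \<sigma>) s s1"
  then have "represents n (set_var x (f \<sigma>) \<sigma>) ((fst s1)(var_reg x := f \<sigma>), snd s1)"
    unfolding computes_def by (intro represents_var) simp
  with s1 show "runs (Copy (var_reg x) (tmp d)) s1 1 (\<lambda>s'. represents n (set_var x (f \<sigma>) \<sigma>) s' \<and>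
      (\<forall>d'<d. fst s' (tmp d') = fst s (tmp d')))"
    by (intro runs_instr) (auto simp: computes_def)
qed

lemma implements_Write_Input:
  assumes A: "evaluates n A S f" and B: "evaluates n B T g"
  shows "implements n (\<lambda>d. Seq (A d) (Seq (B (Suc d)) (Seq (Sub (tmp (Suc (Suc d))) square_reg (tmp d))
      (IfNZ (tmp (Suc (Suc d))) (Store (tmp d) (tmp (Suc d))) Skip)))) (S + (T + (1 + (1 + 1 + 1))))
    (\<lambda>\<sigma>. array_write n Input (f \<sigma>) (g \<sigma>) \<sigma>)"
  unfolding implements_def
proof (intro allI impI runs_Seq[OF evaluatesD[OF A]])
  fix \<sigma> and s s1 :: state and d
  let ?Q = "\<lambda>s'. represents n (array_write n Input (f \<sigma>) (g \<sigma>) \<sigma>) s' \<and> (\<forall>d'<d. fst s' (tmp d') = fst s (tmp d'))"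
  assume s1: "computes n \<sigma> d (f \<sigma>) s s1"
  then have "represents n \<sigma> s1" by (simp add: computes_def)
  then show "runs (Seq (B (Suc d)) (Seq (Sub (tmp (Suc (Suc d))) square_reg (tmp d))
      (IfNZ (tmp (Suc (Suc d))) (Store (tmp d) (tmp (Suc d))) Skip))) s1 (T + (1 + (1 + 1 + 1))) ?Q"
  proof (rule runs_Seq[OF evaluatesD[OF B]])
    fix s2 assume s2: "computes n \<sigma> (Suc d) (g \<sigma>) s1 s2"
    then have rep: "represents n \<sigma> s2" by (simp add: computes_def)
    have "fst s2 (tmp d) = f \<sigma>" "fst s2 (tmp (Suc d)) = g \<sigma>" "fst s2 square_reg = n * n"
        "\<forall>d'<d. fst s2 (tmp d') = fst s (tmp d')"
      using s1 s2 by (auto simp: computes_def representsD(2))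
    then show "runs (Seq (Sub (tmp (Suc (Suc d))) square_reg (tmp d))
        (IfNZ (tmp (Suc (Suc d))) (Store (tmp d) (tmp (Suc d))) Skip)) s2 (1 + (1 + 1 + 1)) ?Q"
      by (intro runs_Seq[OF runs_instr[where Q = "\<lambda>s3. s3 = effect (Sub (tmp (Suc (Suc d))) square_reg (tmp d)) s2"]]
          runs_If runs_instr)
        (auto simp: represents_array_write(2)[OF rep], auto simp: array_write_def rep)
  qed
qed

lemma implements_Write:
  assumes A: "evaluates n A S f" and B: "evaluates n B T g" and a: "a \<noteq> Input"
  shows "implements n (\<lambda>d. Seq (A d) (Seq (address_prog a d) (Seq (B (Suc d)) (Store (tmp d) (tmp (Suc d))))))
    (S + (8 + (T + 1))) (\<lambda>\<sigma>. array_write n a (f \<sigma>) (g \<sigma>) \<sigma>)"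
  unfolding implements_def
proof (intro allI impI runs_Seq[OF evaluatesD[OF A]])
  fix \<sigma> and s s1 :: state and d
  let ?Q = "\<lambda>s'. represents n (array_write n a (f \<sigma>) (g \<sigma>) \<sigma>) s' \<and> (\<forall>d'<d. fst s' (tmp d') = fst s (tmp d'))"
  assume s1: "computes n \<sigma> d (f \<sigma>) s s1"
  then have "represents n \<sigma> s1" by (simp add: computes_def)
  then show "runs (Seq (address_prog a d) (Seq (B (Suc d)) (Store (tmp d) (tmp (Suc d))))) s1 (8 + (T + 1)) ?Q"
  proof (rule runs_Seq[OF runs_address_prog])
    fix s2 assume s2: "computes n \<sigma> d (cell n a (fst s1 (tmp d))) s1 s2"
    then have "represents n \<sigma> s2" by (simp add: computes_def)
    then show "runs (Seq (B (Suc d)) (Store (tmp d) (tmp (Suc d)))) s2 (T + 1) ?Q"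
    proof (rule runs_Seq[OF evaluatesD[OF B]])
      fix s3 assume s3: "computes n \<sigma> (Suc d) (g \<sigma>) s2 s3"
      then have "represents n \<sigma> s3" by (simp add: computes_def)
      from represents_array_write(1)[OF this a, of "f \<sigma>" "g \<sigma>"] s1 s2 s3
      show "runs (Store (tmp d) (tmp (Suc d))) s3 1 ?Q"
        by (intro runs_instr) (auto simp: computes_def)
    qed
  qed
qed

lemma implements_Then:
  assumes "implements n P S F" "implements n P' T F'"
  shows "implements n (\<lambda>d. Seq (P d) (P' d)) (S + T) (\<lambda>\<sigma>. F' (F \<sigma>))"
  unfolding implements_def
proof (intro allI impI runs_Seq[OF implementsD[OF assms(1)]])
  fix \<sigma> and s s1 :: state and d
  assume s1: "represents n (F \<sigma>) s1 \<and> (\<forall>d'<d. fst s1 (tmp d') = fst s (tmp d'))"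
  then show "runs (P' d) s1 T (\<lambda>s'. represents n (F' (F \<sigma>)) s' \<and> (\<forall>d'<d. fst s' (tmp d') = fst s (tmp d')))"
    by (intro runs_conseq[OF implementsD[OF assms(2)]]) auto
qed

lemma implements_Branch:
  assumes E: "evaluates n E R f" and P: "implements n P S F" and P': "implements n P' T F'"
  shows "implements n (\<lambda>d. Seq (E d) (IfNZ (tmp d) (P d) (P' d))) (R + (S + T + 1))
    (\<lambda>\<sigma>. if f \<sigma> \<noteq> 0 then F \<sigma> else F' \<sigma>)"
  unfolding implements_def
proof (intro allI impI runs_Seq[OF evaluatesD[OF E]] runs_If)
  fix \<sigma> and s s1 :: state and d
  let ?Q = "\<lambda>s'. represents n (if f \<sigma> \<noteq> 0 then F \<sigma> else F' \<sigma>) s' \<and> (\<forall>d'<d. fst s' (tmp d') = fst s (tmp d'))"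
  assume s1: "computes n \<sigma> d (f \<sigma>) s s1"
  then have rep: "represents n \<sigma> s1" by (simp add: computes_def)
  show "runs (P d) s1 S ?Q" if "fst s1 (tmp d) \<noteq> 0"
    using that s1 by (intro runs_conseq[OF implementsD[OF P rep]]) (auto simp: computes_def)
  show "runs (P' d) s1 T ?Q" if "fst s1 (tmp d) = 0"
    using that s1 by (intro runs_conseq[OF implementsD[OF P' rep]]) (auto simp: computes_def)
qed

definition iterate :: "var \<Rightarrow> (store \<Rightarrow> store) \<Rightarrow> nat \<Rightarrow> store \<Rightarrow> store" where
  "iterate x F k \<sigma> = foldl (\<lambda>\<sigma> i. F (set_var x i \<sigma>)) \<sigma> [0..<k]"

lemma iterate_0 [simp]: "iterate x F 0 \<sigma> = \<sigma>"
  and iterate_Suc [simp]: "iterate x F (Suc k) \<sigma> = F ((fst (iterate x F k \<sigma>))(x := k), snd (iterate x F k \<sigma>))"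
  by (simp_all add: iterate_def)

definition loop_inv :: "nat \<Rightarrow> (nat \<Rightarrow> store) \<Rightarrow> nat \<Rightarrow> state \<Rightarrow> nat \<Rightarrow> state \<Rightarrow> bool" where
  "loop_inv n \<tau> d s i s' \<longleftrightarrow> represents n (\<tau> i) s' \<and> fst s' (tmp d) = i \<and>
     fst s' (tmp (Suc d)) = Suc n - i \<and> (\<forall>d'<d. fst s' (tmp d') = fst s (tmp d'))"

lemma loop_body_inv:
  assumes P: "implements n P T F" and inv: "loop_inv n (\<lambda>k. iterate x F k \<sigma>) d s i s1"
  shows "runs (loop_body x P d) s1 (1 + (T + 4)) (loop_inv n (\<lambda>k. iterate x F k \<sigma>) d s (Suc i))"
    (is "runs _ _ _ ?Q")
  unfolding loop_body_def
proof (rule runs_Seq[OF runs_instr[where Q = "\<lambda>s2. s2 = ((fst s1)(var_reg x := i), snd s1)"]])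
  let ?\<sigma> = "((fst (iterate x F i \<sigma>))(x := i), snd (iterate x F i \<sigma>))"
  fix s2 assume s2: "s2 = ((fst s1)(var_reg x := i), snd s1)"
  have "represents n ?\<sigma> s2"
    unfolding s2 by (rule represents_var) (use inv in \<open>simp add: loop_inv_def\<close>)
  then show "runs (Seq (P (Suc d)) (block [Const (tmp (Suc d)) 1, Add (tmp d) (tmp d) (tmp (Suc d)),
      Sub (tmp (Suc d)) bound_reg (tmp d)])) s2 (T + 4) ?Q"
  proof (rule runs_Seq[OF implementsD[OF P]])
    fix s3 assume s3: "represents n (F ?\<sigma>) s3 \<and> (\<forall>d'<Suc d. fst s3 (tmp d') = fst s2 (tmp d'))"
    then have "represents n (F ?\<sigma>) s3" "fst s3 bound_reg = Suc n" "fst s3 (tmp d) = i"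
        "\<forall>d'<d. fst s3 (tmp d') = fst s (tmp d')"
      using inv s2 by (auto simp: loop_inv_def representsD(1))
    then show "runs (block [Const (tmp (Suc d)) 1, Add (tmp d) (tmp d) (tmp (Suc d)),
        Sub (tmp (Suc d)) bound_reg (tmp d)]) s3 4 ?Q"
      by (intro runs_conseq[OF runs_block]) (auto simp: loop_inv_def)
  qed
qed (use inv in \<open>simp_all add: loop_inv_def\<close>)

lemma implements_Loop:
  assumes P: "implements n P T F"
  shows "implements n (\<lambda>d. Seq (block [Const (tmp d) 0, Sub (tmp (Suc d)) bound_reg (tmp d)])
      (WhileNZ (tmp (Suc d)) (loop_body x P d))) (3 + (Suc n * (1 + (T + 4) + 1) + 1))
    (iterate x F (Suc n))"
  unfolding implements_def
proof (intro allI impI)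
  fix \<sigma> s d assume s: "represents n \<sigma> s"
  let ?Inv = "loop_inv n (\<lambda>k. iterate x F k \<sigma>) d s"
  show "runs (Seq (block [Const (tmp d) 0, Sub (tmp (Suc d)) bound_reg (tmp d)])
      (WhileNZ (tmp (Suc d)) (loop_body x P d))) s (3 + (Suc n * (1 + (T + 4) + 1) + 1))
      (\<lambda>s'. represents n (iterate x F (Suc n) \<sigma>) s' \<and> (\<forall>d'<d. fst s' (tmp d') = fst s (tmp d')))"
  proof (rule runs_Seq[where R = "?Inv 0"])
    show "runs (block [Const (tmp d) 0, Sub (tmp (Suc d)) bound_reg (tmp d)]) s 3 (?Inv 0)"
      using s representsD(1)[OF s] by (intro runs_conseq[OF runs_block]) (auto simp: loop_inv_def)
    fix s1 assume "?Inv 0 s1"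
    then have "runs (WhileNZ (tmp (Suc d)) (loop_body x P d)) s1 (Suc n * (1 + (T + 4) + 1) + 1) (?Inv (Suc n))"
    proof (rule runs_While[rotated 2])
      show "fst s2 (tmp (Suc d)) \<noteq> 0 \<and> runs (loop_body x P d) s2 (1 + (T + 4)) (?Inv (Suc i))"
        if "i < Suc n" "?Inv i s2" for i s2
        using that loop_body_inv[OF P that(2)] by (simp add: loop_inv_def)
    qed (simp add: loop_inv_def)
    then show "runs (WhileNZ (tmp (Suc d)) (loop_body x P d)) s1 (Suc n * (1 + (T + 4) + 1) + 1)
        (\<lambda>s'. represents n (iterate x F (Suc n) \<sigma>) s' \<and> (\<forall>d'<d. fst s' (tmp d') = fst s (tmp d')))"
      by (rule runs_conseq) (auto simp: loop_inv_def)
  qed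
qed

fun com_time :: "nat \<Rightarrow> com \<Rightarrow> nat" where
  "com_time n Noop = 1"
| "com_time n (Assign x e) = expr_time n e + 1"
| "com_time n (Write a e1 e2) = expr_time n e1 + (8 + (expr_time n e2 + 1))"
| "com_time n (c1 ;; c2) = com_time n c1 + com_time n c2"
| "com_time n (Branch e c1 c2) = expr_time n e + (com_time n c1 + com_time n c2 + 1)"
| "com_time n (Loop x c) = 3 + (Suc n * (1 + (com_time n c + 4) + 1) + 1)"

lemma implements_mono: "implements n P T F \<Longrightarrow> T \<le> T' \<Longrightarrow> implements n P T' F"
  unfolding implements_def by (blast intro: runs_conseq)

lemma implements_compile: "implements n (compile c) (com_time n c) (sem n c)"
proof (induction c)
  case Noop
  show ?case by (auto simp: implements_def intro!: runs_instr[unfolded One_nat_def])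
next
  case (Assign x e)
  show ?case using implements_Assign[OF evaluates_compile_expr] by simp
next
  case (Write a e1 e2)
  note writes = implements_Write_Input[OF evaluates_compile_expr evaluates_compile_expr, THEN implements_mono]
    implements_Write[OF evaluates_compile_expr evaluates_compile_expr]
  show ?case
    using writes(1)[of n e1 e2] writes(2)[of a n e1 e2] by (cases "a = Input") simp_all
next
  case (Then c1 c2)
  then show ?case using implements_Then by fastforce
next
  case (Branch e c1 c2)
  then show ?case using implements_Branch[OF evaluates_compile_expr] by fastforce
next
  case (Loop x c)
  then show ?case using implements_Loop[OF Loop, of x] by (simp add: iterate_def[abs_def])
qed

subsection \<open>Initialisation and running time\<close>

definition init_prog :: prog where
  "init_prog = Seq (block [Const (tmp 0) 1, Add bound_reg size_reg (tmp 0), Copy (tmp 1) size_reg])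
     (WhileNZ (tmp 1) (block [Add square_reg square_reg size_reg, Sub (tmp 1) (tmp 1) (tmp 0)]))"

definition input_store :: "nat \<Rightarrow> nat set set \<Rightarrow> store" where
  "input_store n E = (\<lambda>_. 0, \<lambda>a. if a = Input then snd (graph_input n E) else (\<lambda>_. 0))"

definition init_inv :: "nat \<Rightarrow> nat set set \<Rightarrow> nat \<Rightarrow> state \<Rightarrow> bool" where
  "init_inv n E i s \<longleftrightarrow> snd s = snd (graph_input n E) \<and> fst s size_reg = n \<and> fst s bound_reg = Suc n \<and>
     fst s square_reg = i * n \<and> (\<forall>x. fst s (var_reg x) = 0) \<and> fst s (tmp 0) = 1 \<and> fst s (tmp 1) = n - i"

lemma runs_init_prog: "runs init_prog (graph_input n E) (4 + (n * (3 + 1) + 1)) (represents n (input_store n E))"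
  unfolding init_prog_def
proof (rule runs_Seq[where R = "init_inv n E 0"])
  have "fst (graph_input n E) = (\<lambda>_. 0)(size_reg := n)" by (simp add: graph_input_def size_reg_def)
  then show "runs (block [Const (tmp 0) 1, Add bound_reg size_reg (tmp 0), Copy (tmp 1) size_reg])
      (graph_input n E) 4 (init_inv n E 0)"
    by (intro runs_conseq[OF runs_block]) (auto simp: init_inv_def)
  fix s assume "init_inv n E 0 s"
  then have "runs (WhileNZ (tmp 1) (block [Add square_reg square_reg size_reg, Sub (tmp 1) (tmp 1) (tmp 0)]))
      s (n * (3 + 1) + 1) (init_inv n E n)"
  proof (rule runs_While[rotated 2])
    fix i s assume "i < n" "init_inv n E i s"
    then show "fst s (tmp 1) \<noteq> 0 \<and>
        runs (block [Add square_reg square_reg size_reg, Sub (tmp 1) (tmp 1) (tmp 0)]) s 3 (init_inv n E (Suc i))"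
      by (intro conjI runs_conseq[OF runs_block]) (auto simp: init_inv_def)
  qed (simp add: init_inv_def)
  then show "runs (WhileNZ (tmp 1) (block [Add square_reg square_reg size_reg, Sub (tmp 1) (tmp 1) (tmp 0)]))
      s (n * (3 + 1) + 1) (represents n (input_store n E))"
    by (rule runs_conseq) (auto simp: init_inv_def represents_def input_store_def graph_input_def cell_def)
qed

lemma power_le_power: "T \<le> (m::nat) ^ a \<Longrightarrow> a \<le> b \<Longrightarrow> 2 \<le> m \<Longrightarrow> T \<le> m ^ b"
  by (rule order_trans[OF _ power_increasing]) auto

lemma add_le_power:
  assumes "S \<le> m ^ a" "T \<le> m ^ b" "2 \<le> (m::nat)"
  shows "S + T \<le> m ^ Suc (a + b)"
proof -
  have "S \<le> m ^ (a + b)" "T \<le> m ^ (a + b)" using assms power_le_power by (meson le_add1 le_add2)+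
  then have "S + T \<le> 2 * m ^ (a + b)" by simp
  also have "\<dots> \<le> m ^ Suc (a + b)" using assms(3) by simp
  finally show ?thesis .
qed

lemma mult_le_power: "S \<le> m ^ a \<Longrightarrow> T \<le> m ^ b \<Longrightarrow> S * T \<le> (m::nat) ^ (a + b)"
  unfolding power_add by (rule mult_le_mono)

fun expr_exponent :: "expr \<Rightarrow> nat" where
  "expr_exponent (Var x) = 0"
| "expr_exponent (Num c) = 0"
| "expr_exponent (Plus a b) = expr_exponent a + expr_exponent b + 2"
| "expr_exponent (Minus a b) = expr_exponent a + expr_exponent b + 2"
| "expr_exponent (Read a e) = expr_exponent e + 5"
| "expr_exponent (Cond c a b) = expr_exponent c + expr_exponent a + expr_exponent b + 3"
| "expr_exponent (Total x e) = expr_exponent e + 15"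

fun com_exponent :: "com \<Rightarrow> nat" where
  "com_exponent Noop = 0"
| "com_exponent (Assign x e) = expr_exponent e + 1"
| "com_exponent (Write a e1 e2) = expr_exponent e1 + expr_exponent e2 + 6"
| "com_exponent (c1 ;; c2) = com_exponent c1 + com_exponent c2 + 1"
| "com_exponent (Branch e c1 c2) = expr_exponent e + com_exponent c1 + com_exponent c2 + 3"
| "com_exponent (Loop x c) = com_exponent c + 11"

context
  fixes n m :: nat
  assumes m: "2 \<le> m" "n \<le> m"
begin

lemma const_le_power: "1 \<le> m ^ 0" "3 \<le> m ^ 2" "4 \<le> m ^ 2" "5 \<le> m ^ 3" "8 \<le> m ^ 3" "8 + 1 \<le> m ^ 4"
proof -
  have "2 ^ k \<le> m ^ k" for k using m(1) by (simp add: power_mono)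
  from this[of 2] this[of 3] this[of 4]
  show "1 \<le> m ^ 0" "3 \<le> m ^ 2" "4 \<le> m ^ 2" "5 \<le> m ^ 3" "8 \<le> m ^ 3" "8 + 1 \<le> m ^ 4" by auto
qed

lemma Suc_n_le_power: "Suc n \<le> m ^ 2"
proof -
  have "Suc n \<le> m + m" using m by simp
  also have "\<dots> \<le> m * m" using m(1) by (metis mult_2 mult_le_mono1)
  finally show ?thesis by (simp add: power2_eq_square)
qed

lemma expr_time_le: "expr_time n e \<le> m ^ expr_exponent e"
proof (induction e)
  case (Plus a b)
  show ?case
    unfolding expr_time.simps
    by (rule power_le_power[OF add_le_power[OF Plus(1) add_le_power[OF Plus(2) const_le_power(1)]]])
      (simp_all add: m)
next
  case (Minus a b)
  show ?case
    unfolding expr_time.simps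
    by (rule power_le_power[OF add_le_power[OF Minus(1) add_le_power[OF Minus(2) const_le_power(1)]]])
      (simp_all add: m)
next
  case (Read a e)
  show ?case
    unfolding expr_time.simps
    by (rule power_le_power[OF add_le_power[OF Read const_le_power(6)]]) (simp_all add: m)
next
  case (Cond c a b)
  show ?case
    unfolding expr_time.simps
    by (rule power_le_power[OF add_le_power[OF Cond(1) add_le_power[OF add_le_power[OF Cond(2,3)]
          const_le_power(1)]]]) (simp_all add: m)
next
  case (Total x e)
  have "expr_time n e + 5 + 1 \<le> m ^ (expr_exponent e + 5)"
    by (rule power_le_power[OF add_le_power[OF add_le_power[OF Total const_le_power(4)] const_le_power(1)]])
      (simp_all add: m)
  then have "Suc n * (expr_time n e + 5 + 1) \<le> m ^ (2 + (expr_exponent e + 5))"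
    by (rule mult_le_power[OF Suc_n_le_power])
  then show ?case
    unfolding expr_time.simps
    by (rule power_le_power[OF add_le_power[OF const_le_power(4) add_le_power[OF
          add_le_power[OF _ const_le_power(1)] const_le_power(2)]]]) (simp_all add: m)
qed simp_all

lemma com_time_le: "com_time n c \<le> m ^ com_exponent c"
proof (induction c)
  case (Assign x e)
  show ?case
    unfolding com_time.simps
    by (rule power_le_power[OF add_le_power[OF expr_time_le const_le_power(1)]]) (simp_all add: m)
next
  case (Write a e1 e2)
  show ?case
    unfolding com_time.simps
    by (rule power_le_power[OF add_le_power[OF expr_time_le add_le_power[OF const_le_power(5)
          add_le_power[OF expr_time_le const_le_power(1)]]]]) (simp_all add: m)
next
  case (Then c1 c2)
  show ?case
    unfolding com_time.simps
    by (rule power_le_power[OF add_le_power[OF Then]]) (simp_all add: m)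
next
  case (Branch e c1 c2)
  show ?case
    unfolding com_time.simps
    by (rule power_le_power[OF add_le_power[OF expr_time_le add_le_power[OF add_le_power[OF Branch]
          const_le_power(1)]]]) (simp_all add: m)
next
  case (Loop x c)
  have "1 + (com_time n c + 4) + 1 \<le> m ^ (com_exponent c + 5)"
    by (rule power_le_power[OF add_le_power[OF add_le_power[OF const_le_power(1)
          add_le_power[OF Loop const_le_power(3)]] const_le_power(1)]]) (simp_all add: m)
  then have "Suc n * (1 + (com_time n c + 4) + 1) \<le> m ^ (2 + (com_exponent c + 5))"
    by (rule mult_le_power[OF Suc_n_le_power])
  then show ?case
    unfolding com_time.simps
    by (rule power_le_power[OF add_le_power[OF const_le_power(2) add_le_power[OF _ const_le_power(1)]]])
      (simp_all add: m)
qed simp_all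

lemma init_time_le: "4 + (n * (3 + 1) + 1) \<le> m ^ 8"
proof -
  have "n * (3 + 1) \<le> m ^ (2 + 2)"
    by (rule mult_le_power) (use Suc_n_le_power const_le_power(3) in auto)
  then have "n * (3 + 1) + (4 + 1) \<le> m ^ Suc ((2 + 2) + 3)"
    by (rule add_le_power) (use const_le_power(4) m in auto)
  then show ?thesis by simp
qed

end

definition compiled :: "com \<Rightarrow> prog" where
  "compiled c = Seq init_prog (compile c 0)"

theorem compiled_correct:
  "\<exists>k s. exec (compiled c) (graph_input n E) k s \<and> k \<le> max n 2 ^ (com_exponent c + 9) \<and>
    set_output n s = {v. v < n \<and> snd (sem n c (input_store n E)) Input v = 1}"
proof -
  have "runs (compiled c) (graph_input n E) (4 + (n * (3 + 1) + 1) + com_time n c)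
      (represents n (sem n c (input_store n E)))"
    unfolding compiled_def
    by (rule runs_Seq[OF runs_init_prog]) (auto intro: runs_conseq[OF implementsD[OF implements_compile]])
  then obtain k s where exec: "exec (compiled c) (graph_input n E) k s"
    and k: "k \<le> 4 + (n * (3 + 1) + 1) + com_time n c" and s: "represents n (sem n c (input_store n E)) s"
    unfolding runs_def by blast
  have "4 + (n * (3 + 1) + 1) + com_time n c \<le> max n 2 ^ Suc (8 + com_exponent c)"
    by (rule add_le_power[OF init_time_le com_time_le]) auto
  with k have "k \<le> max n 2 ^ (com_exponent c + 9)" by (simp add: add.commute)
  moreover have "v < n * n" if "v < n" for v using that le_square[of n] by (rule less_le_trans)
  then have "set_output n s = {v. v < n \<and> snd (sem n c (input_store n E)) Input v = 1}"
    using representsD(5)[OF s] by (auto simp: set_output_def)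
  ultimately show ?thesis using exec by blast
qed

section \<open>Program schemes\<close>

lemma sem_Loop: "sem n (Loop x c) \<sigma> = iterate x (sem n c) (Suc n) \<sigma>"
  by (simp add: iterate_def)

declare sem.simps(6) [simp del]

fun assigned :: "com \<Rightarrow> var set" where
  "assigned Noop = {}"
| "assigned (Assign x e) = {x}"
| "assigned (Write a e1 e2) = {}"
| "assigned (c1 ;; c2) = assigned c1 \<union> assigned c2"
| "assigned (Branch e c1 c2) = assigned c1 \<union> assigned c2"
| "assigned (Loop x c) = insert x (assigned c)"

fun written :: "com \<Rightarrow> arr set" where
  "written Noop = {}"
| "written (Assign x e) = {}"
| "written (Write a e1 e2) = {a}"
| "written (c1 ;; c2) = written c1 \<union> written c2"
| "written (Branch e c1 c2) = written c1 \<union> written c2"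
| "written (Loop x c) = written c"

lemma Loop_rule:
  assumes "Inv 0 \<sigma>" "\<And>i \<sigma>. i \<le> n \<Longrightarrow> Inv i \<sigma> \<Longrightarrow> Inv (Suc i) (sem n c (set_var x i \<sigma>))"
  shows "Inv (Suc n) (sem n (Loop x c) \<sigma>)"
proof -
  have "Inv i (iterate x (sem n c) i \<sigma>)" if "i \<le> Suc n" for i
    using that by (induction i) (simp_all add: assms)
  then show ?thesis by (simp only: sem_Loop)
qed

lemma sem_unassigned: "x \<notin> assigned c \<Longrightarrow> fst (sem n c \<sigma>) x = fst \<sigma> x"
proof (induction c arbitrary: \<sigma>)
  case (Loop y c)
  show ?case
    by (rule Loop_rule[where Inv = "\<lambda>_ \<sigma>'. fst \<sigma>' x = fst \<sigma> x"]) (use Loop in auto)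
qed (auto simp: array_write_def)

lemma sem_unwritten: "a \<notin> written c \<Longrightarrow> snd (sem n c \<sigma>) a = snd \<sigma> a"
proof (induction c arbitrary: \<sigma>)
  case (Loop y c)
  show ?case
    by (rule Loop_rule[where Inv = "\<lambda>_ \<sigma>'. snd \<sigma>' a = snd \<sigma> a"]) (use Loop in auto)
qed (auto simp: array_write_def)

subsection \<open>Tests\<close>

definition holds :: "nat \<Rightarrow> store \<Rightarrow> expr \<Rightarrow> bool" where
  "holds n \<sigma> e \<longleftrightarrow> expr_val n \<sigma> e \<noteq> 0"

definition And :: "expr \<Rightarrow> expr \<Rightarrow> expr" where "And a b = Cond a b (Num 0)"
definition Or :: "expr \<Rightarrow> expr \<Rightarrow> expr" where "Or a b = Plus a b"
definition Neg :: "expr \<Rightarrow> expr" where "Neg a = Minus (Num 1) a"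
definition Less :: "expr \<Rightarrow> expr \<Rightarrow> expr" where "Less a b = Minus b a"
definition Equal :: "expr \<Rightarrow> expr \<Rightarrow> expr" where "Equal a b = Neg (Plus (Minus a b) (Minus b a))"
definition Exists :: "var \<Rightarrow> expr \<Rightarrow> expr" where "Exists x e = Total x e"
definition Count :: "var \<Rightarrow> expr \<Rightarrow> expr" where "Count x e = Total x (Cond e (Num 1) (Num 0))"
definition Some_of :: "expr list \<Rightarrow> expr" where "Some_of es = foldr Or es (Num 0)"
definition All_of :: "expr list \<Rightarrow> expr" where "All_of es = foldr And es (Num 1)"

abbreviation scratch_var :: var where "scratch_var \<equiv> Local 0"

definition Bound :: expr where "Bound = Total scratch_var (Num 1)"
definition Size :: expr where "Size = Minus Bound (Num 1)"

lemma holds_simps [simp]: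
  "holds n \<sigma> (And a b) \<longleftrightarrow> holds n \<sigma> a \<and> holds n \<sigma> b"
  "holds n \<sigma> (Or a b) \<longleftrightarrow> holds n \<sigma> a \<or> holds n \<sigma> b"
  "holds n \<sigma> (Neg a) \<longleftrightarrow> \<not> holds n \<sigma> a"
  "holds n \<sigma> (Less a b) \<longleftrightarrow> expr_val n \<sigma> a < expr_val n \<sigma> b"
  "holds n \<sigma> (Equal a b) \<longleftrightarrow> expr_val n \<sigma> a = expr_val n \<sigma> b"
  "holds n \<sigma> (Read r e) \<longleftrightarrow> 0 < snd \<sigma> r (expr_val n \<sigma> e)"
  "holds n \<sigma> (Num k) \<longleftrightarrow> k \<noteq> 0"
  by (auto simp: holds_def And_def Or_def Neg_def Less_def Equal_def)

lemma holds_Exists [simp]: "holds n \<sigma> (Exists x e) \<longleftrightarrow> (\<exists>i\<le>n. holds n (set_var x i \<sigma>) e)"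
  unfolding holds_def Exists_def expr_val.simps by (auto simp: less_Suc_eq_le simp del: sum.lessThan_Suc)

lemma holds_Some_of [simp]: "holds n \<sigma> (Some_of es) \<longleftrightarrow> (\<exists>e\<in>set es. holds n \<sigma> e)"
  unfolding Some_of_def by (induction es) auto

lemma holds_All_of [simp]: "holds n \<sigma> (All_of es) \<longleftrightarrow> (\<forall>e\<in>set es. holds n \<sigma> e)"
  unfolding All_of_def by (induction es) auto

lemma expr_val_Count [simp]: "expr_val n \<sigma> (Count x e) = card {i. i \<le> n \<and> holds n (set_var x i \<sigma>) e}"
proof -
  have "expr_val n \<sigma> (Count x e) = (\<Sum>i\<in>{..<Suc n}. if holds n (set_var x i \<sigma>) e then 1 else 0)"
    unfolding Count_def expr_val.simps holds_def by (rule sum.cong) auto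
  also have "\<dots> = card {i \<in> {..<Suc n}. holds n (set_var x i \<sigma>) e}"
    by (subst sum.If_cases) (auto simp: Int_def)
  finally show ?thesis by (simp add: less_Suc_eq_le)
qed

lemma expr_val_Bound [simp]: "expr_val n \<sigma> Bound = Suc n"
  by (simp add: Bound_def)

lemma expr_val_Size [simp]: "expr_val n \<sigma> Size = n"
  by (simp add: Size_def)

subsection \<open>Stored sets\<close>

abbreviation set_arr :: "arr \<Rightarrow> (nat \<Rightarrow> nat) \<Rightarrow> store \<Rightarrow> store" where
  "set_arr a f \<sigma> \<equiv> (fst \<sigma>, (snd \<sigma>)(a := f))"

definition stored :: "nat \<Rightarrow> store \<Rightarrow> arr \<Rightarrow> nat set" where
  "stored n \<sigma> a = {i. i \<le> n \<and> 0 < snd \<sigma> a i}"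

definition Fill :: "var \<Rightarrow> arr \<Rightarrow> expr \<Rightarrow> com" where
  "Fill x a e = Loop x (Write a (Var x) e)"

lemma stored_le: "stored n \<sigma> a \<subseteq> {..n}"
  by (auto simp: stored_def)

lemma read_iff_stored: "i \<le> n \<Longrightarrow> 0 < snd \<sigma> a i \<longleftrightarrow> i \<in> stored n \<sigma> a"
  by (simp add: stored_def)

lemma stored_cong: "snd \<sigma> a = snd \<sigma>' a \<Longrightarrow> stored n \<sigma> a = stored n \<sigma>' a"
  by (simp add: stored_def)

lemma stored_unwritten: "a \<notin> written c \<Longrightarrow> stored n (sem n c \<sigma>) a = stored n \<sigma> a"
  by (rule stored_cong) (rule sem_unwritten)

lemma assigned_Fill [simp]: "assigned (Fill x a e) = {x}"
  and written_Fill [simp]: "written (Fill x a e) = {a}"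
  by (auto simp: Fill_def)

text \<open>The entries of \<open>a\<close> are replaced one after the other, so that \<open>e\<close> sees the new values of the
  entries before the current one.\<close>

lemma sem_Fill:
  fixes n x a e \<sigma>
  assumes a: "a \<noteq> Input"
  defines "\<sigma>' \<equiv> sem n (Fill x a e) \<sigma>"
  shows "i \<le> n \<Longrightarrow> snd \<sigma>' a i =
      expr_val n (set_var x i (set_arr a (\<lambda>j. if j < i then snd \<sigma>' a j else snd \<sigma> a j) \<sigma>)) e"
    and "n < i \<Longrightarrow> snd \<sigma>' a i = snd \<sigma> a i"
proof -
  define mixed where "mixed f i = set_var x i (set_arr a (\<lambda>j. if j < i then f j else snd \<sigma> a j) \<sigma>)" for f i
  define Inv where "Inv k \<tau> \<longleftrightarrow> (\<forall>y. y \<noteq> x \<longrightarrow> fst \<tau> y = fst \<sigma> y) \<and> (\<forall>b. b \<noteq> a \<longrightarrow> snd \<tau> b = snd \<sigma> b) \<and>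
    (\<forall>i<k. snd \<tau> a i = expr_val n (mixed (snd \<tau> a) i) e) \<and> (\<forall>i\<ge>k. snd \<tau> a i = snd \<sigma> a i)" for k \<tau>
  have "Inv (Suc n) \<sigma>'"
    unfolding \<sigma>'_def Fill_def
  proof (rule Loop_rule)
    show "Inv 0 \<sigma>" by (simp add: Inv_def)
    fix k \<tau> assume inv: "Inv k \<tau>"
    have \<tau>: "set_var x k \<tau> = mixed (snd \<tau> a) k"
      using inv by (auto simp: Inv_def mixed_def fun_eq_iff not_less)
    define v where "v = expr_val n (mixed (snd \<tau> a) k) e"
    have old: "mixed ((snd \<tau> a)(k := v)) i = mixed (snd \<tau> a) i" if "i \<le> k" for i
      using that by (auto simp: mixed_def fun_eq_iff)
    have "sem n (Write a (Var x) e) (set_var x k \<tau>) = set_arr a ((snd \<tau> a)(k := v)) (set_var x k \<tau>)"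
      using a by (simp add: v_def \<tau>[symmetric] array_write_def)
    then show "Inv (Suc k) (sem n (Write a (Var x) e) (set_var x k \<tau>))"
      using inv old by (auto simp: Inv_def less_Suc_eq v_def)
  qed
  then show "i \<le> n \<Longrightarrow> snd \<sigma>' a i =
      expr_val n (set_var x i (set_arr a (\<lambda>j. if j < i then snd \<sigma>' a j else snd \<sigma> a j) \<sigma>)) e"
    "n < i \<Longrightarrow> snd \<sigma>' a i = snd \<sigma> a i"
    by (auto simp: Inv_def mixed_def less_Suc_eq_le)
qed

lemma in_stored_Fill:
  fixes n x a e \<sigma>
  assumes "a \<noteq> Input" "i \<le> n"
  defines "\<sigma>' \<equiv> sem n (Fill x a e) \<sigma>"
  shows "i \<in> stored n \<sigma>' a \<longleftrightarrow>
    holds n (set_var x i (set_arr a (\<lambda>j. if j < i then snd \<sigma>' a j else snd \<sigma> a j) \<sigma>)) e"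
  unfolding stored_def holds_def \<sigma>'_def using sem_Fill(1)[OF assms(1,2), of x e \<sigma>] assms(2) by simp

lemma stored_Fill:
  assumes "a \<noteq> Input" "\<And>i f. i \<le> n \<Longrightarrow> holds n (set_var x i (set_arr a f \<sigma>)) e \<longleftrightarrow> P i"
  shows "stored n (sem n (Fill x a e) \<sigma>) a = {i. i \<le> n \<and> P i}"
proof -
  have "i \<in> stored n (sem n (Fill x a e) \<sigma>) a \<longleftrightarrow> P i" if "i \<le> n" for i
    unfolding in_stored_Fill[OF assms(1) that] using assms(2)[OF that] by simp
  then show ?thesis using stored_le by blast
qed

subsection \<open>Nested loops\<close>

fun nest :: "(nat \<Rightarrow> var) \<Rightarrow> nat \<Rightarrow> com \<Rightarrow> com" where
  "nest f 0 c = c"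
| "nest f (Suc K) c = Loop (f 0) (nest (\<lambda>i. f (Suc i)) K c)"

fun tuples :: "nat \<Rightarrow> nat \<Rightarrow> nat list list" where
  "tuples n 0 = [[]]"
| "tuples n (Suc K) = concat (map (\<lambda>i. map (Cons i) (tuples n K)) [0..<Suc n])"

fun set_vars :: "(nat \<Rightarrow> var) \<Rightarrow> nat list \<Rightarrow> store \<Rightarrow> store" where
  "set_vars f [] \<sigma> = \<sigma>"
| "set_vars f (i # g) \<sigma> = set_vars (\<lambda>i. f (Suc i)) g (set_var (f 0) i \<sigma>)"

lemma set_tuples: "set (tuples n K) = {g. length g = K \<and> set g \<subseteq> {..n}}"
proof (induction K)
  case (Suc K)
  have "g \<in> set (tuples n (Suc K)) \<longleftrightarrow> length g = Suc K \<and> set g \<subseteq> {..n}" for g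
    using Suc.IH by (cases g) (auto simp: less_Suc_eq_le simp del: upt_Suc)
  then show ?case by blast
qed auto

lemma length_tuples: "length (tuples n K) = Suc n ^ K"
  by (induction K) (simp_all add: length_concat comp_def sum_list_triv del: upt_Suc)

lemma assigned_nest: "assigned (nest f K c) = f ` {..<K} \<union> assigned c"
proof (induction K arbitrary: f)
  case (Suc K)
  have "{..<Suc K} = insert 0 (Suc ` {..<K})" by (auto simp: image_iff less_Suc_eq_0_disj)
  then show ?case by (simp add: Suc image_image)
qed simp

lemma written_nest [simp]: "written (nest f K c) = written c"
  by (induction K arbitrary: f) auto

lemma com_exponent_nest: "com_exponent (nest f K c) = com_exponent c + 11 * K"
  by (induction K arbitrary: f) auto

lemma snd_set_vars [simp]: "snd (set_vars f g \<sigma>) = snd \<sigma>"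
  by (induction g arbitrary: f \<sigma>) auto

lemma set_vars_other: "x \<notin> f ` {..<length g} \<Longrightarrow> fst (set_vars f g \<sigma>) x = fst \<sigma> x"
proof (induction g arbitrary: f \<sigma>)
  case (Cons i g)
  then have "x \<notin> (\<lambda>i. f (Suc i)) ` {..<length g}" "x \<noteq> f 0" by auto
  then show ?case using Cons.IH[of "\<lambda>i. f (Suc i)"] by simp
qed simp

lemma set_vars_nth:
  "inj_on f {..<length g} \<Longrightarrow> i < length g \<Longrightarrow> fst (set_vars f g \<sigma>) (f i) = g ! i"
proof (induction g arbitrary: f i \<sigma>)
  case (Cons j g)
  have inj: "inj_on (\<lambda>i. f (Suc i)) {..<length g}" "f 0 \<notin> (\<lambda>i. f (Suc i)) ` {..<length g}"
    using Cons.prems(1) by (auto simp: inj_on_def)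
  show ?case
    using Cons.IH[OF inj(1)] Cons.prems(2) set_vars_other[OF inj(2)] by (cases i) auto
qed simp

lemma foldl_invariant:
  assumes "Inv [] \<sigma>"
    and "\<And>pre g post \<sigma>. gs = pre @ g # post \<Longrightarrow> Inv pre \<sigma> \<Longrightarrow> Inv (pre @ [g]) (F \<sigma> g)"
  shows "Inv gs (foldl F \<sigma> gs)"
  using assms(2)
proof (induction gs rule: rev_induct)
  case (snoc g gs)
  have "Inv gs (foldl F \<sigma> gs)" by (rule snoc.IH) (use snoc.prems in auto)
  then show ?case using snoc.prems[of gs g "[]"] by simp
qed (use assms(1) in simp)

lemma foldl_set_var:
  assumes "\<And>\<sigma> g. g \<in> set gs \<Longrightarrow> fst (F \<sigma> g) x = fst \<sigma> x" "gs \<noteq> []"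
  shows "foldl F (set_var x i \<sigma>) gs = foldl (\<lambda>\<sigma> g. F (set_var x i \<sigma>) g) \<sigma> gs"
  using assms
proof (induction gs arbitrary: \<sigma>)
  case (Cons g gs)
  define \<tau> where "\<tau> = F (set_var x i \<sigma>) g"
  have "fst \<tau> x = i" using Cons.prems(1)[of g "set_var x i \<sigma>"] by (simp add: \<tau>_def)
  then have unchanged: "set_var x i \<tau> = \<tau>" by (metis fun_upd_triv prod.collapse)
  show ?case
  proof (cases "gs = []")
    case False
    have "foldl F (set_var x i \<tau>) gs = foldl (\<lambda>\<sigma> g. F (set_var x i \<sigma>) g) \<tau> gs"
      by (rule Cons.IH[OF Cons.prems(1) False]) simp
    then show ?thesis unfolding unchanged unfolding foldl_Cons \<tau>_def .
  qed simp
qed simp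

lemma sem_nest:
  assumes "inj_on f {..<K}" "f ` {..<K} \<inter> assigned c = {}"
  shows "sem n (nest f K c) \<sigma> = foldl (\<lambda>\<sigma> g. sem n c (set_vars f g \<sigma>)) \<sigma> (tuples n K)"
  using assms
proof (induction K arbitrary: f \<sigma>)
  case (Suc K)
  let ?f = "\<lambda>i. f (Suc i)"
  let ?F = "\<lambda>\<sigma> g. sem n c (set_vars ?f g \<sigma>)"
  have inj: "inj_on ?f {..<K}" "?f ` {..<K} \<inter> assigned c = {}" "f 0 \<notin> ?f ` {..<K}" "f 0 \<notin> assigned c"
    using Suc.prems by (auto simp: inj_on_def)
  have "fst (?F \<sigma> g) (f 0) = fst \<sigma> (f 0)" if "g \<in> set (tuples n K)" for \<sigma> g
    using that inj(3,4) by (simp add: sem_unassigned set_vars_other set_tuples)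
  moreover have "tuples n K \<noteq> []" using length_tuples[of n K] by auto
  ultimately have "foldl ?F (set_var (f 0) i \<sigma>) (tuples n K) =
      foldl (\<lambda>\<sigma> g. sem n c (set_vars f (i # g) \<sigma>)) \<sigma> (tuples n K)" for i \<sigma>
    using foldl_set_var[of "tuples n K" ?F "f 0" \<sigma> i] by simp
  then have "sem n (nest ?f K c) (set_var (f 0) i \<sigma>) =
      foldl (\<lambda>\<sigma> g. sem n c (set_vars f g \<sigma>)) \<sigma> (map (Cons i) (tuples n K))" for i \<sigma>
    using Suc.IH[OF inj(1,2)] by (simp add: foldl_map)
  moreover have "foldl (\<lambda>\<sigma> i. foldl F \<sigma> (h i)) \<sigma> is = foldl F \<sigma> (concat (map h is))"
    for F and h :: "nat \<Rightarrow> nat list list" and \<sigma> :: store and "is"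
    by (induction "is" arbitrary: \<sigma>) simp_all
  ultimately show ?case by (simp add: sem.simps(6) del: upt_Suc)
qed simp

section \<open>The reduction to minimum degree two\<close>

text \<open>
  Arrays hold vertex sets, the value \<open>n\<close> standing for no vertex: \<open>Core\<close> and \<open>Greedy\<close> are the vertices
  that survive the reduction and those chosen by it; \<open>Sep_Bag\<close> and \<open>Bag\<close> are the sets \<open>bag X\<close> and
  \<open>bag (insert p X)\<close> of one step of the dynamic program, and \<open>Table\<close> is the list of all sets found so far.
  The variable \<open>Digit 0\<close> only counts rounds, the other digits form a code: \<open>p\<close>, \<open>c\<close>, the \<open>q\<close> members
  of \<open>X\<close>, and then the first and the second components of the \<open>s\<close> pairs.
\<close>

abbreviation vertex_var :: var where "vertex_var \<equiv> Local 2"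
abbreviation other_var :: var where "other_var \<equiv> Local 3"
abbreviation witness_var :: var where "witness_var \<equiv> Local 4"
abbreviation round_var :: var where "round_var \<equiv> Local 5"
abbreviation seed_var :: var where "seed_var \<equiv> Local 6"
abbreviation offset_var :: var where "offset_var \<equiv> Local 7"
abbreviation end_var :: var where "end_var \<equiv> Local 8"

abbreviation Member :: "arr \<Rightarrow> var \<Rightarrow> expr" where
  "Member a x \<equiv> Read a (Var x)"

text \<open>There is no multiplication: \<open>Minus (Total scratch_var (Var x)) (Var x)\<close> is \<open>n\<close> times \<open>x\<close>.\<close>

definition Adjacent :: "var \<Rightarrow> var \<Rightarrow> expr" where
  "Adjacent x y = And (Less (Var y) Size)
     (Read Input (Plus (Minus (Total scratch_var (Var x)) (Var x)) (Var y)))"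

definition Core_adjacent :: "var \<Rightarrow> var \<Rightarrow> expr" where
  "Core_adjacent x y = And (Member Core x) (And (Member Core y) (Adjacent x y))"

definition reduce_step :: com where
  "reduce_step =
     Branch (And (Member Core vertex_var) (Less (Count other_var (Core_adjacent vertex_var other_var)) (Num 2)))
       (Write Greedy (Var vertex_var) (Num 1) ;;
        Fill other_var Core (And (Member Core other_var)
          (And (Neg (Equal (Var other_var) (Var vertex_var))) (Neg (Adjacent vertex_var other_var)))))
       Noop"

definition reduce_com :: com where
  "reduce_com = Fill vertex_var Core (Less (Var vertex_var) Size) ;;
     Loop round_var (Loop vertex_var reduce_step)"

locale input_graph = sgraph "({..<n}, E)" for n :: nat and E :: "nat set set"
begin

lemma adj_less: "adj x y \<Longrightarrow> x < n" "adj x y \<Longrightarrow> y < n"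
  using adjD by force+

lemma holds_Adjacent [simp]:
  assumes input: "snd \<sigma> Input = snd (graph_input n E)" and "x \<noteq> scratch_var" "y \<noteq> scratch_var"
  shows "holds n \<sigma> (Adjacent x y) \<longleftrightarrow> adj (fst \<sigma> x) (fst \<sigma> y)"
proof -
  have index: "expr_val n \<sigma> (Plus (Minus (Total scratch_var (Var x)) (Var x)) (Var y)) = fst \<sigma> x * n + fst \<sigma> y"
    using assms(2) by (simp add: mult.commute)
  have "0 < snd \<sigma> Input (fst \<sigma> x * n + fst \<sigma> y) \<longleftrightarrow> adj (fst \<sigma> x) (fst \<sigma> y)" if y: "fst \<sigma> y < n"
  proof -
    have "fst \<sigma> x * n + fst \<sigma> y < n * n" if "fst \<sigma> x < n"
    proof -
      have "fst \<sigma> x * n + fst \<sigma> y < Suc (fst \<sigma> x) * n" using y by simp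
      also have "\<dots> \<le> n * n" using that by (intro mult_le_mono1) simp
      finally show ?thesis .
    qed
    then show ?thesis
      using y adj_less(1)[of "fst \<sigma> x" "fst \<sigma> y"] by (auto simp: input graph_input_def adj_def)
  qed
  then have "holds n \<sigma> (Adjacent x y) \<longleftrightarrow> fst \<sigma> y < n \<and> adj (fst \<sigma> x) (fst \<sigma> y)"
    unfolding Adjacent_def holds_simps index expr_val_Size by (simp only: expr_val.simps) blast
  then show ?thesis using adj_less(2) by blast
qed

definition loaded :: "nat set \<Rightarrow> store \<Rightarrow> bool" where
  "loaded A \<sigma> \<longleftrightarrow> snd \<sigma> Input = snd (graph_input n E) \<and> (\<forall>i. 0 < snd \<sigma> Core i \<longleftrightarrow> i \<in> A)"

definition reduction_state :: "nat set \<Rightarrow> nat set \<Rightarrow> store \<Rightarrow> bool" where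
  "reduction_state A S \<sigma> \<longleftrightarrow> loaded A \<sigma> \<and> (\<forall>i. 0 < snd \<sigma> Greedy i \<longleftrightarrow> i \<in> S) \<and> reduced A S"

definition stable :: "nat set \<Rightarrow> bool" where
  "stable A \<longleftrightarrow> (\<forall>v\<in>A. 2 \<le> card {w \<in> A. adj v w})"

lemma reduction_state_set_var [simp]: "reduction_state A S (set_var x i \<sigma>) \<longleftrightarrow> reduction_state A S \<sigma>"
  by (simp add: reduction_state_def loaded_def)

lemma reduced_le: "reduced A S \<Longrightarrow> A \<subseteq> {..<n}"
  by (simp add: reduced_def)

lemma reduce_step_test:
  assumes "loaded A \<sigma>" "A \<subseteq> {..<n}"
  shows "holds n \<sigma> (And (Member Core vertex_var)
      (Less (Count other_var (Core_adjacent vertex_var other_var)) (Num 2))) \<longleftrightarrow>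
    fst \<sigma> vertex_var \<in> A \<and> card {w \<in> A. adj (fst \<sigma> vertex_var) w} < 2"
proof -
  have "{w. w \<le> n \<and> fst \<sigma> vertex_var \<in> A \<and> w \<in> A \<and> adj (fst \<sigma> vertex_var) w} = {w \<in> A. adj (fst \<sigma> vertex_var) w}"
    if "fst \<sigma> vertex_var \<in> A"
    using that assms(2) by auto
  then show ?thesis using assms(1) by (auto simp: loaded_def Core_adjacent_def)
qed

lemma reduce_step_sem:
  assumes state: "reduction_state A S \<sigma>"
  defines "v \<equiv> fst \<sigma> vertex_var"
  shows "v \<in> A \<Longrightarrow> card {w \<in> A. adj v w} < 2 \<Longrightarrow>
      reduction_state (A - closed_nbhd {v}) (insert v S) (sem n reduce_step \<sigma>)"
    and "\<not> (v \<in> A \<and> card {w \<in> A. adj v w} < 2) \<Longrightarrow> sem n reduce_step \<sigma> = \<sigma>"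
proof -
  have loaded: "loaded A \<sigma>" and greedy: "\<And>i. 0 < snd \<sigma> Greedy i \<longleftrightarrow> i \<in> S" and red: "reduced A S"
    using state by (auto simp: reduction_state_def)
  note test = reduce_step_test[OF loaded reduced_le[OF red], folded v_def, unfolded holds_def]
  show "sem n reduce_step \<sigma> = \<sigma>" if "\<not> (v \<in> A \<and> card {w \<in> A. adj v w} < 2)"
    using that test unfolding reduce_step_def by auto
  show "reduction_state (A - closed_nbhd {v}) (insert v S) (sem n reduce_step \<sigma>)"
    if v: "v \<in> A" "card {w \<in> A. adj v w} < 2"
  proof -
    define \<sigma>1 where "\<sigma>1 = set_arr Greedy ((snd \<sigma> Greedy)(v := 1)) \<sigma>"
    define e where "e = And (Member Core other_var)
      (And (Neg (Equal (Var other_var) (Var vertex_var))) (Neg (Adjacent vertex_var other_var)))"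
    define \<sigma>2 where "\<sigma>2 = sem n (Fill other_var Core e) \<sigma>1"
    have sem: "sem n reduce_step \<sigma> = \<sigma>2"
      using v test unfolding reduce_step_def by (simp add: \<sigma>2_def \<sigma>1_def e_def array_write_def v_def)
    have core: "0 < snd \<sigma>2 Core i \<longleftrightarrow> i \<in> A - closed_nbhd {v}" for i
    proof (cases "i \<le> n")
      case True
      have "stored n \<sigma>2 Core = {i. i \<le> n \<and> i \<in> A \<and> i \<noteq> v \<and> \<not> adj v i}"
        unfolding \<sigma>2_def stored_def
        using in_stored_Fill[of Core _ n other_var e \<sigma>1] loaded
        by (auto simp: e_def \<sigma>1_def loaded_def v_def stored_def)
      then show ?thesis using True by (auto simp: read_iff_stored closed_nbhd_def)
    next
      case False
      then have "snd \<sigma>2 Core i = snd \<sigma>1 Core i" unfolding \<sigma>2_def by (intro sem_Fill(2)) auto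
      then show ?thesis using False loaded reduced_le[OF red] by (auto simp: \<sigma>1_def loaded_def)
    qed
    have "snd \<sigma>2 b = snd \<sigma>1 b" if "b \<noteq> Core" for b
      unfolding \<sigma>2_def by (rule sem_unwritten) (use that in simp)
    then have "reduction_state (A - closed_nbhd {v}) (insert v S) \<sigma>2"
      using core loaded greedy reduced_insert[OF red v(1)] v(2)
      by (auto simp: reduction_state_def loaded_def \<sigma>1_def)
    then show ?thesis by (simp only: sem)
  qed
qed

lemma reduce_round:
  assumes state: "reduction_state A0 S0 \<sigma>"
  shows "\<exists>A S. reduction_state A S (sem n (Loop vertex_var reduce_step) \<sigma>) \<and>
    (A = A0 \<and> stable A0 \<or> A \<subset> A0 \<and> \<not> stable A0)"
proof -
  have A0: "A0 \<subseteq> {..<n}" using state reduced_le unfolding reduction_state_def by blast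
  define Inv where "Inv j \<tau> \<longleftrightarrow> (\<exists>A S. reduction_state A S \<tau> \<and>
      (A = A0 \<and> (\<forall>v\<in>A0. v < j \<longrightarrow> 2 \<le> card {w \<in> A0. adj v w}) \<or> A \<subset> A0 \<and> \<not> stable A0))" for j \<tau>
  have "Inv (Suc n) (sem n (Loop vertex_var reduce_step) \<sigma>)"
  proof (rule Loop_rule)
    show "Inv 0 \<sigma>" using state by (auto simp: Inv_def)
    fix j \<tau> assume "Inv j \<tau>"
    then obtain A S where A: "reduction_state A S \<tau>"
      and cases: "A = A0 \<and> (\<forall>v\<in>A0. v < j \<longrightarrow> 2 \<le> card {w \<in> A0. adj v w}) \<or> A \<subset> A0 \<and> \<not> stable A0"
      unfolding Inv_def by blast
    have state': "reduction_state A S (set_var vertex_var j \<tau>)" using A by simp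
    note step = reduce_step_sem[OF state', simplified]
    show "Inv (Suc j) (sem n reduce_step (set_var vertex_var j \<tau>))"
    proof (cases "j \<in> A \<and> card {w \<in> A. adj j w} < 2")
      case True
      then have "A - closed_nbhd {j} \<subset> A0"
        using cases by (auto simp: closed_nbhd_def)
      moreover have "\<not> stable A0" using True cases by (auto simp: stable_def not_le)
      ultimately show ?thesis unfolding Inv_def using step(1) True by blast
    next
      case False
      then have "sem n reduce_step (set_var vertex_var j \<tau>) = set_var vertex_var j \<tau>" using step(2) by blast
      moreover have "A = A0 \<and> (\<forall>v\<in>A0. v < Suc j \<longrightarrow> 2 \<le> card {w \<in> A0. adj v w}) \<or> A \<subset> A0 \<and> \<not> stable A0"
        using cases False by (auto simp: less_Suc_eq)
      ultimately show ?thesis unfolding Inv_def using state' by auto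
    qed
  qed
  moreover have "stable A0" if "\<forall>v\<in>A0. v < Suc n \<longrightarrow> 2 \<le> card {w \<in> A0. adj v w}"
    using that A0 by (auto simp: stable_def)
  ultimately show ?thesis unfolding Inv_def by blast
qed

lemma reduce_com_sem: "\<exists>A S. reduction_state A S (sem n reduce_com (input_store n E)) \<and> stable A"
proof -
  define \<sigma> where "\<sigma> = sem n (Fill vertex_var Core (Less (Var vertex_var) Size)) (input_store n E)"
  have "snd \<sigma> b = snd (input_store n E) b" if "b \<noteq> Core" for b
    unfolding \<sigma>_def by (rule sem_unwritten) (use that in simp)
  moreover have "0 < snd \<sigma> Core i \<longleftrightarrow> i \<in> {..<n}" for i
  proof (cases "i \<le> n")
    case True
    have "stored n \<sigma> Core = {i. i \<le> n \<and> i < n}" unfolding \<sigma>_def by (rule stored_Fill) auto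
    then show ?thesis using True by (simp add: read_iff_stored)
  next
    case False
    then have "snd \<sigma> Core i = snd (input_store n E) Core i" unfolding \<sigma>_def by (intro sem_Fill(2)) auto
    then show ?thesis using False by (simp add: input_store_def)
  qed
  ultimately have start: "reduction_state {..<n} {} \<sigma>"
    using reduced_V by (simp add: reduction_state_def loaded_def input_store_def)
  define Inv where "Inv k \<tau> \<longleftrightarrow> (\<exists>A S. reduction_state A S \<tau> \<and> (stable A \<or> card A + k \<le> n))" for k \<tau>
  have "Inv (Suc n) (sem n (Loop round_var (Loop vertex_var reduce_step)) \<sigma>)"
  proof (rule Loop_rule)
    show "Inv 0 \<sigma>" unfolding Inv_def using start by (intro exI[of _ "{..<n}"] exI[of _ "{}"]) auto
    fix k \<tau> assume "Inv k \<tau>"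
    then obtain A S where A: "reduction_state A S \<tau>" "stable A \<or> card A + k \<le> n" by (auto simp: Inv_def)
    then obtain A' S' where A': "reduction_state A' S' (sem n (Loop vertex_var reduce_step) (set_var round_var k \<tau>))"
        "A' = A \<and> stable A \<or> A' \<subset> A \<and> \<not> stable A"
      using reduce_round[of A S "set_var round_var k \<tau>"] by auto
    have "finite A" using A(1) reduced_le finite_subset[OF _ finite_lessThan] unfolding reduction_state_def by blast
    then have "A' = A \<and> stable A \<or> card A' < card A \<and> \<not> stable A" using A'(2) psubset_card_mono by blast
    then have "stable A' \<or> card A' + Suc k \<le> n" using A(2) by auto
    with A'(1) show "Inv (Suc k) (sem n (Loop vertex_var reduce_step) (set_var round_var k \<tau>))"
      unfolding Inv_def by blast
  qed
  then show ?thesis unfolding Inv_def reduce_com_def by (auto simp: \<sigma>_def)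
qed

end

section \<open>The dynamic program\<close>

definition Outside :: "arr \<Rightarrow> expr" where
  "Outside a = And (Member Core vertex_var) (Neg (Member a vertex_var))"

definition Apart :: "expr \<Rightarrow> expr" where
  "Apart e = Neg (Exists witness_var (And e (Core_adjacent witness_var vertex_var)))"

definition Near :: "var \<Rightarrow> expr" where
  "Near x = Or (Equal (Var x) (Var vertex_var)) (Core_adjacent x vertex_var)"

definition Keeps :: "var \<Rightarrow> var \<Rightarrow> expr" where
  "Keeps x y = Or (And (Member Bag y) (Neg (Less (Var vertex_var) (Var y))))
     (And (Neg (Core_adjacent x vertex_var)) (Neg (Core_adjacent y vertex_var)))"

definition sweep_com :: "arr \<Rightarrow> com" where
  "sweep_com a = Fill vertex_var Reached
     (Or (Member Reached vertex_var) (And (Outside a) (Neg (Apart (Member Reached witness_var)))))"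

definition reach_com :: "expr \<Rightarrow> arr \<Rightarrow> com" where
  "reach_com e a = Fill vertex_var Reached e ;; Loop round_var (sweep_com a)"

definition bag_com :: "nat \<Rightarrow> com" where
  "bag_com q =
     Fill vertex_var Sep_Bag
       (And (Member Core vertex_var) (Some_of (map (\<lambda>i. Near (Digit (3 + i))) [0..<q]))) ;;
     Fill vertex_var Bag
       (And (Member Core vertex_var) (Or (Member Sep_Bag vertex_var) (Near (Digit 1))))"

definition trace_com :: "nat \<Rightarrow> nat \<Rightarrow> com" where
  "trace_com q s = Fill vertex_var Trace
     (And (Member Bag vertex_var)
     (And (All_of (map (\<lambda>i. Keeps (Digit (3 + q + i)) (Digit (3 + q + s + i))) [0..<s]))
       (Apart (And (Less (Var witness_var) (Var vertex_var)) (Member Trace witness_var)))))"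

definition Seed :: expr where
  "Seed = And (Outside Sep_Bag)
     (Or (Equal (Var (Digit 2)) (Var vertex_var)) (Neg (Less (Var (Digit 2)) Size)))"

definition region_com :: com where
  "region_com = reach_com Seed Sep_Bag ;;
     Fill vertex_var Region (And (Member Reached vertex_var)
       (Apart (And (Member Trace witness_var) (Member Sep_Bag witness_var))))"

definition Entry :: expr where
  "Entry = Read Table (Plus (Var offset_var) (Var vertex_var))"

definition Improves :: expr where
  "Improves = And (Neg (Exists vertex_var (And Entry (Neg (Member Target vertex_var)))))
     (Less (Count vertex_var (Member Best vertex_var)) (Count vertex_var Entry))"

definition best_step :: com where
  "best_step = Branch Improves (Fill vertex_var Best Entry) Noop ;;
     Assign offset_var (Plus (Var offset_var) Bound)"

definition best_com :: "nat \<Rightarrow> com" where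
  "best_com K = Assign offset_var (Num 0) ;; Fill vertex_var Best (Num 0) ;;
     nest (\<lambda>i. Local (10 + i)) K best_step"

definition part_com :: "nat \<Rightarrow> com" where
  "part_com K = reach_com (Equal (Var vertex_var) (Var seed_var)) Bag ;;
     Fill vertex_var Target (And (Member Reached vertex_var) (Apart (Member Trace witness_var))) ;;
     best_com K ;;
     Fill vertex_var Assembled (Or (Member Assembled vertex_var) (Member Best vertex_var))"

definition collect_step :: "nat \<Rightarrow> com" where
  "collect_step K = Branch (And (Member Region seed_var) (Neg (Member Bag seed_var))) (part_com K) Noop"

definition collect_com :: "nat \<Rightarrow> com" where
  "collect_com K = Fill vertex_var Assembled (And (Member Trace vertex_var) (Member Region vertex_var)) ;;
     Loop seed_var (collect_step K)"

definition append_com :: com where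
  "append_com =
     Loop vertex_var (Write Table (Plus (Var end_var) (Var vertex_var)) (Member Assembled vertex_var)) ;;
     Assign end_var (Plus (Var end_var) Bound)"

definition assemble_com :: "nat \<Rightarrow> nat \<Rightarrow> nat \<Rightarrow> com" where
  "assemble_com q s K = bag_com q ;; trace_com q s ;; region_com ;; collect_com K"

definition step_com :: "nat \<Rightarrow> nat \<Rightarrow> nat \<Rightarrow> com" where
  "step_com q s K = assemble_com q s K ;; append_com"

definition finish_com :: "nat \<Rightarrow> com" where
  "finish_com K = Fill vertex_var Target (Member Core vertex_var) ;; best_com K ;;
     Loop vertex_var (Write Input (Var vertex_var)
       (Cond (Or (Member Greedy vertex_var) (Member Best vertex_var)) (Num 1) (Num 0)))"

definition code_length :: "nat \<Rightarrow> nat" where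
  "code_length t = 3 + separator_size t + 2 * trace_size t"

definition algorithm :: "nat \<Rightarrow> com" where
  "algorithm t = reduce_com ;;
     nest Digit (code_length t) (step_com (separator_size t) (trace_size t) (code_length t)) ;;
     finish_com (code_length t)"

lemma written_simps [simp]:
  "written (sweep_com a) = {Reached}" "written (reach_com e a) = {Reached}"
  "written (bag_com q) = {Sep_Bag, Bag}" "written (trace_com q s) = {Trace}"
  "written region_com = {Reached, Region}" "written best_step = {Best}" "written (best_com K) = {Best}"
  "written (part_com K) = {Reached, Target, Best, Assembled}"
  "written (collect_step K) = {Reached, Target, Best, Assembled}"
  "written (collect_com K) = {Reached, Target, Best, Assembled}" "written append_com = {Table}"
  "written (assemble_com q s K) = {Sep_Bag, Bag, Trace, Region, Reached, Target, Best, Assembled}"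
  by (auto simp: sweep_com_def reach_com_def bag_com_def trace_com_def region_com_def best_step_def
      best_com_def part_com_def collect_step_def collect_com_def append_com_def
      assemble_com_def)

lemma assigned_simps [simp]:
  "assigned (sweep_com a) = {vertex_var}" "assigned (reach_com e a) = {vertex_var, round_var}"
  "assigned (bag_com q) = {vertex_var}" "assigned (trace_com q s) = {vertex_var}"
  "assigned region_com = {vertex_var, round_var}" "assigned best_step = {vertex_var, offset_var}"
  "assigned (best_com K) = {vertex_var, offset_var} \<union> (\<lambda>i. Local (10 + i)) ` {..<K}"
  "assigned (collect_com K) =
     {vertex_var, round_var, seed_var, offset_var} \<union> (\<lambda>i. Local (10 + i)) ` {..<K}"
  "assigned append_com = {vertex_var, end_var}"
  "assigned (assemble_com q s K) = assigned (collect_com K)"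
  by (auto simp: sweep_com_def reach_com_def bag_com_def trace_com_def region_com_def best_step_def
      best_com_def part_com_def collect_step_def collect_com_def append_com_def assemble_com_def
      assigned_nest)

subsection \<open>Components\<close>

text \<open>A sweep through the vertices in increasing order sees the new members of \<open>R'\<close> below the current vertex.\<close>

lemma (in ordered_sgraph) sweep_step:
  assumes sweep: "\<And>i. i \<in> R' \<longleftrightarrow>
      i \<in> R \<or> i \<in> Z \<and> (\<exists>u. (u < i \<and> u \<in> R' \<or> i \<le> u \<and> u \<in> R) \<and> adj u i)"
    and R: "I \<subseteq> R" "R \<subseteq> (\<Union>c\<in>I. component Z c)"
  shows "R \<subseteq> R'" "R' \<subseteq> (\<Union>c\<in>I. component Z c)" "R \<subset> R' \<or> (\<Union>c\<in>I. component Z c) \<subseteq> R"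
proof -
  show "R \<subseteq> R'" using sweep by blast
  have "i \<in> (\<Union>c\<in>I. component Z c)" if "i \<in> R'" for i
    using that
  proof (induction i rule: less_induct)
    case (less i)
    show ?case
    proof (cases "i \<in> R")
      case False
      then obtain u where u: "i \<in> Z" "u < i \<and> u \<in> R' \<or> i \<le> u \<and> u \<in> R" "adj u i" using sweep less.prems by blast
      then obtain c where "c \<in> I" "u \<in> component Z c" using less.IH R(2) by blast
      then show ?thesis using component_closed u(1,3) by blast
    qed (use R(2) in blast)
  qed
  then show "R' \<subseteq> (\<Union>c\<in>I. component Z c)" by blast
  have "(\<Union>c\<in>I. component Z c) \<subseteq> R" if "R = R'"
  proof -
    have "y \<in> R" if "x \<in> R" "adj x y" "y \<in> Z" for x y
      using sweep[of y] that \<open>R = R'\<close> linorder_less_linear[of x y] by auto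
    then show ?thesis using component_subset_closed R(1) by blast
  qed
  then show "R \<subset> R' \<or> (\<Union>c\<in>I. component Z c) \<subseteq> R" using \<open>R \<subseteq> R'\<close> by blast
qed

lemma finite_stored: "finite (stored n \<sigma> a)"
  by (rule finite_subset[OF stored_le]) simp

locale core_graph = input_graph +
  fixes A :: "nat set"
  assumes A_subset: "A \<subseteq> {..<n}"
begin

sublocale core: ordered_sgraph "induced_subgraph ({..<n}, E) A"
  using A_subset by (intro ordered_sgraph.intro sgraph_induced_subgraph) simp

lemma loaded_sem:
  "loaded A \<sigma> \<Longrightarrow> Input \<notin> written c \<Longrightarrow> Core \<notin> written c \<Longrightarrow> loaded A (sem n c \<sigma>)"
  by (simp add: loaded_def sem_unwritten)

lemma loaded_updates [simp]:
  "loaded A (\<rho>, snd \<sigma>) \<longleftrightarrow> loaded A \<sigma>"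
  "a \<noteq> Input \<Longrightarrow> a \<noteq> Core \<Longrightarrow> loaded A (\<rho>, (snd \<sigma>)(a := f)) \<longleftrightarrow> loaded A \<sigma>"
  by (auto simp: loaded_def)

lemma read_Core [simp]: "loaded A \<sigma> \<Longrightarrow> 0 < snd \<sigma> Core i \<longleftrightarrow> i \<in> A"
  by (simp add: loaded_def)

lemma core_le: "i \<in> A \<Longrightarrow> i \<le> n"
  using A_subset by auto

lemma core_adj_le: "core.adj u v \<Longrightarrow> u \<le> n"
  using core.adjD(1)[of u v] core_le by simp

lemma holds_Core_adjacent [simp]:
  assumes "loaded A \<sigma>" "x \<noteq> scratch_var" "y \<noteq> scratch_var"
  shows "holds n \<sigma> (Core_adjacent x y) \<longleftrightarrow> core.adj (fst \<sigma> x) (fst \<sigma> y)"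
  using assms A_subset by (simp add: Core_adjacent_def adj_induced_subgraph loaded_def)

lemma holds_Apart:
  assumes "loaded A \<sigma>" "\<And>u. u \<le> n \<Longrightarrow> holds n (set_var witness_var u \<sigma>) e \<longleftrightarrow> u \<in> S"
  shows "holds n \<sigma> (Apart e) \<longleftrightarrow> fst \<sigma> vertex_var \<in> core.away S"
  using assms core_adj_le by (auto simp: Apart_def core.away_def)

lemma sweep_com_sem:
  assumes loaded: "loaded A \<sigma>" and a: "a \<noteq> Reached"
  defines "R \<equiv> stored n \<sigma> Reached" and "R' \<equiv> stored n (sem n (sweep_com a) \<sigma>) Reached"
  shows "i \<in> R' \<longleftrightarrow>
    i \<in> R \<or> i \<in> A - stored n \<sigma> a \<and> (\<exists>u. (u < i \<and> u \<in> R' \<or> i \<le> u \<and> u \<in> R) \<and> core.adj u i)"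
proof (cases "i \<le> n")
  case False
  then show ?thesis using core_le by (auto simp: R_def R'_def stored_def)
next
  case i: True
  define f where "f j = (if j < i then snd (sem n (sweep_com a) \<sigma>) Reached j else snd \<sigma> Reached j)" for j
  define S where "S = {u. u < i \<and> u \<in> R' \<or> i \<le> u \<and> u \<in> R}"
  have f: "0 < f u \<longleftrightarrow> u \<in> S" if "u \<le> n" for u
    using that by (auto simp: f_def S_def R_def R'_def stored_def)
  let ?\<sigma> = "set_var vertex_var i (set_arr Reached f \<sigma>)"
  have "i \<in> R' \<longleftrightarrow> holds n ?\<sigma>
      (Or (Member Reached vertex_var) (And (Outside a) (Neg (Apart (Member Reached witness_var)))))"
    unfolding R'_def sweep_com_def f_def by (rule in_stored_Fill) (use i in simp_all)
  also have "\<dots> \<longleftrightarrow> i \<in> S \<or> i \<in> A - stored n \<sigma> a \<and> i \<notin> core.away S"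
    using holds_Apart[of ?\<sigma> "Member Reached witness_var" S] loaded f a i
    by (simp add: Outside_def read_iff_stored[OF i, of \<sigma> a])
  finally show ?thesis by (auto simp: S_def core.away_def)
qed

lemma reach_com_sem:
  assumes loaded: "loaded A \<sigma>" and a: "a \<noteq> Reached" and I: "I \<subseteq> A - stored n \<sigma> a"
    and seed: "\<And>i f. i \<le> n \<Longrightarrow> holds n (set_var vertex_var i (set_arr Reached f \<sigma>)) e \<longleftrightarrow> i \<in> I"
  shows "stored n (sem n (reach_com e a) \<sigma>) Reached = (\<Union>c\<in>I. core.component (A - stored n \<sigma> a) c)"
proof -
  define Z where "Z = A - stored n \<sigma> a"
  define C where "C = (\<Union>c\<in>I. core.component Z c)"
  have "i \<in> core.component Z i" if "i \<in> I" for i by (rule core.component_self) (use I that Z_def in blast)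
  then have IC: "I \<subseteq> C" by (auto simp: C_def)
  have "C \<subseteq> Z" using core.component_subset by (auto simp: C_def)
  then have "C \<subseteq> {..<n}" using A_subset by (auto simp: Z_def)
  then have card_le: "card R \<le> n" if "R \<subseteq> C" for R using card_mono[OF finite_lessThan, of R n] that by simp
  define Inv where "Inv k \<tau> \<longleftrightarrow> loaded A \<tau> \<and> stored n \<tau> a = stored n \<sigma> a \<and>
    I \<subseteq> stored n \<tau> Reached \<and> stored n \<tau> Reached \<subseteq> C \<and>
    (C \<subseteq> stored n \<tau> Reached \<or> k \<le> card (stored n \<tau> Reached))" for k \<tau>
  have "Inv (Suc n) (sem n (Loop round_var (sweep_com a)) (sem n (Fill vertex_var Reached e) \<sigma>))"
  proof (rule Loop_rule)
    have "stored n (sem n (Fill vertex_var Reached e) \<sigma>) Reached = {i. i \<le> n \<and> i \<in> I}"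
      by (rule stored_Fill) (simp, rule seed)
    also have "\<dots> = I" using I core_le by auto
    finally show "Inv 0 (sem n (Fill vertex_var Reached e) \<sigma>)"
      using loaded a IC by (simp add: Inv_def loaded_sem stored_unwritten)
  next
    fix k \<tau> assume inv: "Inv k \<tau>"
    define \<tau>' where "\<tau>' = sem n (sweep_com a) (set_var round_var k \<tau>)"
    define R where "R = stored n \<tau> Reached"
    define R' where "R' = stored n \<tau>' Reached"
    have stored: "stored n (set_var round_var k \<tau>) b = stored n \<tau> b" for b by (rule stored_cong) simp
    have R: "I \<subseteq> R" "R \<subseteq> C" "C \<subseteq> R \<or> k \<le> card R" using inv by (auto simp: Inv_def R_def)
    have "i \<in> R' \<longleftrightarrow> i \<in> R \<or> i \<in> Z \<and> (\<exists>u. (u < i \<and> u \<in> R' \<or> i \<le> u \<and> u \<in> R) \<and> core.adj u i)" for i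
      using sweep_com_sem[of "set_var round_var k \<tau>" a i] inv a
      by (simp add: \<tau>'_def stored Inv_def Z_def R_def R'_def)
    note sweep = core.sweep_step[OF this R(1) R(2)[unfolded C_def], folded C_def]
    have "card R < card R'" if "R \<subset> R'"
      using that psubset_card_mono[OF finite_stored] by (simp add: R'_def)
    then have "C \<subseteq> R' \<or> Suc k \<le> card R'" using R(3) sweep(1,3) by (meson Suc_leI le_less_trans order_trans)
    then show "Inv (Suc k) (sem n (sweep_com a) (set_var round_var k \<tau>))"
      using inv a R(1) sweep(1,2) unfolding Inv_def R'_def \<tau>'_def
      by (simp add: loaded_sem stored_unwritten stored)
  qed
  then show ?thesis using card_le[of "stored n (sem n (reach_com e a) \<sigma>) Reached"]
    by (auto simp: Inv_def reach_com_def C_def Z_def)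
qed

end

subsection \<open>The largest listed set\<close>

definition slot :: "nat \<Rightarrow> store \<Rightarrow> nat \<Rightarrow> nat set" where
  "slot n \<sigma> j = {v. v \<le> n \<and> 0 < snd \<sigma> Table (j * Suc n + v)}"

definition slots :: "nat \<Rightarrow> store \<Rightarrow> nat \<Rightarrow> nat set list" where
  "slots n \<sigma> N = map (slot n \<sigma>) [0..<N]"

lemma slots_unwritten: "Table \<notin> written c \<Longrightarrow> slots n (sem n c \<sigma>) N = slots n \<sigma> N"
  by (simp add: slots_def slot_def sem_unwritten)

lemma slot_set_vars [simp]: "slot n (set_vars f g \<sigma>) = slot n \<sigma>"
  by (simp add: slot_def fun_eq_iff)

lemma stored_set_vars [simp]: "stored n (set_vars f g \<sigma>) a = stored n \<sigma> a"
  by (rule stored_cong) simp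

lemma holds_Improves:
  assumes "fst \<sigma> offset_var = j * Suc n"
  shows "holds n \<sigma> Improves \<longleftrightarrow>
    slot n \<sigma> j \<subseteq> stored n \<sigma> Target \<and> card (stored n \<sigma> Best) < card (slot n \<sigma> j)"
  using assms by (auto simp: Improves_def Entry_def slot_def stored_def)

lemma best_step_sem:
  assumes offset: "fst \<sigma> offset_var = j * Suc n"
  shows "stored n (sem n best_step \<sigma>) Best =
      (if slot n \<sigma> j \<subseteq> stored n \<sigma> Target \<and> card (stored n \<sigma> Best) < card (slot n \<sigma> j)
       then slot n \<sigma> j else stored n \<sigma> Best)"
    and "fst (sem n best_step \<sigma>) offset_var = Suc j * Suc n"
proof -
  have "stored n (sem n (Fill vertex_var Best Entry) \<sigma>) Best = {i. i \<le> n \<and> 0 < snd \<sigma> Table (j * Suc n + i)}"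
    by (rule stored_Fill) (use offset in \<open>simp_all add: Entry_def\<close>)
  also have "\<dots> = slot n \<sigma> j" by (simp add: slot_def)
  finally have fill: "stored n (sem n (Fill vertex_var Best Entry) \<sigma>) Best = slot n \<sigma> j" .
  have "stored n (sem n best_step \<sigma>) Best =
      stored n (if holds n \<sigma> Improves then sem n (Fill vertex_var Best Entry) \<sigma> else \<sigma>) Best"
    by (rule stored_cong) (simp add: best_step_def holds_def)
  then show "stored n (sem n best_step \<sigma>) Best =
      (if slot n \<sigma> j \<subseteq> stored n \<sigma> Target \<and> card (stored n \<sigma> Best) < card (slot n \<sigma> j)
       then slot n \<sigma> j else stored n \<sigma> Best)"
    unfolding holds_Improves[OF offset] by (simp add: fill)
  show "fst (sem n best_step \<sigma>) offset_var = Suc j * Suc n"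
    using offset by (simp add: best_step_def sem_unassigned)
qed

lemma best_com_sem:
  "stored n (sem n (best_com K) \<sigma>) Best = best (slots n \<sigma> (Suc n ^ K)) (stored n \<sigma> Target)"
proof -
  define \<sigma>0 where "\<sigma>0 = sem n (Assign offset_var (Num 0) ;; Fill vertex_var Best (Num 0)) \<sigma>"
  define F where "F \<tau> g = sem n best_step (set_vars (\<lambda>i. Local (10 + i)) g \<tau>)" for \<tau> g
  define Inv where "Inv pre \<tau> \<longleftrightarrow> fst \<tau> offset_var = length pre * Suc n \<and> snd \<tau> Table = snd \<sigma> Table \<and>
    stored n \<tau> Target = stored n \<sigma> Target \<and>
    stored n \<tau> Best = best (slots n \<sigma> (length pre)) (stored n \<sigma> Target)" for pre :: "nat list list" and \<tau>
  have "Inv (tuples n K) (foldl F \<sigma>0 (tuples n K))"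
  proof (rule foldl_invariant)
    have "stored n \<sigma>0 Best = {i. i \<le> n \<and> False}"
      unfolding \<sigma>0_def sem.simps(4) by (rule stored_Fill) auto
    moreover have "stored n \<sigma>0 Target = stored n \<sigma> Target" unfolding \<sigma>0_def by (rule stored_unwritten) simp
    ultimately show "Inv [] \<sigma>0" by (simp add: Inv_def \<sigma>0_def sem_unassigned sem_unwritten slots_def)
    fix pre g post \<tau> assume inv: "Inv pre \<tau>"
    define \<tau>' where "\<tau>' = set_vars (\<lambda>i. Local (10 + i)) g \<tau>"
    have \<tau>': "fst \<tau>' offset_var = length pre * Suc n" "slot n \<tau>' = slot n \<sigma>"
      "stored n \<tau>' Target = stored n \<sigma> Target"
      "stored n \<tau>' Best = best (slots n \<sigma> (length pre)) (stored n \<sigma> Target)"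
      using inv by (simp_all add: \<tau>'_def Inv_def set_vars_other image_iff slot_def fun_eq_iff)
    have "snd (F \<tau> g) Table = snd \<sigma> Table" "stored n (F \<tau> g) Target = stored n \<sigma> Target"
      using inv by (simp_all add: F_def Inv_def sem_unwritten stored_unwritten)
    then show "Inv (pre @ [g]) (F \<tau> g)"
      using best_step_sem[OF \<tau>'(1)] unfolding \<tau>'(2-4) F_def \<tau>'_def[symmetric] Inv_def
      by (simp add: slots_def best_snoc)
  qed
  moreover have "sem n (best_com K) \<sigma> = foldl F \<sigma>0 (tuples n K)"
  proof -
    have "sem n (nest (\<lambda>i. Local (10 + i)) K best_step) \<sigma>0 = foldl F \<sigma>0 (tuples n K)"
      unfolding F_def by (rule sem_nest) (auto simp: inj_on_def)
    then show ?thesis by (simp add: best_com_def \<sigma>0_def)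
  qed
  ultimately show ?thesis by (simp add: Inv_def length_tuples)
qed

subsection \<open>One step\<close>

context core_graph
begin

lemma bag_com_sem:
  fixes q
  assumes loaded: "loaded A \<sigma>"
  defines "X \<equiv> (\<lambda>i. fst \<sigma> (Digit (3 + i))) ` {0..<q}"
  shows "stored n (sem n (bag_com q) \<sigma>) Sep_Bag = core.bag X"
    and "stored n (sem n (bag_com q) \<sigma>) Bag = core.bag (insert (fst \<sigma> (Digit 1)) X)"
proof -
  define e where "e = And (Member Core vertex_var) (Some_of (map (\<lambda>i. Near (Digit (3 + i))) [0..<q]))"
  define e' where "e' = And (Member Core vertex_var) (Or (Member Sep_Bag vertex_var) (Near (Digit 1)))"
  define \<sigma>1 where "\<sigma>1 = sem n (Fill vertex_var Sep_Bag e) \<sigma>"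
  have sem: "sem n (bag_com q) \<sigma> = sem n (Fill vertex_var Bag e') \<sigma>1"
    by (simp add: bag_com_def \<sigma>1_def e_def e'_def)
  have "stored n \<sigma>1 Sep_Bag = {i. i \<le> n \<and> i \<in> A \<and> (\<exists>x\<in>X. x = i \<or> core.adj x i)}"
    unfolding \<sigma>1_def by (rule stored_Fill) (use loaded in \<open>auto simp: e_def Near_def X_def\<close>)
  also have "\<dots> = core.bag X" using core_le by (auto simp: core.bag_def core.closed_nbhd_def)
  finally have sep_bag: "stored n \<sigma>1 Sep_Bag = core.bag X" .
  have \<sigma>1: "loaded A \<sigma>1" "fst \<sigma>1 (Digit 1) = fst \<sigma> (Digit 1)"
    using loaded by (simp_all add: \<sigma>1_def loaded_sem sem_unassigned)
  have "stored n (sem n (Fill vertex_var Bag e') \<sigma>1) Bag = {i. i \<le> n \<and> i \<in> A \<and>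
      (i \<in> core.bag X \<or> fst \<sigma> (Digit 1) = i \<or> core.adj (fst \<sigma> (Digit 1)) i)}"
    by (rule stored_Fill) (use \<sigma>1 in \<open>auto simp: e'_def Near_def read_iff_stored[of _ n \<sigma>1 Sep_Bag] sep_bag\<close>)
  also have "\<dots> = core.bag (insert (fst \<sigma> (Digit 1)) X)"
    using core_le by (auto simp: core.bag_def core.closed_nbhd_def)
  finally show "stored n (sem n (bag_com q) \<sigma>) Bag = core.bag (insert (fst \<sigma> (Digit 1)) X)"
    by (simp only: sem)
  show "stored n (sem n (bag_com q) \<sigma>) Sep_Bag = core.bag X"
    unfolding sem using sep_bag by (simp add: stored_unwritten)
qed

lemma trace_com_sem:
  fixes q s
  assumes loaded: "loaded A \<sigma>" and le: "\<And>i. i < s \<Longrightarrow> fst \<sigma> (Digit (3 + q + s + i)) \<le> n"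
  defines "M \<equiv> map (\<lambda>i. (fst \<sigma> (Digit (3 + q + i)), fst \<sigma> (Digit (3 + q + s + i)))) [0..<s]"
  shows "stored n (sem n (trace_com q s) \<sigma>) Trace = core.trace (stored n \<sigma> Bag) M"
proof -
  define T where "T = stored n (sem n (trace_com q s) \<sigma>) Trace"
  define B where "B = stored n \<sigma> Bag"
  define later where "later = And (Less (Var witness_var) (Var vertex_var)) (Member Trace witness_var)"
  have "w \<in> T \<longleftrightarrow> w \<in> {w \<in> B. core.kept B M w} \<and> (\<forall>w'\<in>T. w' < w \<longrightarrow> \<not> core.adj w' w)" for w
  proof (cases "w \<le> n")
    case w: True
    define f where "f j = (if j < w then snd (sem n (trace_com q s) \<sigma>) Trace j else snd \<sigma> Trace j)" for j
    let ?\<sigma> = "set_var vertex_var w (set_arr Trace f \<sigma>)"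
    have keeps: "holds n ?\<sigma> (Keeps (Digit (3 + q + i)) (Digit (3 + q + s + i))) \<longleftrightarrow>
        (fst \<sigma> (Digit (3 + q + s + i)) \<in> B \<and> fst \<sigma> (Digit (3 + q + s + i)) \<le> w \<or>
         \<not> core.adj (fst \<sigma> (Digit (3 + q + i))) w \<and> \<not> core.adj (fst \<sigma> (Digit (3 + q + s + i))) w)" if "i < s" for i
      using loaded le[OF that] by (simp add: Keeps_def B_def read_iff_stored[of _ n \<sigma> Bag] not_less)
    have apart: "holds n ?\<sigma> (Apart later) \<longleftrightarrow> w \<in> core.away {u \<in> T. u < w}"
      using holds_Apart[of ?\<sigma> later "{u \<in> T. u < w}"] loaded
      by (auto simp: later_def f_def T_def stored_def)
    have "w \<in> T \<longleftrightarrow> holds n ?\<sigma> (And (Member Bag vertex_var)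
        (And (All_of (map (\<lambda>i. Keeps (Digit (3 + q + i)) (Digit (3 + q + s + i))) [0..<s])) (Apart later)))"
      unfolding T_def trace_com_def f_def later_def by (rule in_stored_Fill) (use w in simp_all)
    also have "\<dots> \<longleftrightarrow> w \<in> {w \<in> B. core.kept B M w} \<and> w \<in> core.away {u \<in> T. u < w}"
      using w keeps apart by (auto simp: B_def core.kept_def M_def stored_def not_less)
    finally show ?thesis by (auto simp: core.away_def)
  qed (use stored_le in \<open>auto simp: T_def B_def stored_def\<close>)
  then show ?thesis unfolding core.trace_def T_def B_def by (rule core.first_fit_eqI[symmetric])
qed

lemma UN_component_Int:
  "(\<Union>c\<in>{c \<in> Z. c = d \<or> P}. core.component Z c) = (if P then Z else core.component Z d)"
  using core.component_subset core.component_self by (auto simp: core.component_def)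

lemma region_com_sem:
  fixes \<sigma>
  assumes loaded: "loaded A \<sigma>" and sep_bag: "stored n \<sigma> Sep_Bag = core.bag X"
  defines "c \<equiv> (if fst \<sigma> (Digit 2) < n then Some (fst \<sigma> (Digit 2)) else None)"
  shows "stored n (sem n region_com \<sigma>) Region =
    core.region X c \<inter> core.away (stored n \<sigma> Trace \<inter> core.bag X)"
proof -
  define e where "e = And (Member Trace witness_var) (Member Sep_Bag witness_var)"
  define \<sigma>1 where "\<sigma>1 = sem n (reach_com Seed Sep_Bag) \<sigma>"
  define S where "S = stored n \<sigma> Trace \<inter> core.bag X"
  have "stored n \<sigma>1 Reached = (\<Union>d\<in>{d \<in> A - core.bag X. d = fst \<sigma> (Digit 2) \<or> \<not> fst \<sigma> (Digit 2) < n}.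
      core.component (A - core.bag X) d)"
    unfolding \<sigma>1_def sep_bag[symmetric]
    by (rule reach_com_sem[OF loaded])
      (use loaded in \<open>auto simp: Seed_def Outside_def read_iff_stored[of _ n \<sigma> Sep_Bag]\<close>)
  also have "\<dots> = core.region X c" unfolding UN_component_Int by (simp add: core.region_def c_def)
  finally have reached: "stored n \<sigma>1 Reached = core.region X c" .
  have \<sigma>1: "loaded A \<sigma>1" "stored n \<sigma>1 Trace = stored n \<sigma> Trace" "stored n \<sigma>1 Sep_Bag = core.bag X"
    using loaded sep_bag by (simp_all add: \<sigma>1_def loaded_sem stored_unwritten)
  have "stored n (sem n (Fill vertex_var Region (And (Member Reached vertex_var) (Apart e))) \<sigma>1) Region =
      {i. i \<le> n \<and> i \<in> core.region X c \<and> i \<in> core.away S}"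
  proof (rule stored_Fill)
    fix i f assume i: "i \<le> n"
    have "holds n (set_var vertex_var i (set_arr Region f \<sigma>1)) (Apart e) \<longleftrightarrow> i \<in> core.away S"
      using \<sigma>1 by (subst holds_Apart[where S = S]) (auto simp: e_def S_def read_iff_stored)
    then show "holds n (set_var vertex_var i (set_arr Region f \<sigma>1)) (And (Member Reached vertex_var) (Apart e)) \<longleftrightarrow>
        i \<in> core.region X c \<and> i \<in> core.away S"
      using i reached by (simp add: read_iff_stored)
  qed simp
  also have "\<dots> = core.region X c \<inter> core.away S" using core.region_subset[of X c] core_le by auto
  finally show ?thesis by (simp add: region_com_def \<sigma>1_def e_def S_def)
qed

lemma part_com_sem:
  assumes loaded: "loaded A \<sigma>" and seed: "fst \<sigma> seed_var \<in> A - stored n \<sigma> Bag"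
  shows "stored n (sem n (part_com K) \<sigma>) Assembled = stored n \<sigma> Assembled \<union>
    best (slots n \<sigma> (Suc n ^ K))
      (core.component (A - stored n \<sigma> Bag) (fst \<sigma> seed_var) \<inter> core.away (stored n \<sigma> Trace))"
proof -
  define D where "D = core.component (A - stored n \<sigma> Bag) (fst \<sigma> seed_var)"
  define S where "S = stored n \<sigma> Trace"
  define \<sigma>1 where "\<sigma>1 = sem n (reach_com (Equal (Var vertex_var) (Var seed_var)) Bag) \<sigma>"
  define \<sigma>2 where "\<sigma>2 = sem n (Fill vertex_var Target
    (And (Member Reached vertex_var) (Apart (Member Trace witness_var)))) \<sigma>1"
  define \<sigma>3 where "\<sigma>3 = sem n (best_com K) \<sigma>2"
  have "stored n \<sigma>1 Reached = (\<Union>c\<in>{fst \<sigma> seed_var}. core.component (A - stored n \<sigma> Bag) c)"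
    unfolding \<sigma>1_def by (rule reach_com_sem[OF loaded]) (use seed in auto)
  then have reached: "stored n \<sigma>1 Reached = D" by (simp add: D_def)
  have \<sigma>1: "loaded A \<sigma>1" "stored n \<sigma>1 Trace = S"
    using loaded by (simp_all add: \<sigma>1_def S_def loaded_sem stored_unwritten)
  have "stored n \<sigma>2 Target = {i. i \<le> n \<and> i \<in> D \<and> i \<in> core.away S}"
    unfolding \<sigma>2_def
  proof (rule stored_Fill)
    fix i f assume i: "i \<le> n"
    have "holds n (set_var vertex_var i (set_arr Target f \<sigma>1)) (Apart (Member Trace witness_var)) \<longleftrightarrow>
        i \<in> core.away S"
      using \<sigma>1 by (subst holds_Apart[where S = S]) (auto simp: read_iff_stored)
    then show "holds n (set_var vertex_var i (set_arr Target f \<sigma>1))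
        (And (Member Reached vertex_var) (Apart (Member Trace witness_var))) \<longleftrightarrow> i \<in> D \<and> i \<in> core.away S"
      using i reached by (simp add: read_iff_stored)
  qed simp
  also have "\<dots> = D \<inter> core.away S" using core.component_subset core_le by (fastforce simp: D_def)
  finally have "stored n \<sigma>3 Best = best (slots n \<sigma>2 (Suc n ^ K)) (D \<inter> core.away S)"
    by (simp add: \<sigma>3_def best_com_sem)
  moreover have "slots n \<sigma>2 (Suc n ^ K) = slots n \<sigma> (Suc n ^ K)" "stored n \<sigma>3 Assembled = stored n \<sigma> Assembled"
    by (simp_all add: \<sigma>1_def \<sigma>2_def \<sigma>3_def slots_unwritten stored_unwritten)
  moreover have "stored n (sem n (Fill vertex_var Assembled
      (Or (Member Assembled vertex_var) (Member Best vertex_var))) \<sigma>3) Assembled =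
      stored n \<sigma>3 Assembled \<union> stored n \<sigma>3 Best"
    using in_stored_Fill[of Assembled _ n vertex_var "Or (Member Assembled vertex_var) (Member Best vertex_var)" \<sigma>3]
      stored_le by (auto simp: stored_def)
  ultimately show ?thesis by (simp add: part_com_def \<sigma>1_def \<sigma>2_def \<sigma>3_def D_def S_def)
qed

lemma collect_step_sem:
  assumes loaded: "loaded A \<sigma>" and i: "fst \<sigma> seed_var \<le> n" and region: "stored n \<sigma> Region \<subseteq> A"
  shows "stored n (sem n (collect_step K) \<sigma>) Assembled = stored n \<sigma> Assembled \<union>
    (if fst \<sigma> seed_var \<in> stored n \<sigma> Region - stored n \<sigma> Bag
     then best (slots n \<sigma> (Suc n ^ K))
       (core.component (A - stored n \<sigma> Bag) (fst \<sigma> seed_var) \<inter> core.away (stored n \<sigma> Trace))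
     else {})"
proof -
  have "holds n \<sigma> (And (Member Region seed_var) (Neg (Member Bag seed_var))) \<longleftrightarrow>
      fst \<sigma> seed_var \<in> stored n \<sigma> Region - stored n \<sigma> Bag"
    using i by (simp add: read_iff_stored)
  then have "sem n (collect_step K) \<sigma> =
      (if fst \<sigma> seed_var \<in> stored n \<sigma> Region - stored n \<sigma> Bag then sem n (part_com K) \<sigma> else \<sigma>)"
    by (auto simp: collect_step_def holds_def)
  then show ?thesis using part_com_sem[OF loaded, of K] region by auto
qed

lemma collect_loop_sem:
  assumes loaded: "loaded A \<sigma>" and region: "stored n \<sigma> Region \<subseteq> A"
  shows "stored n (sem n (Loop seed_var (collect_step K)) \<sigma>) Assembled = stored n \<sigma> Assembled \<union>
    (\<Union>c\<in>stored n \<sigma> Region - stored n \<sigma> Bag. best (slots n \<sigma> (Suc n ^ K))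
      (core.component (A - stored n \<sigma> Bag) c \<inter> core.away (stored n \<sigma> Trace)))"
proof -
  define C where "C = stored n \<sigma> Region - stored n \<sigma> Bag"
  define T where "T c = best (slots n \<sigma> (Suc n ^ K))
    (core.component (A - stored n \<sigma> Bag) c \<inter> core.away (stored n \<sigma> Trace))" for c
  define Inv where "Inv i \<tau> \<longleftrightarrow> (\<forall>b. b \<notin> written (collect_step K) \<longrightarrow> snd \<tau> b = snd \<sigma> b) \<and>
    stored n \<tau> Assembled = stored n \<sigma> Assembled \<union> (\<Union>c\<in>{c \<in> C. c < i}. T c)" for i \<tau>
  have "Inv (Suc n) (sem n (Loop seed_var (collect_step K)) \<sigma>)"
  proof (rule Loop_rule)
    fix i \<tau> assume i: "i \<le> n" and inv: "Inv i \<tau>"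
    define \<tau>' where "\<tau>' = set_var seed_var i \<tau>"
    have unchanged: "snd \<tau>' b = snd \<sigma> b" if "b \<notin> written (collect_step K)" for b
      using inv that by (simp add: Inv_def \<tau>'_def)
    have "stored n \<tau>' b = stored n \<sigma> b" if "b \<notin> written (collect_step K)" for b
      using unchanged[OF that] by (rule stored_cong)
    moreover have "slots n \<tau>' N = slots n \<sigma> N" for N using unchanged[of Table] by (simp add: slots_def slot_def)
    moreover have "loaded A \<tau>'" "fst \<tau>' seed_var = i"
      using loaded unchanged by (simp add: loaded_def, simp add: \<tau>'_def)
    ultimately have "stored n (sem n (collect_step K) \<tau>') Assembled =
        stored n \<tau>' Assembled \<union> (if i \<in> C then T i else {})"
      using collect_step_sem[of \<tau>' K] i region by (simp add: C_def T_def del: Diff_iff)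
    moreover have "stored n \<tau>' Assembled = stored n \<sigma> Assembled \<union> (\<Union>c\<in>{c \<in> C. c < i}. T c)"
      using inv by (simp add: Inv_def \<tau>'_def stored_def)
    moreover have "(\<Union>c\<in>{c \<in> C. c < Suc i}. T c) = (\<Union>c\<in>{c \<in> C. c < i}. T c) \<union> (if i \<in> C then T i else {})"
      by (auto simp: less_Suc_eq split: if_splits)
    ultimately show "Inv (Suc i) (sem n (collect_step K) (set_var seed_var i \<tau>))"
      using unchanged by (simp add: Inv_def sem_unwritten Un_assoc flip: \<tau>'_def)
  qed (simp add: Inv_def)
  moreover have "{c \<in> C. c < Suc n} = C" by (auto simp: C_def stored_def)
  ultimately show ?thesis by (simp add: Inv_def C_def T_def)
qed

lemma collect_com_sem:
  assumes loaded: "loaded A \<sigma>" and bag: "stored n \<sigma> Bag = core.bag (insert p X)"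
    and region: "stored n \<sigma> Region = core.region X c \<inter> core.away (stored n \<sigma> Trace \<inter> core.bag X)"
  shows "stored n (sem n (collect_com K) \<sigma>) Assembled =
    core.assemble (slots n \<sigma> (Suc n ^ K)) X p c (stored n \<sigma> Trace)"
proof -
  define \<sigma>' where "\<sigma>' = sem n (Fill vertex_var Assembled (And (Member Trace vertex_var) (Member Region vertex_var))) \<sigma>"
  have "stored n \<sigma>' Assembled = {i. i \<le> n \<and> i \<in> stored n \<sigma> Trace \<and> i \<in> stored n \<sigma> Region}"
    unfolding \<sigma>'_def by (rule stored_Fill) (auto simp: read_iff_stored)
  also have "\<dots> = stored n \<sigma> Trace \<inter> stored n \<sigma> Region" by (auto simp: stored_def)
  finally have assembled: "stored n \<sigma>' Assembled = stored n \<sigma> Trace \<inter> stored n \<sigma> Region" .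
  have unchanged: "stored n \<sigma>' b = stored n \<sigma> b" if "b \<noteq> Assembled" for b
    using that by (simp add: \<sigma>'_def stored_unwritten)
  have "stored n \<sigma> Region \<subseteq> A" using region core.region_subset[of X c] by auto
  moreover have "loaded A \<sigma>'" "slots n \<sigma>' N = slots n \<sigma> N" for N
    using loaded by (simp_all add: \<sigma>'_def loaded_sem slots_unwritten)
  ultimately have "stored n (sem n (Loop seed_var (collect_step K)) \<sigma>') Assembled =
      core.assemble (slots n \<sigma> (Suc n ^ K)) X p c (stored n \<sigma> Trace)"
    using collect_loop_sem[of \<sigma>' K] assembled
    by (simp add: unchanged core.assemble_def Let_def flip: region bag)
  then show ?thesis by (simp add: collect_com_def \<sigma>'_def)
qed

end

subsection \<open>The table\<close>

definition decode :: "nat \<Rightarrow> nat \<Rightarrow> nat \<Rightarrow> nat list \<Rightarrow> nat code" where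
  "decode n q s g = (map (\<lambda>i. g ! (3 + i)) [0..<q], g ! 1, if g ! 2 < n then Some (g ! 2) else None,
     map (\<lambda>i. (g ! (3 + q + i), g ! (3 + q + s + i))) [0..<s])"

context core_graph
begin

definition listed :: "nat set list \<Rightarrow> store \<Rightarrow> bool" where
  "listed L \<sigma> \<longleftrightarrow> loaded A \<sigma> \<and> slots n \<sigma> (length L) = L \<and> fst \<sigma> end_var = length L * Suc n \<and>
     (\<forall>j \<ge> length L * Suc n. snd \<sigma> Table j = 0)"

lemma listed_sem:
  "listed L \<sigma> \<Longrightarrow> {Input, Core, Table} \<inter> written c = {} \<Longrightarrow> end_var \<notin> assigned c \<Longrightarrow> listed L (sem n c \<sigma>)"
  by (simp add: listed_def loaded_sem slots_unwritten sem_unwritten sem_unassigned)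

lemma best_slots:
  assumes "listed L \<sigma>" "length L \<le> N"
  shows "best (slots n \<sigma> N) = best L"
proof -
  have "slot n \<sigma> j = {}" if "length L \<le> j" for j
  proof -
    have "length L * Suc n \<le> j * Suc n + v" for v using mult_le_mono1[OF that, of "Suc n"] by linarith
    then show ?thesis using assms(1) by (simp add: listed_def slot_def)
  qed
  then have "map (slot n \<sigma>) [length L..<N] = replicate (N - length L) {}"
    by (intro nth_equalityI) auto
  moreover have "[0..<N] = [0..<length L] @ [length L..<N]"
    using assms(2) upt_add_eq_append[of 0 "length L" "N - length L"] by simp
  ultimately have "slots n \<sigma> N = L @ replicate (N - length L) {}"
    using assms(1) by (simp add: listed_def slots_def)
  then show ?thesis by (simp add: best_append_empty fun_eq_iff)
qed

lemma append_com_sem: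
  "fst (sem n append_com \<sigma>) end_var = fst \<sigma> end_var + Suc n"
  "snd (sem n append_com \<sigma>) Table j =
    (if fst \<sigma> end_var \<le> j \<and> j \<le> fst \<sigma> end_var + n then snd \<sigma> Assembled (j - fst \<sigma> end_var)
     else snd \<sigma> Table j)"
proof -
  define body where "body = Write Table (Plus (Var end_var) (Var vertex_var)) (Member Assembled vertex_var)"
  define Inv where "Inv i \<tau> \<longleftrightarrow> fst \<tau> end_var = fst \<sigma> end_var \<and> snd \<tau> Assembled = snd \<sigma> Assembled \<and>
    (\<forall>j. snd \<tau> Table j = (if fst \<sigma> end_var \<le> j \<and> j < fst \<sigma> end_var + i
      then snd \<sigma> Assembled (j - fst \<sigma> end_var) else snd \<sigma> Table j))" for i \<tau>
  have "Inv (Suc n) (sem n (Loop vertex_var body) \<sigma>)"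
    by (rule Loop_rule) (auto simp: Inv_def body_def array_write_def)
  then show "fst (sem n append_com \<sigma>) end_var = fst \<sigma> end_var + Suc n"
    "snd (sem n append_com \<sigma>) Table j =
      (if fst \<sigma> end_var \<le> j \<and> j \<le> fst \<sigma> end_var + n then snd \<sigma> Assembled (j - fst \<sigma> end_var)
       else snd \<sigma> Table j)"
    by (simp_all add: append_com_def body_def Inv_def less_Suc_eq_le)
qed

lemma append_com_listed:
  assumes listed: "listed L \<sigma>"
  shows "listed (L @ [stored n \<sigma> Assembled]) (sem n append_com \<sigma>)"
proof -
  define \<sigma>' where "\<sigma>' = sem n append_com \<sigma>"
  have end_var: "fst \<sigma> end_var = length L * Suc n" using listed by (simp add: listed_def)
  note append = append_com_sem[of \<sigma>, folded \<sigma>'_def, unfolded end_var]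
  have "slot n \<sigma>' j = slot n \<sigma> j" if "j < length L" for j
  proof -
    have "snd \<sigma>' Table (j * Suc n + v) = snd \<sigma> Table (j * Suc n + v)" if "v \<le> n" for v
    proof -
      have "j * Suc n + v < Suc j * Suc n" using that by simp
      also have "\<dots> \<le> length L * Suc n" using \<open>j < length L\<close> by (intro mult_le_mono1) simp
      finally show ?thesis unfolding append(2) by simp
    qed
    then show ?thesis by (auto simp: slot_def)
  qed
  then have "slots n \<sigma>' (length L) = slots n \<sigma> (length L)" by (simp add: slots_def)
  then have "slots n \<sigma>' (length L) = L" using listed by (simp add: listed_def)
  moreover have "slot n \<sigma>' (length L) = stored n \<sigma> Assembled"
    using append(2) by (auto simp: slot_def stored_def)
  moreover have "loaded A \<sigma>'" using listed by (simp add: \<sigma>'_def listed_def loaded_sem)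
  moreover have "snd \<sigma>' Table j = 0" if "Suc (length L) * Suc n \<le> j" for j
    using listed that append(2)[of j] by (simp add: listed_def)
  ultimately show ?thesis
    using append(1) unfolding \<sigma>'_def[symmetric] by (simp add: listed_def slots_def)
qed

lemma assemble_com_sem:
  assumes loaded: "loaded A \<sigma>"
    and digits: "\<And>i. i < 3 + q + 2 * s \<Longrightarrow> fst \<sigma> (Digit i) = g ! i \<and> g ! i \<le> n"
  shows "stored n (sem n (assemble_com q s K) \<sigma>) Assembled = core.step (slots n \<sigma> (Suc n ^ K)) (decode n q s g)"
proof -
  define X where "X = (\<lambda>i. g ! (3 + i)) ` {0..<q}"
  define c where "c = (if g ! 2 < n then Some (g ! 2) else None)"
  define M where "M = map (\<lambda>i. (g ! (3 + q + i), g ! (3 + q + s + i))) [0..<s]"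
  define \<sigma>1 where "\<sigma>1 = sem n (bag_com q) \<sigma>"
  define \<sigma>2 where "\<sigma>2 = sem n (trace_com q s) \<sigma>1"
  define \<sigma>3 where "\<sigma>3 = sem n region_com \<sigma>2"
  have loaded': "loaded A \<sigma>1" "loaded A \<sigma>2" "loaded A \<sigma>3"
    using loaded by (simp_all add: \<sigma>1_def \<sigma>2_def \<sigma>3_def loaded_sem)
  have digit: "fst \<sigma> (Digit i) = g ! i" "fst \<sigma>1 (Digit i) = g ! i" "fst \<sigma>2 (Digit i) = g ! i"
    if "i < 3 + q + 2 * s" for i
    using digits[OF that] by (simp_all add: \<sigma>1_def \<sigma>2_def sem_unassigned)
  have "(\<lambda>i. fst \<sigma> (Digit (3 + i))) ` {0..<q} = X" unfolding X_def by (rule image_cong) (simp_all add: digit)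
  then have bags: "stored n \<sigma>1 Sep_Bag = core.bag X" "stored n \<sigma>1 Bag = core.bag (insert (g ! 1) X)"
    using bag_com_sem[OF loaded, of q] by (simp_all add: \<sigma>1_def digit)
  have "stored n \<sigma>2 Trace = core.trace (stored n \<sigma>1 Bag)
      (map (\<lambda>i. (fst \<sigma>1 (Digit (3 + q + i)), fst \<sigma>1 (Digit (3 + q + s + i)))) [0..<s])"
    unfolding \<sigma>2_def by (rule trace_com_sem[OF loaded'(1)]) (use digits digit in auto)
  also have "map (\<lambda>i. (fst \<sigma>1 (Digit (3 + q + i)), fst \<sigma>1 (Digit (3 + q + s + i)))) [0..<s] = M"
    unfolding M_def by (rule map_cong) (simp_all add: digit)
  finally have trace: "stored n \<sigma>2 Trace = core.trace (core.bag (insert (g ! 1) X)) M" using bags by simp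
  have later: "stored n \<sigma>2 Sep_Bag = core.bag X" "stored n \<sigma>3 Bag = core.bag (insert (g ! 1) X)"
    "stored n \<sigma>3 Trace = stored n \<sigma>2 Trace" "slots n \<sigma>3 N = slots n \<sigma> N" for N
    using bags by (simp_all add: \<sigma>1_def \<sigma>2_def \<sigma>3_def stored_unwritten slots_unwritten)
  have "stored n \<sigma>3 Region = core.region X c \<inter> core.away (stored n \<sigma>3 Trace \<inter> core.bag X)"
    using region_com_sem[OF loaded'(2) later(1)] unfolding \<sigma>3_def[symmetric] by (simp add: later digit c_def)
  from collect_com_sem[OF loaded'(3) later(2) this, of K]
  have "stored n (sem n (assemble_com q s K) \<sigma>) Assembled =
      core.assemble (slots n \<sigma> (Suc n ^ K)) X (g ! 1) c (stored n \<sigma>2 Trace)"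
    by (simp add: assemble_com_def \<sigma>1_def \<sigma>2_def \<sigma>3_def later[unfolded \<sigma>3_def \<sigma>2_def \<sigma>1_def])
  then show ?thesis by (simp add: core.step_def decode_def X_def c_def M_def trace)
qed

lemma step_cong: "best L = best L' \<Longrightarrow> core.step L = core.step L'"
  by (simp add: core.step_def core.assemble_def fun_eq_iff)

lemma step_com_sem:
  assumes listed: "listed L \<sigma>" and len: "length L \<le> Suc n ^ K"
    and digits: "\<And>i. i < 3 + q + 2 * s \<Longrightarrow> fst \<sigma> (Digit i) = g ! i \<and> g ! i \<le> n"
  shows "listed (L @ [core.step L (decode n q s g)]) (sem n (step_com q s K) \<sigma>)"
proof -
  have "stored n (sem n (assemble_com q s K) \<sigma>) Assembled = core.step (slots n \<sigma> (Suc n ^ K)) (decode n q s g)"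
    by (rule assemble_com_sem) (use listed digits in \<open>auto simp: listed_def\<close>)
  also have "core.step (slots n \<sigma> (Suc n ^ K)) = core.step L"
    by (rule step_cong) (rule best_slots[OF listed len])
  moreover have "listed L (sem n (assemble_com q s K) \<sigma>)" by (rule listed_sem[OF listed]) auto
  ultimately show ?thesis using append_com_listed by (fastforce simp: step_com_def)
qed

lemma nest_step_com_sem:
  assumes "listed [] \<sigma>" "K = 3 + q + 2 * s"
  shows "listed (core.run [] (map (decode n q s) (tuples n K))) (sem n (nest Digit K (step_com q s K)) \<sigma>)"
proof -
  define F where "F \<tau> g = sem n (step_com q s K) (set_vars Digit g \<tau>)" for \<tau> g
  have "listed (core.run [] (map (decode n q s) (tuples n K))) (foldl F \<sigma> (tuples n K))"
  proof (rule foldl_invariant[where Inv = "\<lambda>pre. listed (core.run [] (map (decode n q s) pre))"])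
    fix pre g post \<tau>
    assume split: "tuples n K = pre @ g # post" and listed: "listed (core.run [] (map (decode n q s) pre)) \<tau>"
    have g: "length g = K" "set g \<subseteq> {..n}" using set_tuples[of n K] split by auto
    have "listed (core.run [] (map (decode n q s) pre)) (set_vars Digit g \<tau>)"
      using listed by (simp add: listed_def slots_def loaded_def set_vars_other image_iff)
    moreover have "length (core.run [] (map (decode n q s) pre)) \<le> Suc n ^ K"
      using length_tuples[of n K] split by (simp add: core.length_run)
    moreover have "fst (set_vars Digit g \<tau>) (Digit i) = g ! i \<and> g ! i \<le> n" if "i < 3 + q + 2 * s" for i
    proof -
      have i: "i < length g" using that g(1) assms(2) by simp
      then have "g ! i \<in> {..n}" using g(2) nth_mem by blast
      then show ?thesis using i by (simp add: set_vars_nth inj_on_def)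
    qed
    ultimately show "listed (core.run [] (map (decode n q s) (pre @ [g]))) (F \<tau> g)"
      unfolding F_def using step_com_sem by simp
  qed (use assms(1) in simp)
  moreover have "sem n (nest Digit K (step_com q s K)) \<sigma> = foldl F \<sigma> (tuples n K)"
    unfolding F_def by (rule sem_nest) (auto simp: inj_on_def step_com_def)
  ultimately show ?thesis by simp
qed

lemma finish_com_sem:
  assumes listed: "listed L \<sigma>" and len: "length L = Suc n ^ K" and S: "S \<subseteq> {..<n}"
    and greedy: "\<And>i. 0 < snd \<sigma> Greedy i \<longleftrightarrow> i \<in> S"
  shows "{v. v < n \<and> snd (sem n (finish_com K) \<sigma>) Input v = 1} = S \<union> best L A"
proof -
  define e where "e = Cond (Or (Member Greedy vertex_var) (Member Best vertex_var)) (Num 1) (Num 0)"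
  define \<sigma>1 where "\<sigma>1 = sem n (Fill vertex_var Target (Member Core vertex_var)) \<sigma>"
  define \<sigma>2 where "\<sigma>2 = sem n (best_com K) \<sigma>1"
  have "stored n \<sigma>1 Target = {i. i \<le> n \<and> i \<in> A}"
    unfolding \<sigma>1_def by (rule stored_Fill) (use listed in \<open>simp_all add: listed_def\<close>)
  also have "\<dots> = A" using core_le by auto
  finally have target: "stored n \<sigma>1 Target = A" .
  have "listed L \<sigma>1" unfolding \<sigma>1_def by (rule listed_sem[OF listed]) auto
  then have best: "stored n \<sigma>2 Best = best L A"
    using len by (simp add: \<sigma>2_def best_com_sem target best_slots)
  have greedy2: "0 < snd \<sigma>2 Greedy i \<longleftrightarrow> i \<in> S" for i
    using greedy by (simp add: \<sigma>1_def \<sigma>2_def sem_unwritten)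
  define Inv where "Inv i \<tau> \<longleftrightarrow> (\<forall>b. b \<noteq> Input \<longrightarrow> snd \<tau> b = snd \<sigma>2 b) \<and>
    (\<forall>v<i. v < n \<longrightarrow> snd \<tau> Input v = (if v \<in> S \<union> best L A then 1 else 0))"
    for i and \<tau> :: store
  have "Inv (Suc n) (sem n (Loop vertex_var (Write Input (Var vertex_var) e)) \<sigma>2)"
  proof (rule Loop_rule)
    fix i \<tau> assume i: "i \<le> n" and inv: "Inv i \<tau>"
    have "expr_val n (set_var vertex_var i \<tau>) e = (if i \<in> S \<union> best L A then 1 else 0)"
      using inv greedy2 best read_iff_stored[OF i, of \<sigma>2 Best]
      by (simp add: e_def Inv_def Or_def)
    moreover have "i < n * n" if "i < n" using that by (cases n) auto
    ultimately show "Inv (Suc i) (sem n (Write Input (Var vertex_var) e) (set_var vertex_var i \<tau>))"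
      using inv by (auto simp: Inv_def array_write_def less_Suc_eq not_le)
  qed (simp add: Inv_def)
  then have "snd (sem n (finish_com K) \<sigma>) Input v = (if v \<in> S \<union> best L A then 1 else 0)" if "v < n" for v
    using that by (simp add: Inv_def finish_com_def \<sigma>1_def \<sigma>2_def e_def)
  moreover have "S \<union> best L A \<subseteq> {..<n}" using S A_subset best_subset[of L A] by blast
  ultimately show ?thesis by (auto split: if_splits)
qed

end

section \<open>Running time\<close>

lemma expr_exponent_Some_of:
  "(\<And>x. x \<in> set xs \<Longrightarrow> expr_exponent (f x) = w) \<Longrightarrow>
    expr_exponent (Some_of (map f xs)) = length xs * (w + 2)"
  unfolding Some_of_def by (induction xs) (simp_all add: Or_def)

lemma expr_exponent_All_of:
  "(\<And>x. x \<in> set xs \<Longrightarrow> expr_exponent (f x) = w) \<Longrightarrow>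
    expr_exponent (All_of (map f xs)) = length xs * (w + 3)"
  unfolding All_of_def by (induction xs) (simp_all add: And_def)

lemmas exponent_defs = Fill_def And_def Or_def Neg_def Less_def Equal_def Exists_def Count_def Bound_def Size_def
  Adjacent_def Core_adjacent_def Outside_def Apart_def Near_def Keeps_def Seed_def Entry_def Improves_def
  sweep_com_def reach_com_def

lemma com_exponent_algorithm:
  "com_exponent (algorithm t) = 1707 + 107 * separator_size t + 214 * trace_size t"
proof -
  define q where "q = separator_size t"
  define s where "s = trace_size t"
  define K where "K = code_length t"
  have "expr_exponent (Some_of (map (\<lambda>i. Near (Digit (3 + i))) [0..<q])) = 74 * q"
    by (subst expr_exponent_Some_of[where w = 72]) (simp_all add: exponent_defs)
  then have "com_exponent (bag_com q) = 130 + 74 * q"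
    by (simp add: bag_com_def Fill_def And_def) (simp add: exponent_defs)
  moreover have "expr_exponent (All_of (map (\<lambda>i. Keeps (Digit (3 + q + i)) (Digit (3 + q + s + i))) [0..<s])) = 148 * s"
    by (subst expr_exponent_All_of[where w = 145]) (simp_all add: exponent_defs)
  then have "com_exponent (trace_com q s) = 120 + 148 * s"
    by (simp add: trace_com_def Fill_def And_def) (simp add: exponent_defs)
  moreover have "com_exponent region_com = 330" by (simp add: region_com_def exponent_defs)
  moreover have best: "com_exponent (best_com K) = 153 + 11 * K"
    by (simp add: best_com_def best_step_def com_exponent_nest exponent_defs)
  moreover have "com_exponent (collect_com K) = 525 + 11 * K"
    by (simp add: collect_com_def collect_step_def part_com_def best exponent_defs)
  moreover have "com_exponent append_com = 43" by (simp add: append_com_def exponent_defs)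
  moreover have "com_exponent (finish_com K) = 209 + 11 * K" by (simp add: finish_com_def best exponent_defs)
  moreover have "com_exponent reduce_com = 245" by (simp add: reduce_com_def reduce_step_def exponent_defs)
  ultimately show ?thesis
    by (simp add: algorithm_def step_com_def assemble_com_def com_exponent_nest q_def s_def K_def code_length_def)
qed

lemma com_exponent_algorithm_le:
  assumes "1 \<le> t"
  shows "com_exponent (algorithm t) + 9 \<le> 14000 * t ^ 5"
proof -
  have le: "t ^ j \<le> t ^ 5" if "j \<le> 5" for j using assms that by (rule power_increasing[rotated])
  have "com_exponent (algorithm t) + 9 = 1716 * t ^ 0 + 321 * t ^ 1 + 2782 * t ^ 2 + 8346 * t ^ 3"
    by (simp add: com_exponent_algorithm separator_size_def trace_size_def algebra_simps power2_eq_square power3_eq_cube)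
  also have "\<dots> \<le> 14000 * t ^ 5" using le[of 0] le[of 1] le[of 2] le[of 3] by linarith
  finally show ?thesis .
qed

section \<open>Correctness\<close>

definition round_codes :: "nat \<Rightarrow> nat \<Rightarrow> nat code list" where
  "round_codes n t = map (\<lambda>g. decode n (separator_size t) (trace_size t) (0 # g))
     (tuples n (2 + separator_size t + 2 * trace_size t))"

lemma decode_first_digit: "decode n q s (i # g) = decode n q s (j # g)"
  by (simp add: decode_def numeral_3_eq_3 numeral_2_eq_2)

lemma map_decode_tuples:
  "map (decode n (separator_size t) (trace_size t)) (tuples n (code_length t)) =
     concat (replicate (Suc n) (round_codes n t))"
proof -
  have "code_length t = Suc (2 + separator_size t + 2 * trace_size t)" by (simp add: code_length_def)
  then have "map (decode n (separator_size t) (trace_size t)) (tuples n (code_length t)) =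
      concat (map (\<lambda>i. map (\<lambda>g. decode n (separator_size t) (trace_size t) (i # g))
        (tuples n (2 + separator_size t + 2 * trace_size t))) [0..<Suc n])"
    by (simp only: tuples.simps(2) map_concat map_map o_def)
  also have "\<dots> = concat (map (\<lambda>i. round_codes n t) [0..<Suc n])"
    unfolding round_codes_def by (intro arg_cong[where f = concat] map_cong refl decode_first_digit)
  finally show ?thesis by (simp add: map_replicate_const del: upt_Suc)
qed

lemma in_round_codes:
  assumes "length X = separator_size t" "length M = trace_size t" "insert p (set X) \<subseteq> {..n}"
    "set M \<subseteq> {..n} \<times> {..n}" "set_option c \<subseteq> {..<n}"
  shows "(X, p, c, M) \<in> set (round_codes n t)"
proof -
  define g where "g = p # (case c of None \<Rightarrow> n | Some c \<Rightarrow> c) # X @ map fst M @ map snd M"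
  have "set g \<subseteq> {..n}" using assms by (auto simp: g_def split: option.splits)
  then have "g \<in> set (tuples n (2 + separator_size t + 2 * trace_size t))"
    unfolding set_tuples using assms(1,2) by (simp add: g_def)
  moreover have "decode n (separator_size t) (trace_size t) (0 # g) = (X, p, c, M)"
  proof -
    have "map (\<lambda>i. (0 # g) ! (3 + i)) [0..<separator_size t] = X"
      using assms(1) by (intro nth_equalityI) (auto simp: g_def nth_append numeral_3_eq_3)
    moreover have "map (\<lambda>i. ((0 # g) ! (3 + separator_size t + i),
        (0 # g) ! (3 + separator_size t + trace_size t + i))) [0..<trace_size t] = M"
      using assms(1,2) by (intro nth_equalityI) (auto simp: g_def nth_append numeral_3_eq_3)
    moreover have "(0 # g) ! 1 = p" "(if (0 # g) ! 2 < n then Some ((0 # g) ! 2) else None) = c"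
      using assms(5) by (auto simp: g_def numeral_2_eq_2 split: option.splits)
    ultimately show ?thesis by (simp only: decode_def)
  qed
  ultimately show ?thesis unfolding round_codes_def by (metis image_eqI image_set)
qed

context core_graph
begin

lemma best_rounds_maximum_independent_set:
  assumes free: "\<not> induced_minor (friendship_graph t) ({..<n}, E)" and stable: "stable A"
  shows "maximum_independent_set (induced_subgraph ({..<n}, E) A) (best (core.rounds (round_codes n t) (Suc n)) A)"
proof -
  interpret min_degree_two_friendship_free "induced_subgraph ({..<n}, E) A" t n
  proof
    show "\<not> induced_minor (friendship_graph t) (induced_subgraph ({..<n}, E) A)"
      using free A_subset induced_minor_induced_subgraph[OF simple] by (metis fst_conv)
    show "n \<notin> fst (induced_subgraph ({..<n}, E) A)" using A_subset by auto
    fix p assume "p \<in> fst (induced_subgraph ({..<n}, E) A)"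
    then have "p \<in> A" by simp
    moreover from this have "{w. core.adj p w} = {w \<in> A. adj p w}"
      using A_subset by (auto simp: adj_induced_subgraph)
    ultimately show "2 \<le> core.degree p" using stable by (simp add: stable_def core.degree_def)
  qed
  have "g \<in> set (round_codes n t)" if "valid_code g" for g
  proof -
    obtain X p c M where "g = (X, p, c, M)" by (cases g)
    moreover have "insert n A \<subseteq> {..n}" using A_subset by auto
    ultimately show ?thesis using that A_subset unfolding valid_code_def
      by (auto intro!: in_round_codes)
  qed
  moreover have "card A \<le> n" using card_mono[OF finite_lessThan A_subset] by simp
  ultimately show ?thesis using rounds_maximum_independent_set by simp
qed

end

theorem algorithm_correct:
  assumes G: "simple_graph ({..<n}, E)" and free: "\<not> induced_minor (friendship_graph t) ({..<n}, E)"
  shows "maximum_independent_set ({..<n}, E) {v. v < n \<and> snd (sem n (algorithm t) (input_store n E)) Input v = 1}"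
proof -
  interpret input_graph n E by unfold_locales (rule G)
  define q where "q = separator_size t"
  define s where "s = trace_size t"
  define K where "K = code_length t"
  define \<sigma>1 where "\<sigma>1 = sem n reduce_com (input_store n E)"
  define \<sigma>2 where "\<sigma>2 = sem n (nest Digit K (step_com q s K)) \<sigma>1"
  obtain A S where A: "reduction_state A S \<sigma>1" "stable A" unfolding \<sigma>1_def using reduce_com_sem by blast
  then have red: "reduced A S" by (simp add: reduction_state_def)
  interpret core_graph n E A by unfold_locales (rule reduced_le[OF red])
  have K: "K = 3 + q + 2 * s" by (simp add: K_def code_length_def q_def s_def)
  have "written reduce_com = {Core, Greedy}" "end_var \<notin> assigned reduce_com"
    by (auto simp: reduce_com_def reduce_step_def)
  then have "listed [] \<sigma>1"
    using A(1) by (simp add: listed_def reduction_state_def slots_def \<sigma>1_def sem_unwritten sem_unassigned input_store_def)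
  from nest_step_com_sem[OF this K]
  have listed: "listed (core.rounds (round_codes n t) (Suc n)) \<sigma>2"
    unfolding \<sigma>2_def core.rounds_def map_decode_tuples[symmetric] by (simp only: q_def s_def K_def)
  have "length (core.rounds (round_codes n t) (Suc n)) = Suc n ^ K"
    unfolding core.rounds_def map_decode_tuples[symmetric]
    by (simp add: core.length_run length_tuples K_def)
  moreover have "0 < snd \<sigma>2 Greedy i \<longleftrightarrow> i \<in> S" for i
    using A(1) by (simp add: \<sigma>2_def reduction_state_def sem_unwritten step_com_def)
  moreover have "S \<subseteq> {..<n}" using red by (simp add: reduced_def independent_set_def)
  ultimately have "{v. v < n \<and> snd (sem n (algorithm t) (input_store n E)) Input v = 1} =
      S \<union> best (core.rounds (round_codes n t) (Suc n)) A"
    using finish_com_sem[OF listed, of K S] by (simp add: algorithm_def \<sigma>1_def \<sigma>2_def q_def s_def K_def)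
  then show ?thesis
    using reduced_maximum_independent_set[OF red best_rounds_maximum_independent_set[OF free A(2)]] by simp
qed

theorem theorem1p1:
  shows "\<exists>C::nat. \<forall>t::nat. t \<ge> 1 \<longrightarrow>
    (\<exists>P::prog. \<forall>(n::nat) (E::nat set set).
       simple_graph ({..<n}, E) \<and> \<not> induced_minor (friendship_graph t) ({..<n}, E) \<longrightarrow>
       (\<exists>k s. exec P (graph_input n E) k s \<and>
              k \<le> (max n 2) ^ (C * t ^ 5) \<and>
              maximum_independent_set ({..<n}, E) (set_output n s)))"
proof (intro exI[of _ 14000] allI impI)
  fix t :: nat assume t: "t \<ge> 1"
  show "\<exists>P. \<forall>n (E::nat set set).
      simple_graph ({..<n}, E) \<and> \<not> induced_minor (friendship_graph t) ({..<n}, E) \<longrightarrow>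
      (\<exists>k s. exec P (graph_input n E) k s \<and> k \<le> max n 2 ^ (14000 * t ^ 5) \<and>
        maximum_independent_set ({..<n}, E) (set_output n s))"
  proof (intro exI[of _ "compiled (algorithm t)"] allI impI)
    fix n and E :: "nat set set"
    assume G: "simple_graph ({..<n}, E) \<and> \<not> induced_minor (friendship_graph t) ({..<n}, E)"
    obtain k s where run: "exec (compiled (algorithm t)) (graph_input n E) k s"
      and k: "k \<le> max n 2 ^ (com_exponent (algorithm t) + 9)"
      and out: "set_output n s = {v. v < n \<and> snd (sem n (algorithm t) (input_store n E)) Input v = 1}"
      using compiled_correct by blast
    have "k \<le> max n 2 ^ (14000 * t ^ 5)"
      using k com_exponent_algorithm_le[OF t] by (rule power_le_power) simp
    moreover have "maximum_independent_set ({..<n}, E) (set_output n s)"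
      unfolding out using G by (intro algorithm_correct) auto
    ultimately show "\<exists>k s. exec (compiled (algorithm t)) (graph_input n E) k s \<and>
        k \<le> max n 2 ^ (14000 * t ^ 5) \<and> maximum_independent_set ({..<n}, E) (set_output n s)"
      using run by blast
  qed
qed

end
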